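(* Let $d \ge 2$ be an integer, let $A$ be a real $(d\times d)$ matrix, and let $\alpha = (\alpha_1,\dots,\alpha_d) \in (0,1]^d$ be such that not all $\alpha_k$ are equal and all quotients $\alpha_k/\tilde\alpha$ ($k=1,\dots,d$) are rational, where $\tilde\alpha := \max_{k=1,\dots,d}\alpha_k$. For each $k$ write $\alpha_k = \tilde\alpha\, r_k/s_k$ with positive integers $r_k \le s_k$, $\gcd(r_k,s_k)=1$; let $\sigma$ be the least common multiple of $s_1,\dots,s_d$, and put $q_k := r_k\sigma/s_k \in \{1,2,\dots,\sigma\}$, so that $\alpha_k = \tilde\alpha\, q_k/\sigma$. Put $q_0 := 0$, $A_0 := -A$ and $A_j := e_j e_j^{\mathrm T}$ for $j=1,\dots,d$, where $e_j$ is the $j$-th coordinate unit (column) vector of $\mathbb R^d$, and define the matrix polynomial $$p(\mu) = \sum_{j=0}^d A_j \mu^{q_j}.$$ Then the following three statements are equivalent: (a) The differential equation system $D^\alpha x(t) = A x(t)$ is not asymptotically stable. (b) The characteristic function $\chi(\lambda) = \det(\operatorname{diag}(\lambda^{\alpha_1},\dots,\lambda^{\alpha_d}) - A)$ of this system has a zero $\lambda\in\mathbb C$ with $|\arg(\lambda)| \le \pi/2$. (c) There exists some $\mu\in\mathbb C$ with $|\arg(\mu)| \le \pi\tilde\alpha/(2\sigma)$ for which the linear equation system $p(\mu)v = 0$ has a nontrivial solution $v \ne 0$, $v\in\mathbb C^d$.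
   Context: Fractional derivatives: for $x=(x_1,\dots,x_d)^{\mathrm T}:[0,\infty)\to\mathbb R^d$, $D^\alpha x(t) = (D^{\alpha_1}x_1(t),\dots,D^{\alpha_d}x_d(t))^{\mathrm T}$. Here $D^1 y = y'$ is the classical first derivative, and for $0<\beta<1$, $D^\beta y(t) = D^1 J^{1-\beta}[y-y(0)](t)$ is the Caputo derivative of order $\beta$ with starting point $0$, where $J^{1-\beta}y(t) = \frac{1}{\Gamma(1-\beta)}\int_0^t (t-\tau)^{-\beta}y(\tau)\,d\tau$ is the Riemann-Liouville integral. Solutions and stability: a solution of $D^\alpha x(t)=Ax(t)$ is a continuous function $x:[0,\infty)\to\mathbb R^d$ for which $D^\alpha x(t)$ exists and the equation holds for $t>0$. The system is called asymptotically stable if every solution $x$ (no matter which initial value $x(0)\in\mathbb R^d$ it has) satisfies $\lim_{t\to\infty}x(t)=0$. Complex powers: noninteger powers are taken in the principal branch, $z^\beta = |z|^\beta\exp(\mathrm i\beta\arg(z))$ with $\arg(z)\in(-\pi,\pi]$ for $z\neq 0$, and $0^\beta=0$ for $\beta>0$; $\mu^0=1$ for all $\mu\in\mathbb C$. The point $0$ is regarded as satisfying $|\arg(0)|\le c$ for every $c\ge 0$ (i.e. convention $\arg(0)=0$), so that for $\lambda\in\mathbb C$ the condition $|\arg(\lambda)|\le\pi/2$ means exactly $\operatorname{Re}\lambda\ge 0$. *)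

theory Defs
  imports "HOL-Analysis.Analysis"
begin

definition riemann_liouville :: "real \<Rightarrow> (real \<Rightarrow> real) \<Rightarrow> real \<Rightarrow> real" where
  "riemann_liouville \<gamma> y t =
     1 / Gamma \<gamma> * integral {0..t} (\<lambda>\<tau>. (t - \<tau>) powr (\<gamma> - 1) * y \<tau>)"

text \<open>
  Caputo derivative of order \<open>\<beta> \<in> (0,1]\<close> with starting point 0, as a relation:
  the derivative exists at the point \<open>t\<close> and has the value \<open>D\<close>.
  Used only at \<open>t > 0\<close>, where the values of \<open>y\<close> at negative arguments are irrelevant.
\<close>

definition has_caputo_derivative ::
    "(real \<Rightarrow> real) \<Rightarrow> real \<Rightarrow> real \<Rightarrow> real \<Rightarrow> bool" where
  "has_caputo_derivative y \<beta> D t \<longleftrightarrow>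
     (if \<beta> = 1 then (y has_real_derivative D) (at t)
      else (riemann_liouville (1 - \<beta>) (\<lambda>\<tau>. y \<tau> - y 0) has_real_derivative D) (at t))"

definition has_frac_derivative ::
    "(real \<Rightarrow> real ^ 'n) \<Rightarrow> real ^ 'n \<Rightarrow> real ^ 'n \<Rightarrow> real \<Rightarrow> bool" where
  "has_frac_derivative x \<alpha> D t \<longleftrightarrow>
     (\<forall>k. has_caputo_derivative (\<lambda>\<tau>. x \<tau> $ k) (\<alpha> $ k) (D $ k) t)"

text \<open>
  A function on \<open>[0,\<infinity>)\<close> is represented by a total function on the reals whose values
  at negative arguments play no role.
\<close>

definition frac_solution ::
    "real ^ 'n \<Rightarrow> real ^ 'n ^ 'n \<Rightarrow> (real \<Rightarrow> real ^ 'n::finite) \<Rightarrow> bool" where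
  "frac_solution \<alpha> A x \<longleftrightarrow>
     continuous_on {0..} x \<and> (\<forall>t>0. has_frac_derivative x \<alpha> (A *v x t) t)"

definition asymptotically_stable :: "real ^ 'n \<Rightarrow> real ^ 'n ^ 'n::finite \<Rightarrow> bool" where
  "asymptotically_stable \<alpha> A \<longleftrightarrow> (\<forall>x. frac_solution \<alpha> A x \<longrightarrow> (x \<longlongrightarrow> 0) at_top)"

definition diag_matrix :: "('n \<Rightarrow> 'a::zero) \<Rightarrow> 'a ^ 'n ^ 'n::finite" where
  "diag_matrix f = (\<chi> i j. if i = j then f i else 0)"

text \<open>
  The complex \<open>powr\<close> uses the principal branch and \<open>0 powr b = 0\<close>.
\<close>

definition char_fun :: "real ^ 'n \<Rightarrow> real ^ 'n ^ 'n::finite \<Rightarrow> complex \<Rightarrow> complex" where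
  "char_fun \<alpha> A z =
     det (diag_matrix (\<lambda>k. z powr complex_of_real (\<alpha> $ k)) - map_matrix complex_of_real A)"

definition unit_matrix :: "'n \<Rightarrow> real ^ 'n ^ 'n::finite" where
  "unit_matrix j = (columnvector (axis j 1) :: real ^ 1 ^ 'n) ** rowvector (axis j 1)"

text \<open>
  The first summand is the term with index 0, whose exponent is \<open>q\<^sub>0 = 0\<close> and whose
  coefficient is \<open>A\<^sub>0 = - A\<close>; the indices \<open>1, \<dots>, d\<close> are the elements of the type \<open>'n\<close>.
\<close>

definition matrix_poly ::
    "real ^ 'n ^ 'n \<Rightarrow> ('n \<Rightarrow> nat) \<Rightarrow> complex \<Rightarrow> complex ^ 'n ^ 'n::finite" where
  "matrix_poly A q \<mu> =
     map_matrix (\<lambda>a. complex_of_real a * \<mu> ^ 0) (- A) +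
     (\<Sum>j\<in>UNIV. map_matrix (\<lambda>a. complex_of_real a * \<mu> ^ q j) (unit_matrix j))"

end

theory Submission
  imports
    Defs
    "HOL-Probability.Characteristic_Functions"
    "HOL-Complex_Analysis.Cauchy_Integral_Theorem"
begin

text \<open>
The equivalence of the conditions on the characteristic function and on the matrix polynomial is a
substitution. With \<open>\<delta> = \<alpha>max / \<sigma>\<close> one has \<open>\<alpha>\<^sub>k = \<delta> q\<^sub>k\<close>, so \<open>\<mu> = z\<^sup>\<delta>\<close> turns the characteristic matrix
\<open>diag (z\<^sup>\<alpha>\<^sup>k) - A\<close> into \<open>p(\<mu>)\<close>. Since \<open>\<delta> \<le> 1\<close>, no argument leaves the principal branch, and the closed
right half-plane corresponds exactly to the sector \<open>\<bar>Arg \<mu>\<bar> \<le> \<pi> \<delta> / 2\<close>.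

The analytic part is the stability criterion: all solutions decay iff \<open>\<chi>\<close> has no zero in the closed
right half-plane. A system of Caputo equations is the same as the system of Volterra equations
\<open>x\<^sub>k = x\<^sub>k(0) + J\<^sup>\<alpha>\<^sup>k (A x)\<^sub>k\<close> (\<open>caputo_iff_volterra\<close>), because \<open>J\<^sup>a J\<^sup>b = J\<^sup>a\<^sup>+\<^sup>b\<close>. In a
suitable exponentially weighted norm the map \<open>x \<mapsto> (J\<^sup>\<alpha>\<^sup>k (A x)\<^sub>k)\<^sub>k\<close> is a contraction. This gives a
solution for every initial value, and an exponential bound for every solution, so that the Laplace
transform \<open>X\<close> exists for \<open>Re s\<close> large and satisfies
\<open>(diag (s\<^sup>\<alpha>\<^sup>k) - A) X(s) = (s\<^sup>\<alpha>\<^sup>k\<^sup>-\<^sup>1 x\<^sub>k(0))\<^sub>k\<close> (\<open>laplace_volterra_solution\<close>).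

Suppose that \<open>\<chi>(z) = 0\<close> with \<open>Re z \<ge> 0\<close>, and that all solutions decay. If \<open>z = 0\<close>, a kernel vector of \<open>A\<close>
is a constant solution. Otherwise take a left kernel vector \<open>w\<close> of the characteristic matrix at \<open>z\<close>,
multiply the equation for \<open>X\<close> by \<open>w\<close> at \<open>s = z + \<epsilon>\<close>, and let \<open>\<epsilon>\<close> tend to 0. The matrix factor is
\<open>O(\<epsilon>)\<close> and \<open>\<epsilon> X(z + \<epsilon>)\<close> tends to 0 since the solution does (\<open>abelian_laplace\<close>); hence
\<open>\<Sum>\<^sub>k w\<^sub>k z\<^sup>\<alpha>\<^sup>k\<^sup>-\<^sup>1 x\<^sub>k(0) = 0\<close> for every initial value, and \<open>w = 0\<close>.

Suppose that \<open>\<chi>\<close> has no such zero. Then the equation for \<open>X\<close> can be solved on the whole closed half-plane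
without the origin. The function \<open>F\<^sub>k(s) = X\<^sub>k(s) - x\<^sub>k(0) / (s + 1)\<close> is the transform of
\<open>x\<^sub>k(t) - x\<^sub>k(0) exp (- t)\<close>, and with \<open>a = min \<alpha>\<^sub>k\<close> it is \<open>O(\<bar>s\<bar>\<^sup>a\<^sup>-\<^sup>1)\<close> at 0 and \<open>O(\<bar>s\<bar>\<^sup>-\<^sup>1\<^sup>-\<^sup>a)\<close> at infinity
(\<open>resolvent_solution_bound\<close>), hence integrable along vertical lines, uniformly up to the imaginary
axis. Fourier inversion on a line far to the right, followed by a shift of the line to the imaginary
axis, represents \<open>x\<^sub>k(t) - x\<^sub>k(0) exp (- t)\<close> as the Fourier integral of an integrable function, and
the Riemann-Lebesgue lemma shows that it tends to 0 (\<open>inverse_laplace_tendsto_zero\<close>).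
\<close>

(* The dollar sign denotes vector components throughout, not coefficients of power series. *)
no_notation fps_nth (infixl "$" 75)


section \<open>Causal convolutions and the Riemann-Liouville kernel\<close>

text \<open>
All functions live on the whole real line and vanish on the negative axis, so that the convolution
over \<open>[0,t]\<close> becomes an integral over \<open>\<real>\<close>. Fubini's theorem and translations then apply without any
bookkeeping of integration limits.
\<close>

definition conv :: "(real \<Rightarrow> 'a) \<Rightarrow> (real \<Rightarrow> 'a) \<Rightarrow> real \<Rightarrow>
    'a::{real_normed_field,banach,second_countable_topology}"
  where "conv f g t = (LINT u|lborel. f u * g (t - u))"

text \<open>
Convolution with this kernel is the Riemann-Liouville integral of order \<open>b\<close>. It is needed for
every \<open>b > 0\<close>: \<open>b = 1\<close> is ordinary integration.
\<close>

definition frac_kernel :: "real \<Rightarrow> real \<Rightarrow> real" where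
  "frac_kernel b u = (if u > 0 then u powr (b - 1) / Gamma b else 0)"

definition causal :: "(real \<Rightarrow> 'a) \<Rightarrow> real \<Rightarrow> 'a::zero" where
  "causal h u = (if 0 \<le> u then h u else 0)"

lemma frac_kernel_nonpos [simp]: "u \<le> 0 \<Longrightarrow> frac_kernel b u = 0"
  by (simp add: frac_kernel_def)

lemma frac_kernel_nonneg: "b > 0 \<Longrightarrow> 0 \<le> frac_kernel b u"
  by (simp add: frac_kernel_def Gamma_real_pos less_imp_le)

lemma measurable_frac_kernel [measurable]: "frac_kernel b \<in> borel_measurable borel"
  unfolding frac_kernel_def[abs_def] by measurable

lemma causal_neg [simp]: "u < 0 \<Longrightarrow> causal h u = 0"
  by (simp add: causal_def)

lemma causal_nonneg [simp]: "0 \<le> u \<Longrightarrow> causal h u = h u"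
  by (simp add: causal_def)

lemma isCont_causal:
  fixes h :: "real \<Rightarrow> 'a::real_normed_vector"
  assumes "continuous_on {0..} h" "u \<noteq> 0"
  shows "isCont (causal h) u"
proof (cases "u < 0")
  case True
  have "continuous_on {..<0} (causal h)"
    by (rule continuous_on_eq[of _ "\<lambda>_. 0"]) auto
  then show ?thesis using True by (simp add: continuous_on_eq_continuous_at)
next
  case False
  have "continuous_on {0<..} (causal h)"
    by (rule continuous_on_eq[of _ h]) (auto intro: continuous_on_subset[OF assms(1)])
  then show ?thesis using False assms(2) by (simp add: continuous_on_eq_continuous_at)
qed

lemma measurable_causal:
  fixes h :: "real \<Rightarrow> 'a::{real_normed_vector,second_countable_topology}"
  assumes "continuous_on {0..} h"
  shows "causal h \<in> borel_measurable borel"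
proof -
  have "(\<lambda>u. if u \<in> {0..} then h u else 0) \<in> borel_measurable borel"
    by (rule borel_measurable_continuous_on_if) (use assms in auto)
  then show ?thesis by (simp add: causal_def[abs_def])
qed

lemma causal_bounded:
  fixes h :: "real \<Rightarrow> 'a::real_normed_vector"
  assumes "continuous_on {0..} h"
  obtains M where "M \<ge> 0" "\<And>u. u \<le> T \<Longrightarrow> norm (causal h u) \<le> M"
proof -
  have "compact (h ` {0..T})"
    by (intro compact_continuous_image continuous_on_subset[OF assms]) auto
  then obtain M where M: "\<And>u. u \<in> {0..T} \<Longrightarrow> norm (h u) \<le> M"
    using compact_imp_bounded bounded_iff by (metis image_eqI)
  show ?thesis
    by (rule that[of "max M 0"]) (use M in \<open>fastforce simp: causal_def le_max_iff_disj\<close>)+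
qed

lemma conv_commute: "conv f g t = conv g f t"
  unfolding conv_def by (subst lborel_integral_real_affine[where c="-1" and t=t])
      (auto simp: mult.commute)

lemma conv_eq_reflect: "conv f g t = (LINT u|lborel. f (t - u) * g u)"
  by (subst conv_commute) (simp add: conv_def mult.commute)

lemma frac_kernel_integrable_upto:
  assumes "b > 0"
  shows "integrable lborel (\<lambda>u. frac_kernel b u * indicator {..T} u)"
proof (cases "T \<le> 0")
  case True
  then have "(\<lambda>u. frac_kernel b u * indicator {..T} u) = (\<lambda>u. 0)"
    by (auto simp: fun_eq_iff indicator_def)
  then show ?thesis by simp
next
  case False
  have "(\<lambda>t. t powr (b - 1)) integrable_on {0..T}"
    by (rule integrable_on_powr_from_0) (use assms False in auto)
  hence "(\<lambda>t. t powr (b - 1)) absolutely_integrable_on {0..T}"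
    by (subst absolutely_integrable_on_iff_nonneg) auto
  from integrable_mult_right[OF this [unfolded set_integrable_def], of "1 / Gamma b"]
  have "integrable lborel (\<lambda>x. 1 / Gamma b * (indicat_real {0..T} x *\<^sub>R x powr (b - 1)))"
    by (subst (asm) integrable_completion) (auto simp: mult_ac)
  also have "(\<lambda>x. 1 / Gamma b * (indicat_real {0..T} x *\<^sub>R x powr (b - 1)))
      = (\<lambda>u. frac_kernel b u * indicator {..T} u)"
    by (auto simp: fun_eq_iff indicator_def frac_kernel_def)
  finally show ?thesis .
qed

text \<open>
For \<open>w > 0\<close> the substitution \<open>u = w v\<close> reduces the integral to Euler's Beta integral.
\<close>

lemma frac_kernel_conv_frac_kernel:
  assumes "a > 0" "b > 0"
  shows "has_bochner_integral lborel (\<lambda>u. frac_kernel a u * frac_kernel b (w - u))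
      (frac_kernel (a + b) w)"
proof (cases "w > 0")
  case False
  then have "(\<lambda>u. frac_kernel a u * frac_kernel b (w - u)) = (\<lambda>u. 0)"
    by (auto simp: fun_eq_iff frac_kernel_def)
  then show ?thesis using False by (simp add: has_bochner_integral_zero)
next
  case True
  let ?f = "\<lambda>v. indicat_real {0..1} v *\<^sub>R (v powr (a - 1) * (1 - v) powr (b - 1))"
  have i: "integrable lborel ?f"
    using integrable_Beta[OF assms] by (simp add: set_integrable_def)
  have "integral\<^sup>L lborel ?f = integral {0..1} (\<lambda>t. t powr (a - 1) * (1 - t) powr (b - 1))"
    using set_borel_integral_eq_integral(2)[OF integrable_Beta[OF assms]]
    by (simp add: set_lebesgue_integral_def)
  also have "\<dots> = Beta a b"
    using has_integral_Beta_real[OF assms] by (rule integral_unique)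
  finally have "has_bochner_integral lborel ?f (Beta a b)" using i
    by (simp add: has_bochner_integral_iff)
  then have "has_bochner_integral lborel (\<lambda>v. (w powr (a+b-2) / (Gamma a * Gamma b)) * ?f v)
      ((w powr (a+b-2) / (Gamma a * Gamma b)) * Beta a b)"
    by (rule has_bochner_integral_mult_right)
  also have "(\<lambda>v. (w powr (a+b-2) / (Gamma a * Gamma b)) * ?f v)
      = (\<lambda>v. frac_kernel a (0 + w * v) * frac_kernel b (w - (0 + w * v)))"
  proof
    fix v
    have eq: "w - w * v = w * (1 - v)" by (simp add: algebra_simps)
    show "(w powr (a+b-2) / (Gamma a * Gamma b)) * ?f v
        = frac_kernel a (0 + w * v) * frac_kernel b (w - (0 + w * v))"
      using True
      by (auto simp: frac_kernel_def indicator_def eq zero_less_mult_iff powr_mult mult_le_0_iff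
               simp flip: powr_add)
  qed
  finally have h: "has_bochner_integral lborel
      (\<lambda>v. frac_kernel a (0 + w * v) * frac_kernel b (w - (0 + w * v)))
     ((w powr (a+b-2) / (Gamma a * Gamma b)) * Beta a b)" .
  have "has_bochner_integral lborel (\<lambda>u. frac_kernel a u * frac_kernel b (w - u))
      (\<bar>w\<bar> *\<^sub>R ((w powr (a+b-2) / (Gamma a * Gamma b)) * Beta a b))"
    using h True by (subst lborel_has_bochner_integral_real_affine_iff[of w _ _ 0])
        (simp_all add: field_simps)
  also have "\<bar>w\<bar> *\<^sub>R ((w powr (a+b-2) / (Gamma a * Gamma b)) * Beta a b) = frac_kernel (a + b) w"
  proof -
    have "w * w powr (a+b-2) = w powr (a + b - 1)" using True
      using powr_mult_base[of w "a + b - 2"] by (simp add: algebra_simps)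
    moreover have "Gamma a > 0" "Gamma b > 0" using assms by (auto simp: Gamma_real_pos)
    ultimately show ?thesis using True by (simp add: frac_kernel_def Beta_def)
  qed
  finally show ?thesis .
qed

lemma conv_kernel_integrable:
  fixes h :: "real \<Rightarrow> real"
  assumes "b > 0" and h: "continuous_on {0..} h"
  shows "integrable lborel (\<lambda>u. frac_kernel b u * causal h (t - u))"
proof -
  obtain M where M: "M \<ge> 0" "\<And>u. u \<le> t \<Longrightarrow> norm (causal h u) \<le> M"
    using causal_bounded[OF h] by blast
  note [measurable] = measurable_causal[OF h]
  show ?thesis
  proof (rule Bochner_Integration.integrable_bound[OF
      integrable_mult_right[OF frac_kernel_integrable_upto[OF assms(1), of t], of M]])
    show "AE u in lborel. norm (frac_kernel b u * causal h (t - u))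
        \<le> norm (M * (frac_kernel b u * indicator {..t} u))"
    proof (rule AE_I2)
      fix u
      have "\<bar>causal h (t - u)\<bar> * \<bar>frac_kernel b u\<bar> \<le> M * \<bar>frac_kernel b u\<bar>"
        if "u > 0"
        using M(2)[of "t - u"] that by (intro mult_right_mono) auto
      then show "norm (frac_kernel b u * causal h (t - u))
          \<le> norm (M * (frac_kernel b u * indicator {..t} u))"
        using M(1) by (cases "u > 0") (auto simp: indicator_def abs_mult mult.commute causal_def)
    qed
  qed measurable
qed

lemma conv_kernel_neg: "t \<le> 0 \<Longrightarrow> conv (frac_kernel b) (causal h) t = 0"
proof -
  assume t: "t \<le> 0"
  have "frac_kernel b u * causal h (t - u) = 0" for u
    using t by (cases "u > 0") auto
  then show ?thesis unfolding conv_def by (simp only: integral_zero)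
qed

text \<open>
Dominated convergence: the argument of \<open>h\<close> meets the only possible discontinuity for a single value
of the integration variable.
\<close>

lemma conv_isCont:
  fixes \<kappa> h :: "real \<Rightarrow> real"
  assumes k: "integrable lborel \<kappa>" and [measurable]: "h \<in> borel_measurable borel"
    and M: "\<And>u. \<bar>h u\<bar> \<le> M" and c: "\<And>u. u \<noteq> 0 \<Longrightarrow> isCont h u"
  shows "isCont (conv \<kappa> h) t"
  unfolding continuous_at_sequentially o_def
proof (intro allI impI)
  fix X :: "nat \<Rightarrow> real" assume X: "X \<longlonglongrightarrow> t"
  have [measurable]: "\<kappa> \<in> borel_measurable borel" using k by auto
  show "(\<lambda>n. conv \<kappa> h (X n)) \<longlonglongrightarrow> conv \<kappa> h t"
    unfolding conv_def
  proof (rule integral_dominated_convergence[where w="\<lambda>u. M * \<bar>\<kappa> u\<bar>"])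
    show "AE u in lborel. (\<lambda>n. \<kappa> u * h (X n - u)) \<longlonglongrightarrow> \<kappa> u * h (t - u)"
      using AE_lborel_singleton[of t]
    proof eventually_elim
      case (elim u)
      have "(\<lambda>n. X n - u) \<longlonglongrightarrow> t - u" using X by (intro tendsto_intros)
      then have "(\<lambda>n. h (X n - u)) \<longlonglongrightarrow> h (t - u)"
        using c[of "t - u"] elim isCont_tendsto_compose by force
      then show ?case by (intro tendsto_intros)
    qed
    show "AE u in lborel. norm (\<kappa> u * h (X n - u)) \<le> M * \<bar>\<kappa> u\<bar>" for n
      using M by (intro AE_I2) (simp add: abs_mult mult.commute[of M] mult_left_mono)
  qed (use k in \<open>auto\<close>)
qed

text \<open>
The value at a time below \<open>T\<close> does not change when the kernel is cut off at \<open>T\<close> and \<open>h\<close> is frozen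
after time \<open>T\<close>; the kernel is then integrable and the function bounded.
\<close>

lemma conv_kernel_isCont:
  fixes h :: "real \<Rightarrow> real"
  assumes b: "b > 0" and h: "continuous_on {0..} h"
  shows "isCont (conv (frac_kernel b) (causal h)) t"
proof -
  define T where "T = max t 0 + 1"
  have T: "T > 0" "t < T" by (auto simp: T_def)
  define h' where "h' u = h (min u T)" for u
  define k' where "k' u = frac_kernel b u * indicator {..T} u" for u
  have c: "continuous_on {0..} h'"
    unfolding h'_def using T by (intro continuous_on_compose2[OF h] continuous_intros) auto
  obtain M where M: "M \<ge> 0" "\<And>u. u \<le> T \<Longrightarrow> norm (causal h u) \<le> M"
    using causal_bounded[OF h] by blast
  have h'_eq: "causal h' u = causal h (min u T)" for u
    using T by (auto simp: causal_def h'_def)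
  have cont: "isCont (conv k' (causal h')) t"
  proof (rule conv_isCont[of _ _ M])
    show "causal h' \<in> borel_measurable borel" by (rule measurable_causal[OF c])
    show "isCont (causal h') u" if "u \<noteq> 0" for u by (rule isCont_causal[OF c that])
    show "integrable lborel k'" unfolding k'_def by (rule frac_kernel_integrable_upto[OF b])
    show "\<bar>causal h' u\<bar> \<le> M" for u
      using M(2)[of "min u T"] by (simp add: h'_eq)
  qed
  have eq: "conv k' (causal h') u = conv (frac_kernel b) (causal h) u" if "u < T" for u
    unfolding conv_def
  proof (rule Bochner_Integration.integral_cong)
    fix v
    show "k' v * causal h' (u - v) = frac_kernel b v * causal h (u - v)"
      using that by (cases "v > 0") (auto simp: k'_def h'_eq indicator_def)
  qed auto
  have "eventually (\<lambda>u. conv k' (causal h') u = conv (frac_kernel b) (causal h) u) (nhds t)"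
    using eventually_nhds_in_open[of "{..<T}" t] T by (auto elim!: eventually_mono intro: eq)
  with cont show ?thesis using isCont_cong by blast
qed

text \<open>
The semigroup law \<open>J\<^sup>a J\<^sup>b = J\<^sup>a\<^sup>+\<^sup>b\<close>: by Fubini's theorem it is inherited from the kernels. The
    outer
variable \<open>w\<close> is the total delay, so the inner integral is the convolution of the two kernels.
\<close>

lemma conv_kernel_conv_kernel:
  fixes h :: "real \<Rightarrow> real"
  assumes a: "a > 0" and b: "b > 0" and h: "continuous_on {0..} h"
  shows "conv (frac_kernel a) (conv (frac_kernel b) (causal h)) t
      = conv (frac_kernel (a + b)) (causal h) t"
proof -
  note [measurable] = measurable_causal[OF h]
  define f where "f w u = frac_kernel a u * frac_kernel b (w - u) * causal h (t - w)" for w u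
  have nn: "frac_kernel a u \<ge> 0" "frac_kernel b u \<ge> 0" for u
    using a b by (auto intro: frac_kernel_nonneg)
  have f1: "has_bochner_integral lborel (f w) (frac_kernel (a + b) w * causal h (t - w))" for w
    unfolding f_def by (intro has_bochner_integral_mult_left frac_kernel_conv_frac_kernel a b)
  have f2: "(LINT u|lborel. norm (f w u)) = norm (frac_kernel (a + b) w * causal h (t - w))" for w
  proof -
    have "has_bochner_integral lborel (\<lambda>u. frac_kernel a u * frac_kernel b (w - u)
        * \<bar>causal h (t - w)\<bar>) (frac_kernel (a + b) w * \<bar>causal h (t - w)\<bar>)"
      by (intro has_bochner_integral_mult_left frac_kernel_conv_frac_kernel a b)
    also have "(\<lambda>u. frac_kernel a u * frac_kernel b (w - u) * \<bar>causal h (t - w)\<bar>)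
        = (\<lambda>u. norm (f w u))"
      using nn by (auto simp: f_def abs_mult)
    finally show ?thesis
      using frac_kernel_nonneg[of "a + b"] a b by (simp add: has_bochner_integral_iff abs_mult)
  qed
  have int: "integrable (lborel \<Otimes>\<^sub>M lborel) (\<lambda>(w, u). f w u)"
  proof (rule lborel_pair.Fubini_integrable)
    show "(\<lambda>(w, u). f w u) \<in> borel_measurable (lborel \<Otimes>\<^sub>M lborel)"
      unfolding f_def by measurable
    show "integrable lborel (\<lambda>w. LINT u|lborel. norm (case (w, u) of (w, u) \<Rightarrow> f w u))"
      unfolding prod.case f2 using a b h by (intro integrable_norm conv_kernel_integrable) auto
    show "AE w in lborel. integrable lborel (\<lambda>u. case (w, u) of (w, u) \<Rightarrow> f w u)"
      using f1 by (auto simp: has_bochner_integral_iff)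
  qed
  have "conv (frac_kernel (a + b)) (causal h) t = (LINT w|lborel. LINT u|lborel. f w u)"
    unfolding conv_def using f1 by (simp add: has_bochner_integral_iff)
  also have "\<dots> = (LINT u|lborel. LINT w|lborel. f w u)"
    using lborel_pair.Fubini_integral[OF int] by simp
  also have "\<dots> = (LINT u|lborel. frac_kernel a u * conv (frac_kernel b) (causal h) (t - u))"
  proof (rule Bochner_Integration.integral_cong[OF refl])
    fix u
    have "(LINT w|lborel. f w u) = frac_kernel a u
        * (LINT w|lborel. frac_kernel b (w - u) * causal h (t - w))"
      by (simp add: f_def mult.assoc)
    also have "(LINT w|lborel. frac_kernel b (w - u) * causal h (t - w))
        = conv (frac_kernel b) (causal h) (t - u)"
      unfolding conv_def by (subst lborel_integral_real_affine[where c=1 and t=u])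
          (auto simp: algebra_simps)
    finally show "(LINT w|lborel. f w u)
        = frac_kernel a u * conv (frac_kernel b) (causal h) (t - u)" .
  qed
  finally show ?thesis by (simp add: conv_def)
qed

section \<open>Fractional differential equations as Volterra equations\<close>

lemma riemann_liouville_eq_conv:
  assumes b: "b > 0" and y: "continuous_on {0..} y"
  shows "riemann_liouville b y t = conv (frac_kernel b) (causal y) t"
proof -
  have eq: "indicat_real {0..t} u *\<^sub>R ((t - u) powr (b - 1) * y u)
      = Gamma b * (frac_kernel b (t - u) * causal y u)" for u
    using Gamma_real_pos[OF b] by (auto simp: indicator_def frac_kernel_def causal_def)
  have "integrable lborel (\<lambda>u. frac_kernel b (t - u) * causal y u)"
    using lborel_integrable_real_affine[OF conv_kernel_integrable[OF assms, of t], of "-1" t]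
    by simp
  then have i: "set_integrable lborel {0..t} (\<lambda>u. (t - u) powr (b - 1) * y u)"
    unfolding set_integrable_def eq by (rule integrable_mult_right)
  have "integral {0..t} (\<lambda>u. (t - u) powr (b - 1) * y u)
      = (LINT u|lborel. Gamma b * (frac_kernel b (t - u) * causal y u))"
    using set_borel_integral_eq_integral(2)[OF i] unfolding set_lebesgue_integral_def eq by simp
  also have "\<dots> = Gamma b * conv (frac_kernel b) (causal y) t"
    unfolding conv_eq_reflect by (rule integral_mult_right_zero)
  finally show ?thesis using Gamma_real_pos[OF b] by (simp add: riemann_liouville_def)
qed

lemma conv_kernel_one:
  assumes y: "continuous_on {0..} y"
  shows "conv (frac_kernel 1) (causal y) t = integral {0..t} y"
proof -
  have "integral {0..t} (\<lambda>u. (t - u) powr (1 - 1) * y u) = integral {0..t} y"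
    by (rule integral_spike[of "{t}"]) auto
  then show ?thesis
    using riemann_liouville_eq_conv[OF zero_less_one y, of t] by (simp add: riemann_liouville_def)
qed

lemma integral_has_real_derivative_nonneg:
  fixes f :: "real \<Rightarrow> real"
  assumes f: "continuous_on {0..} f" and t: "t > 0"
  shows "((\<lambda>u. integral {0..u} f) has_real_derivative f t) (at t)"
proof -
  have "((\<lambda>u. integral {0..u} f) has_real_derivative f t) (at t within {0..t+1})"
    using t by (intro integral_has_real_derivative continuous_on_subset[OF f]) auto
  then show ?thesis using t
    by (subst (asm) at_within_interior) auto
qed

lemma eq_integral_of_derivative_nonneg:
  fixes f G :: "real \<Rightarrow> real"
  assumes f: "continuous_on {0..} f" and G: "continuous_on {0..} G"
    and D: "\<And>t. t > 0 \<Longrightarrow> (G has_real_derivative f t) (at t)" and t: "t \<ge> 0"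
  shows "G t = G 0 + integral {0..t} f"
proof -
  have "(f has_integral (G t - G 0)) {0..t}"
  proof (rule fundamental_theorem_of_calculus_interior[OF t])
    show "continuous_on {0..t} G" by (rule continuous_on_subset[OF G]) auto
    show "(G has_vector_derivative f u) (at u)" if "u \<in> {0<..<t}" for u
      using D[of u] that by (simp add: has_real_derivative_iff_has_vector_derivative)
  qed
  then show ?thesis by (simp add: integral_unique)
qed

text \<open>
For \<open>b < 1\<close> both conditions are equivalent to \<open>J\<^sup>1\<^sup>-\<^sup>b (y - y(0)) = J\<^sup>1 f\<close>: the differential
    equation by
the fundamental theorem of calculus; the integral equation because applying \<open>J\<^sup>1\<^sup>-\<^sup>b\<close> leads there,
    and
because applying \<open>J\<^sup>b\<close> and differentiating leads back.
\<close>

lemma caputo_iff_volterra: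
  assumes b: "0 < b" "b \<le> 1" and y: "continuous_on {0..} y" and f: "continuous_on {0..} f"
  shows "(\<forall>t>0. has_caputo_derivative y b (f t) t) \<longleftrightarrow>
         (\<forall>t\<ge>0. y t = y 0 + conv (frac_kernel b) (causal f) t)"
proof (cases "b = 1")
  case True
  show ?thesis
  proof
    assume "\<forall>t>0. has_caputo_derivative y b (f t) t"
    then show "\<forall>t\<ge>0. y t = y 0 + conv (frac_kernel b) (causal f) t"
      unfolding True conv_kernel_one[OF f] has_caputo_derivative_def
      by (auto intro: eq_integral_of_derivative_nonneg[OF f y])
  next
    assume *: "\<forall>t\<ge>0. y t = y 0 + conv (frac_kernel b) (causal f) t"
    show "\<forall>t>0. has_caputo_derivative y b (f t) t"
    proof (intro allI impI)
      fix t :: real assume t: "t > 0"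
      have "((\<lambda>t. y 0 + integral {0..t} f) has_real_derivative f t) (at t)"
        using integral_has_real_derivative_nonneg[OF f t] by (auto intro!: derivative_eq_intros)
      moreover have "eventually (\<lambda>u. y u = y 0 + integral {0..u} f) (nhds t)"

      proof (rule eventually_mono)
        show "eventually (\<lambda>u. u \<in> {0<..}) (nhds t)"
          using t by (intro eventually_nhds_in_open) auto
        show "y u = y 0 + integral {0..u} f" if "u \<in> {0<..}" for u
          using *[unfolded True conv_kernel_one[OF f], rule_format, of u] that by simp
      qed
      ultimately have "(y has_real_derivative f t) (at t)"
        using DERIV_cong_ev[of t t y "\<lambda>u. y 0 + integral {0..u} f" "f t" "f t"] by simp
      then show "has_caputo_derivative y b (f t) t" using True
        by (simp add: has_caputo_derivative_def)
    qed
  qed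
next
  case False
  with b have b1: "1 - b > 0" by auto
  define u where "u = (\<lambda>\<tau>. y \<tau> - y 0)"
  have u: "continuous_on {0..} u" unfolding u_def by (intro continuous_intros y)
  have cap: "has_caputo_derivative y b (f t) t \<longleftrightarrow>
      (conv (frac_kernel (1 - b)) (causal u) has_real_derivative f t) (at t)" for t
  proof -
    have "riemann_liouville (1 - b) u = conv (frac_kernel (1 - b)) (causal u)"
      by (rule ext) (rule riemann_liouville_eq_conv[OF b1 u])
    then show ?thesis using False by (simp add: has_caputo_derivative_def u_def)
  qed
  define V where "V t = conv (frac_kernel b) (causal f) t" for t
  have V: "isCont V t" for t unfolding V_def[abs_def] by (rule conv_kernel_isCont[OF b(1) f])
  have cV: "continuous_on {0..} V" using V by (simp add: continuous_at_imp_continuous_on)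
  have causal_V: "causal V = V"
    using conv_kernel_neg by (auto simp: fun_eq_iff causal_def V_def)
  show ?thesis
  proof
    assume "\<forall>t>0. has_caputo_derivative y b (f t) t"
    then have D: "(conv (frac_kernel (1 - b)) (causal u) has_real_derivative f t) (at t)"
        if "t > 0" for t
      using cap that by auto
    have eq1: "conv (frac_kernel (1 - b)) (causal u) = causal (\<lambda>t. integral {0..t} f)"
    proof
      fix t
      show "conv (frac_kernel (1 - b)) (causal u) t = causal (\<lambda>t. integral {0..t} f) t"
      proof (cases "t \<ge> 0")
        case True
        have "conv (frac_kernel (1 - b)) (causal u) t
            = conv (frac_kernel (1 - b)) (causal u) 0 + integral {0..t} f"
          by (rule eq_integral_of_derivative_nonneg[OF f _ D True])
            (auto intro!: continuous_at_imp_continuous_on conv_kernel_isCont b1 u)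
        then show ?thesis using True by (simp add: conv_kernel_neg)
      qed (auto simp: conv_kernel_neg)
    qed
    have eq2: "conv (frac_kernel 1) (causal f) = causal (\<lambda>t. integral {0..t} f)"
    proof
      fix t show "conv (frac_kernel 1) (causal f) t = causal (\<lambda>t. integral {0..t} f) t"
        by (cases "t \<ge> 0") (simp_all add: conv_kernel_neg, simp_all add: conv_kernel_one[OF f])
    qed
    \<comment> \<open>Apply J^b to eq1 and eq2, and use the semigroup law on both sides.\<close>
    have int_eq: "integral {0..t} u = integral {0..t} V" for t
    proof -
      have "integral {0..t} u = conv (frac_kernel (b + (1 - b))) (causal u) t"
        using conv_kernel_one[OF u] by simp
      also have "\<dots> = conv (frac_kernel b) (conv (frac_kernel (1 - b)) (causal u)) t"
        by (rule conv_kernel_conv_kernel[OF b(1) b1 u, symmetric])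
      also have "\<dots> = conv (frac_kernel b) (conv (frac_kernel 1) (causal f)) t"
        by (simp add: eq1 eq2)
      also have "\<dots> = conv (frac_kernel (1 + b)) (causal f) t"
        by (subst conv_kernel_conv_kernel[OF b(1) _ f]) (auto simp: add.commute)
      also have "\<dots> = conv (frac_kernel 1) (conv (frac_kernel b) (causal f)) t"
        by (rule conv_kernel_conv_kernel[OF _ b(1) f, symmetric]) auto
      also have "\<dots> = conv (frac_kernel 1) (causal V) t"
        by (simp add: causal_V) (simp add: V_def[abs_def])
      also have "\<dots> = integral {0..t} V" by (rule conv_kernel_one[OF cV])
      finally show ?thesis .
    qed
    show "\<forall>t\<ge>0. y t = y 0 + conv (frac_kernel b) (causal f) t"
    proof (intro allI impI)
      fix t :: real assume "t \<ge> 0"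
      have "u t = V t"
      proof (cases "t = 0")
        case True
        then show ?thesis by (simp add: u_def V_def conv_kernel_neg)
      next
        case False
        with \<open>t \<ge> 0\<close> have "t > 0" by simp
        have "((\<lambda>t. integral {0..t} u) has_real_derivative u t) (at t)"
             "((\<lambda>t. integral {0..t} u) has_real_derivative V t) (at t)"
          using integral_has_real_derivative_nonneg[OF u \<open>t > 0\<close>]
                integral_has_real_derivative_nonneg[OF cV \<open>t > 0\<close>] int_eq by simp_all
        then show ?thesis by (rule DERIV_unique)
      qed
      then show "y t = y 0 + conv (frac_kernel b) (causal f) t" by (simp add: u_def V_def)
    qed
  next
    assume *: "\<forall>t\<ge>0. y t = y 0 + conv (frac_kernel b) (causal f) t"
    have "causal u = V"
    proof
      fix t show "causal u t = V t"
        using *[rule_format, of t] by (cases "t \<ge> 0") (auto simp: u_def V_def conv_kernel_neg)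
    qed
    then have eq: "conv (frac_kernel (1 - b)) (causal u) t = integral {0..t} f" for t
      using conv_kernel_conv_kernel[OF b1 b(1) f, of t]
      by (simp add: V_def[abs_def] conv_kernel_one[OF f])
    show "\<forall>t>0. has_caputo_derivative y b (f t) t"
      unfolding cap eq[abs_def] using integral_has_real_derivative_nonneg[OF f] by simp
  qed
qed

section \<open>Laplace transforms\<close>

lemma frac_kernel_scale: "c > 0 \<Longrightarrow> frac_kernel b (c * t) = c powr (b - 1) * frac_kernel b t"
  by (simp add: frac_kernel_def powr_mult zero_less_mult_iff)

lemma laplace_frac_kernel_real:
  assumes b: "b > 0" and c: "c > 0"
  shows "has_bochner_integral lborel (\<lambda>t. exp (- (c * t)) * frac_kernel b t) (c powr (- b))"
proof -
  have G: "Gamma b > 0" by (rule Gamma_real_pos[OF b])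
  have "has_bochner_integral lborel (\<lambda>t. indicator {0..} t * t powr (b - 1) / exp t) (Gamma b)"
    by (rule has_bochner_integral_nn_integral) (use Gamma_conv_nn_integral_real[OF b] G in auto)
  from has_bochner_integral_mult_right[OF this, of "1 / Gamma b"]
  have "has_bochner_integral lborel (\<lambda>t. 1 / Gamma b * (indicator {0..} t * t powr (b - 1) / exp t))
      1"
    using G by simp
  also have "(\<lambda>t. 1 / Gamma b * (indicator {0..} t * t powr (b - 1) / exp t))
      = (\<lambda>t. exp (- t) * frac_kernel b t)"
    by (auto simp: fun_eq_iff frac_kernel_def indicator_def exp_minus field_simps)
  finally have "has_bochner_integral lborel (\<lambda>t. exp (- (0 + c * t)) * frac_kernel b (0 + c * t))
      (1 /\<^sub>R \<bar>c\<bar>)"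
    using c by (subst (asm) lborel_has_bochner_integral_real_affine_iff[of c _ _ 0]) auto
  from has_bochner_integral_mult_right[OF this, of "c powr (1 - b)"]
  have "has_bochner_integral lborel (\<lambda>t. c powr (1 - b)
      * (exp (- (0 + c * t)) * frac_kernel b (0 + c * t))) (c powr (1 - b) / c)"
    using c by (simp add: field_simps)
  also have "(\<lambda>t. c powr (1 - b) * (exp (- (0 + c * t)) * frac_kernel b (0 + c * t)))
      = (\<lambda>t. exp (- (c * t)) * frac_kernel b t)"
    using c by (auto simp: frac_kernel_scale fun_eq_iff simp flip: powr_add)
  also have "c powr (1 - b) / c = c powr (- b)"
    using c by (simp add: powr_diff powr_minus field_simps)
  finally show ?thesis .
qed

text \<open>
A power of \<open>t\<close> only raises the order of the kernel, so the terms of the exponential series are again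
handled by the real Laplace transform.
\<close>

lemma frac_kernel_times_power:
  assumes "b > 0"
  shows "frac_kernel b t * t ^ n = pochhammer b n * frac_kernel (b + real n) t"
proof (cases "t > 0")
  case True
  have "b \<notin> \<int>\<^sub>\<le>\<^sub>0" using assms by (auto elim!: nonpos_Ints_cases)
  then have "pochhammer b n = Gamma (b + real n) / Gamma b" by (rule pochhammer_Gamma)
  moreover have "Gamma b > 0" "Gamma (b + real n) > 0" using assms by (auto intro: Gamma_real_pos)
  moreover have "t powr (b + real n - 1) = t powr (b - 1) * t ^ n"
    using True by (simp add: powr_realpow[symmetric] algebra_simps flip: powr_add)
  ultimately show ?thesis using True by (simp add: frac_kernel_def)
qed auto

text \<open>
The real case does not rescale to complex \<open>s\<close>. Instead, \<open>exp (- s t)\<close> is expanded around a real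
    point
\<open>r\<close> with \<open>\<bar>s - r\<bar> < r\<close>; such an \<open>r\<close> exists because \<open>Re s > 0\<close>. Integrating term
  by term with the real
case gives the binomial series of \<open>r\<^sup>-\<^sup>b (s / r)\<^sup>-\<^sup>b\<close>.
\<close>

lemma laplace_frac_kernel:
  assumes b: "b > 0" and s: "Re s > 0"
  shows "has_bochner_integral lborel (\<lambda>t. exp (- (s * complex_of_real t))
      * complex_of_real (frac_kernel b t))
           (s powr (- complex_of_real b))"
proof -
  \<comment> \<open>Any larger real number would do as well: this r gives |s - r|^2 = r^2 - |s|^2.\<close>
  define r where "r = (norm s)\<^sup>2 / Re s"
  have s0: "s \<noteq> 0" using s by auto
  have r: "r > 0" using s s0 by (simp add: r_def)
  have rs: "r * Re s = (norm s)\<^sup>2" using s by (simp add: r_def)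
  have "(norm (of_real r - s))\<^sup>2 = r\<^sup>2 - 2 * (r * Re s) + (norm s)\<^sup>2"
    unfolding cmod_power2 by (simp add: power2_eq_square algebra_simps)
  also have "\<dots> < r\<^sup>2" using s0 by (simp add: rs)
  finally have "norm (of_real r - s) < r" using r by (simp add: power2_less_imp_less)
  define q where "q = (of_real r - s) / of_real r"
  have q: "norm q < 1" using \<open>norm (of_real r - s) < r\<close> r by (simp add: q_def norm_divide)
  define f where "f n t = of_real (exp (- (r * t)) * frac_kernel b t)
      * (((of_real r - s) * of_real t) ^ n /\<^sub>R fact n)" for n t
  define c where "c n = of_real (pochhammer b n * r powr (- (b + real n))) * (of_real r - s) ^ n
      / fact n" for n
  have pb: "pochhammer b n > 0" for n using b by (rule pochhammer_pos)
  have ker: "exp (- (r * t)) * frac_kernel b t * t ^ n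
      = pochhammer b n * (exp (- (r * t)) * frac_kernel (b + real n) t)" for t n
    using frac_kernel_times_power[OF b, of t n] by simp
  have f_eq: "f n t = of_real (pochhammer b n * (exp (- (r * t)) * frac_kernel (b + real n) t))
      * ((of_real r - s) ^ n / fact n)" for n t
    unfolding f_def ker[symmetric] power_mult_distrib
    by (simp add: scaleR_conv_of_real divide_inverse mult_ac)
  have f: "has_bochner_integral lborel (f n) (c n)" for n
  proof -
    have "has_bochner_integral lborel (\<lambda>t. of_real
        (pochhammer b n * (exp (- (r * t)) * frac_kernel (b + real n) t))
        * ((of_real r - s) ^ n / fact n))
        (of_real (pochhammer b n * r powr (- (b + real n))) * ((of_real r - s) ^ n / fact n))"
      by (intro has_bochner_integral_mult_left has_bochner_integral_of_real
          has_bochner_integral_mult_right laplace_frac_kernel_real) (use b r in auto)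
    then show ?thesis by (simp add: f_eq[abs_def] c_def)
  qed
  have nf: "(LINT t|lborel. norm (f n t))
      = (pochhammer b n * r powr (- (b + real n))) * (norm (of_real r - s) ^ n / fact n)" for n
  proof -
    have "has_bochner_integral lborel (\<lambda>t.
        (pochhammer b n * (exp (- (r * t)) * frac_kernel (b + real n) t))
        * (norm (of_real r - s) ^ n / fact n))
        ((pochhammer b n * r powr (- (b + real n))) * (norm (of_real r - s) ^ n / fact n))"
      by (intro has_bochner_integral_mult_left has_bochner_integral_mult_right
          laplace_frac_kernel_real) (use b r in auto)
    moreover have "norm (f n t) = (pochhammer b n * (exp (- (r * t)) * frac_kernel (b + real n) t))
        * (norm (of_real r - s) ^ n / fact n)" for t
      unfolding f_eq using pb[of n] frac_kernel_nonneg[of "b + real n" t] b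
      by (simp add: norm_mult norm_divide norm_power)
    ultimately show ?thesis by (simp add: has_bochner_integral_iff)
  qed
  have "(\<lambda>n. ((- b) gchoose n) * (- norm q) ^ n) sums (1 + (- norm q)) powr (- b)"
    using q by (intro gen_binomial_real) auto
  then have "summable (\<lambda>n. r powr (- b) * (((- b) gchoose n) * (- norm q) ^ n))"
    by (intro summable_mult) (auto simp: sums_iff)
  also have "(\<lambda>n. r powr (- b) * (((- b) gchoose n) * (- norm q) ^ n))
      = (\<lambda>n. LINT t|lborel. norm (f n t))"
  proof
    fix n
    have "((- b) gchoose n) * (- norm q) ^ n = pochhammer b n / fact n * norm q ^ n"
      by (simp add: gbinomial_pochhammer power_mult_distrib[symmetric])
    also have "norm q ^ n = norm (of_real r - s) ^ n * r powr (- real n)"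
      using r unfolding q_def norm_divide power_divide
      by (simp add: powr_minus powr_realpow divide_inverse)
    finally show "r powr (- b) * (((- b) gchoose n) * (- norm q) ^ n)
        = (LINT t|lborel. norm (f n t))"
      by (simp add: nf powr_add algebra_simps powr_diff powr_minus divide_inverse)
  qed
  finally have sum: "summable (\<lambda>n. LINT t|lborel. norm (f n t))" .
  have lim: "(\<lambda>n. f n t) sums (exp (- (s * complex_of_real t)) * complex_of_real (frac_kernel b t))"
      for t
  proof -
    have "(\<lambda>n. of_real (exp (- (r * t)) * frac_kernel b t)
        * (((of_real r - s) * of_real t) ^ n /\<^sub>R fact n)) sums
        (of_real (exp (- (r * t)) * frac_kernel b t) * exp ((of_real r - s) * of_real t))"
      by (intro sums_mult exp_converges)
    also have "of_real (exp (- (r * t)) * frac_kernel b t) * exp ((of_real r - s) * of_real t)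
        = exp (- (s * complex_of_real t)) * complex_of_real (frac_kernel b t)"
      by (simp add: exp_of_real[symmetric] algebra_simps flip: exp_add)
    finally show ?thesis by (simp add: f_def)
  qed
  have nsum: "summable (\<lambda>n. norm (f n t))" for t
  proof -
    have "summable (\<lambda>n. norm (of_real (exp (- (r * t)) * frac_kernel b t))
        * norm (((of_real r - s) * of_real t) ^ n /\<^sub>R fact n))"
      by (intro summable_mult summable_norm_exp)
    then show ?thesis unfolding f_def norm_mult .
  qed
  have fi: "integrable lborel (f n)" for n using f has_bochner_integral_iff by blast
  have suminf: "(\<lambda>t. \<Sum>n. f n t) = (\<lambda>t. exp (- (s * complex_of_real t))
      * complex_of_real (frac_kernel b t))"
    using lim by (auto simp: sums_iff)
  have int: "integrable lborel (\<lambda>t. exp (- (s * complex_of_real t))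
      * complex_of_real (frac_kernel b t))"
    using integrable_suminf[OF fi AE_I2[OF nsum] sum] by (simp add: suminf)
  have "(\<lambda>n. integral\<^sup>L lborel (f n)) sums
      (LINT t|lborel. exp (- (s * complex_of_real t)) * complex_of_real (frac_kernel b t))"
    using sums_integral[OF fi AE_I2[OF nsum] sum] by (simp add: suminf)
  moreover have "(\<lambda>n. integral\<^sup>L lborel (f n)) sums (s powr (- complex_of_real b))"
  proof -
    have "(\<lambda>n. ((- of_real b) gchoose n) * (- q) ^ n) sums (1 + (- q)) powr (- of_real b)"
      using q by (intro gen_binomial_complex) auto
    then have "(\<lambda>n. of_real (r powr (- b)) * (((- of_real b) gchoose n) * (- q) ^ n)) sums
        (of_real (r powr (- b)) * (1 + (- q)) powr (- of_real b))"
      by (rule sums_mult)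
    also have "of_real (r powr (- b)) * (1 + (- q)) powr (- of_real b)
        = s powr (- complex_of_real b)"
    proof -
      have "1 - q = s / of_real r" using r by (simp add: q_def field_simps)
      then have "s = of_real r * (1 - q)" using r by simp
      then have "s powr (- of_real b) = of_real r powr (- of_real b) * (1 - q) powr (- of_real b)"
        using powr_times_real_left[of "of_real r" "1 - q" "- of_real b"] r by simp
      also have "of_real r powr (- complex_of_real b) = of_real (r powr (- b))"
        using powr_of_real[of r "- b"] r by simp
      finally show ?thesis by simp
    qed
    also have "(\<lambda>n. of_real (r powr (- b)) * (((- of_real b) gchoose n) * (- q) ^ n))
        = (\<lambda>n. integral\<^sup>L lborel (f n))"
    proof
      fix n
      have "((- complex_of_real b) gchoose n) * (- q) ^ n
          = pochhammer (of_real b) n / fact n * q ^ n"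
        by (simp add: gbinomial_pochhammer power_mult_distrib[symmetric])
      also have "q ^ n = (of_real r - s) ^ n * of_real (r powr (- real n))"
        using r by (simp add: q_def power_divide powr_minus powr_realpow divide_inverse
            power_mult_distrib power_inverse)
      finally show "of_real (r powr (- b)) * (((- complex_of_real b) gchoose n) * (- q) ^ n)
          = integral\<^sup>L lborel (f n)"
        using f[of n] by (simp add: has_bochner_integral_iff c_def powr_add pochhammer_of_real
            algebra_simps powr_diff powr_minus divide_inverse)
    qed
    finally show ?thesis .
  qed
  ultimately have "(LINT t|lborel. exp (- (s * complex_of_real t))
      * complex_of_real (frac_kernel b t)) = s powr (- complex_of_real b)"
    by (rule sums_unique2)
  with int show ?thesis by (simp add: has_bochner_integral_iff)
qed

lemma
  fixes f g :: "real \<Rightarrow> 'a::{real_normed_field,banach,second_countable_topology}"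
  assumes f: "integrable lborel f" and g: "integrable lborel g"
  shows integrable_conv: "integrable lborel (conv f g)"
    and integral_conv: "integral\<^sup>L lborel (conv f g) = integral\<^sup>L lborel f * integral\<^sup>L lborel g"
proof -
  have [measurable]: "f \<in> borel_measurable borel" "g \<in> borel_measurable borel" using f g by auto
  have shift: "integrable lborel (\<lambda>t. g (t - u))" for u
    using lborel_integrable_real_affine[OF g, of 1 "-u"] by simp
  have shift_eq: "(LINT t|lborel. h (t - u))
      = integral\<^sup>L lborel h" for u and h :: "real \<Rightarrow> 'b::{banach,second_countable_topology}"
    using lborel_integral_real_affine[of 1 h "-u"] by simp
  have int: "integrable (lborel \<Otimes>\<^sub>M lborel) (\<lambda>(u, t). f u * g (t - u))"
  proof (rule lborel_pair.Fubini_integrable)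
    have "(LINT t|lborel. norm (f u * g (t - u))) = norm (f u) * (LINT t|lborel. norm (g t))" for u
      using shift_eq[of "\<lambda>t. norm (g t)" u] by (simp add: norm_mult)
    then show "integrable lborel (\<lambda>u. LINT t|lborel. norm
        (case (u, t) of (u, t) \<Rightarrow> f u * g (t - u)))"
      using f by simp
    show "AE u in lborel. integrable lborel (\<lambda>t. case (u, t) of (u, t) \<Rightarrow> f u * g (t - u))"
      using shift by simp
  qed measurable
  show "integrable lborel (conv f g)"
    using lborel_pair.integrable_snd[OF int] by (simp add: conv_def[abs_def])
  have "integral\<^sup>L lborel (conv f g) = (LINT t|lborel. LINT u|lborel. f u * g (t - u))"
    by (simp add: conv_def[abs_def])
  also have "\<dots> = (LINT u|lborel. LINT t|lborel. f u * g (t - u))"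
    using lborel_pair.Fubini_integral[OF int] .
  also have "\<dots> = integral\<^sup>L lborel f * integral\<^sup>L lborel g"
    by (simp add: shift_eq)
  finally show "integral\<^sup>L lborel (conv f g) = integral\<^sup>L lborel f * integral\<^sup>L lborel g" .
qed

text \<open>
This integral runs over the whole line; it is the usual Laplace transform for functions that vanish
on the negative axis.
\<close>

definition laplace :: "(real \<Rightarrow> real) \<Rightarrow> complex \<Rightarrow> complex" where
  "laplace h s = (LINT t|lborel. exp (- (s * of_real t)) * of_real (h t))"

definition laplace_integrable :: "(real \<Rightarrow> real) \<Rightarrow> complex \<Rightarrow> bool" where
  "laplace_integrable h s \<longleftrightarrow> integrable lborel (\<lambda>t. exp (- (s * of_real t)) * complex_of_real (h t))"

lemma
  assumes k: "laplace_integrable k s" and h: "laplace_integrable h s"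
  shows laplace_integrable_conv: "laplace_integrable (conv k h) s"
    and laplace_conv: "laplace (conv k h) s = laplace k s * laplace h s"
proof -
  let ?e = "\<lambda>h t. exp (- (s * of_real t)) * complex_of_real (h t)"
  have "?e (conv k h) t = conv (?e k) (?e h) t" for t
  proof -
    have "conv (?e k) (?e h) t = (LINT u|lborel. exp (- (s * of_real t))
        * of_real (k u * h (t - u)))"
      unfolding conv_def by (rule Bochner_Integration.integral_cong)
          (auto simp: algebra_simps simp flip: exp_add)
    also have "\<dots> = exp (- (s * of_real t)) * (LINT u|lborel. complex_of_real (k u * h (t - u)))"
      by (rule integral_mult_right_zero)
    also have "\<dots> = ?e (conv k h) t"
      unfolding conv_def by (simp only: integral_complex_of_real)
    finally show ?thesis by simp
  qed
  then have eq: "?e (conv k h) = conv (?e k) (?e h)" by auto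
  show "laplace_integrable (conv k h) s"
    using integrable_conv[OF k[unfolded laplace_integrable_def] h[unfolded laplace_integrable_def]]
    by (simp add: laplace_integrable_def eq)
  show "laplace (conv k h) s = laplace k s * laplace h s"
    using integral_conv[OF k[unfolded laplace_integrable_def] h[unfolded laplace_integrable_def]]
    by (simp add: laplace_def eq)
qed

lemma laplace_integrable_exp_bound:
  assumes h: "continuous_on {0..} h" and b: "\<And>t. t \<ge> 0 \<Longrightarrow> \<bar>h t\<bar> \<le> C * exp (L * t)" and s: "Re s > L"
  shows "laplace_integrable (causal h) s"
  unfolding laplace_integrable_def
proof (rule Bochner_Integration.integrable_bound)
  note [measurable] = measurable_causal[OF h]
  show "integrable lborel (\<lambda>t. C * (exp (- ((Re s - L) * t)) * frac_kernel 1 t))"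
    using laplace_frac_kernel_real[of 1 "Re s - L"] s
    by (intro integrable_mult_right) (simp add: has_bochner_integral_iff)
  show "(\<lambda>t. exp (- (s * of_real t)) * complex_of_real (causal h t)) \<in> borel_measurable lborel"
    by measurable
  have "0 \<le> C" using b[of 0] by simp
  show "AE t in lborel. norm (exp (- (s * of_real t)) * complex_of_real (causal h t))
      \<le> norm (C * (exp (- ((Re s - L) * t)) * frac_kernel 1 t))"
    using AE_lborel_singleton[of 0]
  proof eventually_elim
    fix t :: real assume "t \<noteq> 0"
    show "norm (exp (- (s * of_real t)) * complex_of_real (causal h t))
        \<le> norm (C * (exp (- ((Re s - L) * t)) * frac_kernel 1 t))"
    proof (cases "t > 0")
      case True
      have "exp (- (Re s * t)) * \<bar>h t\<bar> \<le> exp (- (Re s * t)) * (C * exp (L * t))"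
        using b[of t] True by (intro mult_left_mono) auto
      also have "\<dots> = C * exp (- ((Re s - L) * t))" by (simp add: algebra_simps flip: exp_add)
      finally show ?thesis using True \<open>0 \<le> C\<close> by (simp add: norm_mult frac_kernel_def abs_mult)
    qed (use \<open>t \<noteq> 0\<close> in auto)
  qed
qed

lemma laplace_add:
  "laplace_integrable f s \<Longrightarrow> laplace_integrable g s \<Longrightarrow> laplace (\<lambda>t. f t + g t) s
      = laplace f s + laplace g s"
  by (simp add: laplace_def laplace_integrable_def distrib_left)

lemma laplace_sum_scaled:
  assumes "\<And>j. j \<in> J \<Longrightarrow> laplace_integrable (f j) s"
  shows "laplace (\<lambda>t. \<Sum>j\<in>J. a j * f j t) s = (\<Sum>j\<in>J. of_real (a j) * laplace (f j) s)"
proof -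
  have "laplace (\<lambda>t. \<Sum>j\<in>J. a j * f j t) s
      = (LINT t|lborel. (\<Sum>j\<in>J. of_real (a j) * (exp (- (s * of_real t)) * of_real (f j t))))"
    unfolding laplace_def by (simp add: sum_distrib_left mult_ac)
  also have "\<dots> = (\<Sum>j\<in>J. LINT t|lborel. of_real (a j) * (exp (- (s * of_real t)) * of_real (f j t)))"
    using assms by (intro Bochner_Integration.integral_sum) (auto simp: laplace_integrable_def)
  also have "\<dots> = (\<Sum>j\<in>J. of_real (a j) * laplace (f j) s)" by (simp add: laplace_def)
  finally show ?thesis .
qed

lemma
  assumes "b > 0" "Re s > 0"
  shows laplace_integrable_kernel: "laplace_integrable (frac_kernel b) s"
    and laplace_kernel: "laplace (frac_kernel b) s = s powr (- of_real b)"
  using laplace_frac_kernel[OF assms] by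
      (simp_all add: laplace_def laplace_integrable_def has_bochner_integral_iff)

lemma laplace_causal_const:
  assumes "Re s > 0"
  shows "laplace (causal (\<lambda>_. c)) s = of_real c / s"
proof -
  have "laplace (causal (\<lambda>_. c)) s = (LINT t|lborel. of_real c
      * (exp (- (s * of_real t)) * of_real (frac_kernel 1 t)))"
    unfolding laplace_def
  proof (rule integral_cong_AE)
    show "AE t in lborel. exp (- (s * of_real t)) * complex_of_real (causal (\<lambda>_. c) t)
        = of_real c * (exp (- (s * of_real t)) * of_real (frac_kernel 1 t))"
      using AE_lborel_singleton[of 0] by eventually_elim (auto simp: causal_def frac_kernel_def)
    show "(\<lambda>t. exp (- (s * of_real t)) * complex_of_real (causal (\<lambda>_. c) t)) \<in> borel_measurable
        lborel"
      using measurable_causal[OF continuous_on_const, of c] by measurable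
  qed measurable
  also have "\<dots> = of_real c * laplace (frac_kernel 1) s" unfolding laplace_def
    by (rule integral_mult_right_zero)
  finally show ?thesis using laplace_kernel[of 1 s] assms by (simp add: powr_minus divide_inverse)
qed

lemma laplace_diff_scaled:
  assumes "laplace_integrable f s" "laplace_integrable g s"
  shows "laplace (\<lambda>t. f t - c * g t) s = laplace f s - of_real c * laplace g s"
proof -
  have "laplace (\<lambda>t. f t - c * g t) s = (LINT t|lborel. exp (- (s * of_real t)) * of_real (f t)
      - of_real c * (exp (- (s * of_real t)) * of_real (g t)))"
    unfolding laplace_def by (simp add: right_diff_distrib mult_ac)
  also have "\<dots> = laplace f s - (LINT t|lborel. of_real c
      * (exp (- (s * of_real t)) * of_real (g t)))"
    unfolding laplace_def using assms unfolding laplace_integrable_def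
    by (intro Bochner_Integration.integral_diff integrable_mult_right)
  also have "(LINT t|lborel. of_real c * (exp (- (s * of_real t)) * of_real (g t)))
      = of_real c * laplace g s"
    unfolding laplace_def by (rule integral_mult_right_zero)
  finally show ?thesis .
qed

lemma laplace_causal_exp:
  assumes "Re s > 0"
  shows "laplace (causal (\<lambda>t. exp (- t))) s = 1 / (s + 1)"
proof -
  have "laplace (causal (\<lambda>t. exp (- t))) s = laplace (causal (\<lambda>_. 1)) (s + 1)"
    unfolding laplace_def
    by (rule Bochner_Integration.integral_cong)
        (auto simp: causal_def exp_of_real[symmetric] algebra_simps simp flip: exp_add)
  then show ?thesis using laplace_causal_const[of "s + 1" 1] assms by simp
qed

section \<open>The Volterra system: growth and existence of solutions\<close>

definition volterra_solution :: "real ^ 'n \<Rightarrow> real ^ 'n ^ 'n \<Rightarrow> (real \<Rightarrow> real ^ 'n::finite) \<Rightarrow> bool"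
    where
  "volterra_solution \<alpha> A x \<longleftrightarrow> continuous_on {0..} x \<and>
     (\<forall>k. \<forall>t\<ge>0. x t $ k = x 0 $ k + conv (frac_kernel (\<alpha> $ k)) (causal (\<lambda>\<tau>. (A *v x \<tau>) $ k)) t)"

lemma continuous_on_component [continuous_intros]:
  fixes x :: "'a::topological_space \<Rightarrow> real ^ 'n::finite"
  shows "continuous_on S x \<Longrightarrow> continuous_on S (\<lambda>t. x t $ k)"
  by (rule bounded_linear.continuous_on[OF bounded_linear_vec_nth])

lemma continuous_on_matvec:
  fixes A :: "real ^ 'n ^ 'm::finite" and x :: "'a::topological_space \<Rightarrow> real ^ 'n"
  shows "continuous_on S x \<Longrightarrow> continuous_on S (\<lambda>t. (A *v x t) $ k)"
  by (simp add: matrix_vector_mult_def) (intro continuous_intros)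

lemma frac_solution_iff_volterra:
  fixes \<alpha> :: "real ^ 'n::finite"
  assumes "\<And>k. 0 < \<alpha> $ k \<and> \<alpha> $ k \<le> 1"
  shows "frac_solution \<alpha> A x \<longleftrightarrow> volterra_solution \<alpha> A x"
proof (cases "continuous_on {0..} x")
  case True
  have "(\<forall>t>0. has_caputo_derivative (\<lambda>\<tau>. x \<tau> $ k) (\<alpha> $ k) ((A *v x t) $ k) t) \<longleftrightarrow>
      (\<forall>t\<ge>0. x t $ k = x 0 $ k + conv (frac_kernel (\<alpha> $ k)) (causal (\<lambda>\<tau>. (A *v x \<tau>) $ k)) t)" for k
    using assms[of k] by (intro caputo_iff_volterra continuous_on_component continuous_on_matvec
        True) auto
  then show ?thesis using True
    unfolding frac_solution_def volterra_solution_def has_frac_derivative_def by blast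
qed (simp add: frac_solution_def volterra_solution_def)

text \<open>
In the norm with weight \<open>exp (- L t)\<close> the operator \<open>J\<^sup>b\<close> has norm at most \<open>L\<^sup>-\<^sup>b\<close>, the Laplace
    transform
of its kernel at \<open>L\<close>. Both the growth bound and the existence proof rest on this.
\<close>

lemma conv_kernel_exp_bound:
  fixes h :: "real \<Rightarrow> real"
  assumes b: "b > 0" and L: "L > 0" and h: "continuous_on {0..} h"
    and N: "\<And>v. 0 \<le> v \<Longrightarrow> v \<le> t \<Longrightarrow> \<bar>h v\<bar> \<le> N * exp (L * v)" and "0 \<le> N"
  shows "\<bar>conv (frac_kernel b) (causal h) t\<bar> \<le> N * L powr (- b) * exp (L * t)"
proof -
  have K: "has_bochner_integral lborel (\<lambda>u. N * exp (L * t) * (exp (- (L * u)) * frac_kernel b u))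
      (N * exp (L * t) * L powr (- b))"
    by (intro has_bochner_integral_mult_right laplace_frac_kernel_real b L)
  have "norm (conv (frac_kernel b) (causal h) t)
      \<le> (LINT u|lborel. norm (frac_kernel b u * causal h (t - u)))"
    unfolding conv_def by (rule integral_norm_bound)
  also have "\<dots> \<le> (LINT u|lborel. N * exp (L * t) * (exp (- (L * u)) * frac_kernel b u))"
  proof (rule integral_mono)
    show "integrable lborel (\<lambda>u. norm (frac_kernel b u * causal h (t - u)))"
      by (intro integrable_norm conv_kernel_integrable b h)
    show "integrable lborel (\<lambda>u. N * exp (L * t) * (exp (- (L * u)) * frac_kernel b u))"
      using K by (simp add: has_bochner_integral_iff)
    fix u
    show "norm (frac_kernel b u * causal h (t - u))
        \<le> N * exp (L * t) * (exp (- (L * u)) * frac_kernel b u)"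
    proof (cases "0 < u \<and> u \<le> t")
      case True
      then have "\<bar>causal h (t - u)\<bar> \<le> N * exp (L * (t - u))" using N[of "t - u"] by simp
      also have "\<dots> = N * exp (L * t) * exp (- (L * u))" by (simp add: algebra_simps flip: exp_add)
      finally have "frac_kernel b u * \<bar>causal h (t - u)\<bar>
          \<le> frac_kernel b u * (N * exp (L * t) * exp (- (L * u)))"
        using frac_kernel_nonneg[OF b, of u] by (rule mult_left_mono)
      then show ?thesis using frac_kernel_nonneg[OF b, of u] by (simp add: abs_mult mult_ac)
    next
      case False
      then have eq0: "frac_kernel b u * causal h (t - u) = 0" by (cases "u > 0") auto
      show ?thesis unfolding eq0 using \<open>0 \<le> N\<close> frac_kernel_nonneg[OF b, of u] by simp
    qed
  qed
  also have "\<dots> = N * L powr (- b) * exp (L * t)" using K by (simp add: has_bochner_integral_iff)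
  finally show ?thesis by simp
qed

definition row_sum :: "real ^ 'n ^ 'n \<Rightarrow> 'n::finite \<Rightarrow> real" where
  "row_sum A k = (\<Sum>j\<in>UNIV. \<bar>A $ k $ j\<bar>)"

lemma row_sum_nonneg: "0 \<le> row_sum A k"
  by (simp add: row_sum_def sum_nonneg)

lemma abs_matvec_le:
  fixes A :: "real ^ 'n ^ 'n::finite" and v :: "real ^ 'n"
  assumes "\<And>j. \<bar>v $ j\<bar> \<le> c"
  shows "\<bar>(A *v v) $ k\<bar> \<le> row_sum A k * c"
proof -
  have "\<bar>(A *v v) $ k\<bar> \<le> (\<Sum>j\<in>UNIV. \<bar>A $ k $ j * v $ j\<bar>)"
    by (simp add: matrix_vector_mult_def)
  also have "\<dots> \<le> (\<Sum>j\<in>UNIV. \<bar>A $ k $ j\<bar> * c)"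
    by (intro sum_mono) (simp add: abs_mult assms mult_left_mono)
  finally show ?thesis by (simp add: row_sum_def sum_distrib_right)
qed

lemma contraction_weight_exists:
  fixes \<alpha> :: "real ^ 'n::finite"
  assumes "\<And>k. 0 < \<alpha> $ k"
  obtains L where "L > 0" "(\<Sum>k\<in>UNIV. row_sum A k * L powr (- (\<alpha> $ k))) \<le> 1 / 2"
proof -
  have "((\<lambda>L. \<Sum>k\<in>UNIV. row_sum A k * L powr (- (\<alpha> $ k))) \<longlongrightarrow> (\<Sum>k\<in>UNIV. row_sum A k * 0)) at_top"
    using assms by (intro tendsto_sum tendsto_mult_left tendsto_neg_powr filterlim_ident) auto
  then have "eventually (\<lambda>L. (\<Sum>k\<in>UNIV. row_sum A k * L powr (- (\<alpha> $ k))) < 1 / 2) at_top"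
    by (intro order_tendstoD(2)) auto
  then have "eventually (\<lambda>L. L > 0 \<and> (\<Sum>k\<in>UNIV. row_sum A k * L powr (- (\<alpha> $ k))) < 1 / 2) at_top"
    using eventually_gt_at_top[of 0] by eventually_elim auto
  then obtain L where "L > 0" "(\<Sum>k\<in>UNIV. row_sum A k * L powr (- (\<alpha> $ k))) < 1 / 2"
    using eventually_happens by (metis (no_types, lifting) trivial_limit_at_top_linorder)
  then show ?thesis using that by simp
qed

text \<open>
Where the weighted solution \<open>m\<close> attains its maximum over \<open>[0,T]\<close>, the integral equation bounds it by
the initial data plus half of that maximum. The resulting bound does not depend on \<open>T\<close>.
\<close>

lemma volterra_solution_exp_bound:
  fixes \<alpha> :: "real ^ 'n::finite"
  assumes \<alpha>: "\<And>k. 0 < \<alpha> $ k" and x: "volterra_solution \<alpha> A x"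
  obtains C L where "L > 0" "\<And>t k. t \<ge> 0 \<Longrightarrow> \<bar>x t $ k\<bar> \<le> C * exp (L * t)"
proof -
  obtain L where L: "L > 0" "(\<Sum>k\<in>UNIV. row_sum A k * L powr (- (\<alpha> $ k))) \<le> 1 / 2"
    using contraction_weight_exists[OF \<alpha>] by blast
  have cx: "continuous_on {0..} x" and vx: "\<And>k t. t \<ge> 0 \<Longrightarrow> x t $ k
      = x 0 $ k + conv (frac_kernel (\<alpha> $ k)) (causal (\<lambda>\<tau>. (A *v x \<tau>) $ k)) t"
    using x unfolding volterra_solution_def by blast+
  define S where "S = (\<Sum>k\<in>UNIV. \<bar>x 0 $ k\<bar>)"
  define m where "m t = exp (- (L * t)) * (\<Sum>k\<in>UNIV. \<bar>x t $ k\<bar>)" for t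
  have cm: "continuous_on {0..} m" unfolding m_def by (intro continuous_intros cx)
  have m_nonneg: "m t \<ge> 0" for t by (simp add: m_def sum_nonneg)
  have x_le_m: "\<bar>x t $ k\<bar> \<le> m t * exp (L * t)" for t k
  proof -
    have "\<bar>x t $ k\<bar> \<le> (\<Sum>k\<in>UNIV. \<bar>x t $ k\<bar>)" by (rule member_le_sum) auto
    also have "\<dots> = m t * exp (L * t)" by (simp add: m_def exp_minus field_simps)
    finally show ?thesis .
  qed
  have m_le: "m T \<le> 2 * S" if T: "T \<ge> 0" for T
  proof -
    obtain t where t: "t \<in> {0..T}" "\<And>u. u \<in> {0..T} \<Longrightarrow> m u \<le> m t"
      using continuous_attains_sup[of "{0..T}" m] T continuous_on_subset[OF cm, of "{0..T}"] by auto
    have k: "exp (- (L * t)) * \<bar>x t $ k\<bar> \<le> \<bar>x 0 $ k\<bar> + row_sum A k * L powr (- (\<alpha> $ k)) * m t" for k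
    proof -
      have "\<bar>conv (frac_kernel (\<alpha> $ k)) (causal (\<lambda>\<tau>. (A *v x \<tau>) $ k)) t\<bar>
          \<le> (row_sum A k * m t) * L powr (- (\<alpha> $ k)) * exp (L * t)"
      proof (rule conv_kernel_exp_bound[OF \<alpha> L(1)])
        show "continuous_on {0..} (\<lambda>\<tau>. (A *v x \<tau>) $ k)" by (rule continuous_on_matvec[OF cx])
        show "0 \<le> row_sum A k * m t" by (simp add: row_sum_nonneg m_nonneg)
        fix v assume v: "0 \<le> v" "v \<le> t"
        have "\<bar>x v $ j\<bar> \<le> m t * exp (L * v)" for j
          using t(2)[of v] t(1) v by (intro order_trans[OF x_le_m[of v j]] mult_right_mono) auto
        then have "\<bar>(A *v x v) $ k\<bar> \<le> row_sum A k * (m t * exp (L * v))" by (rule abs_matvec_le)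
        then show "\<bar>(A *v x v) $ k\<bar> \<le> row_sum A k * m t * exp (L * v)" by (simp add: mult.assoc)
      qed
      then have "\<bar>x t $ k\<bar> \<le> \<bar>x 0 $ k\<bar> + (row_sum A k * m t) * L powr (- (\<alpha> $ k)) * exp (L * t)"
        using vx[of t k] t(1) by auto
      then have "exp (- (L * t)) * \<bar>x t $ k\<bar>
          \<le> exp (- (L * t)) * (\<bar>x 0 $ k\<bar> + (row_sum A k * m t) * L powr (- (\<alpha> $ k)) * exp (L * t))"
        by (intro mult_left_mono) auto
      also have "\<dots> = exp (- (L * t)) * \<bar>x 0 $ k\<bar> + row_sum A k * L powr (- (\<alpha> $ k)) * m t"
        by (simp add: distrib_left exp_minus field_simps)
      also have "exp (- (L * t)) * \<bar>x 0 $ k\<bar> \<le> 1 * \<bar>x 0 $ k\<bar>"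
        using t(1) L(1) by (intro mult_right_mono) auto
      finally show ?thesis by simp
    qed
    have "m t = (\<Sum>k\<in>UNIV. exp (- (L * t)) * \<bar>x t $ k\<bar>)" by (simp add: m_def sum_distrib_left)
    also have "\<dots> \<le> (\<Sum>k\<in>UNIV. \<bar>x 0 $ k\<bar> + row_sum A k * L powr (- (\<alpha> $ k)) * m t)"
      by (intro sum_mono k)
    also have "\<dots> = S + (\<Sum>k\<in>UNIV. row_sum A k * L powr (- (\<alpha> $ k))) * m t"
      by (simp add: sum.distrib S_def sum_distrib_right)
    also have "\<dots> \<le> S + 1 / 2 * m t" using L(2) m_nonneg[of t]
      by (intro add_left_mono mult_right_mono)
    finally have "m t \<le> 2 * S" by simp
    then show ?thesis using t(2)[of T] T by simp
  qed
  show ?thesis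
  proof (rule that[OF L(1)])
    fix t :: real and k assume "t \<ge> 0"
    then show "\<bar>x t $ k\<bar> \<le> 2 * S * exp (L * t)"
      using m_le[of t] by (intro order_trans[OF x_le_m[of t k]] mult_right_mono) auto
  qed
qed

lemma conv_kernel_diff:
  fixes f g :: "real \<Rightarrow> real"
  assumes "b > 0" "continuous_on {0..} f" "continuous_on {0..} g"
  shows "conv (frac_kernel b) (causal f) t - conv (frac_kernel b) (causal g) t
      = conv (frac_kernel b) (causal (\<lambda>u. f u - g u)) t"
proof -
  have "causal (\<lambda>u. f u - g u) v = causal f v - causal g v" for v by (simp add: causal_def)
  then show ?thesis
    unfolding conv_def using assms
    by (simp add: right_diff_distrib conv_kernel_integrable)
qed

text \<open>
Banach's fixed point theorem for \<open>y(t) = exp (- L t) x(t)\<close> in the space of bounded continuous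
functions.
\<close>

lemma volterra_solution_exists:
  fixes \<alpha> x0 :: "real ^ 'n::finite"
  assumes \<alpha>: "\<And>k. 0 < \<alpha> $ k"
  obtains x where "volterra_solution \<alpha> A x" "x 0 = x0"
proof -
  obtain L where L: "L > 0" "(\<Sum>k\<in>UNIV. row_sum A k * L powr (- (\<alpha> $ k))) \<le> 1 / 2"
    using contraction_weight_exists[OF \<alpha>] by blast
  define G :: "(real \<Rightarrow>\<^sub>C (real ^ 'n)) \<Rightarrow> 'n \<Rightarrow> real \<Rightarrow> real"
    where "G y k \<tau> = (A *v (exp (L * \<tau>) *\<^sub>R y \<tau>)) $ k" for y k \<tau>
  \<comment> \<open>At negative times the maximum makes the function constant, so that it is continuous on the
      line.\<close>
  define \<Phi> :: "(real \<Rightarrow>\<^sub>C (real ^ 'n)) \<Rightarrow> real \<Rightarrow> real ^ 'n"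
    where "\<Phi> y t = (\<chi> k. exp (- (L * max t 0))
        * (x0 $ k + conv (frac_kernel (\<alpha> $ k)) (causal (G y k)) t))" for y t
  have cG: "continuous_on {0..} (G y k)" for y k
    unfolding G_def by (intro continuous_on_matvec continuous_intros continuous_on_apply_bcontfun)
  have bound: "exp (- (L * max t 0)) * \<bar>conv (frac_kernel (\<alpha> $ k)) (causal h) t\<bar>
      \<le> row_sum A k * L powr (- (\<alpha> $ k)) * N"
    if h: "continuous_on {0..} h" "\<And>v. 0 \<le> v \<Longrightarrow> \<bar>h v\<bar> \<le> row_sum A k * N * exp (L * v)" and N: "0
        \<le> N" for h k N t
  proof (cases "t \<le> 0")
    case True
    then show ?thesis using N by (simp add: conv_kernel_neg row_sum_nonneg)
  next
    case False
    have "\<bar>conv (frac_kernel (\<alpha> $ k)) (causal h) t\<bar>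
        \<le> row_sum A k * N * L powr (- (\<alpha> $ k)) * exp (L * t)"
      using h N by (intro conv_kernel_exp_bound \<alpha> L(1)) (auto simp: row_sum_nonneg)
    then have "exp (- (L * t)) * \<bar>conv (frac_kernel (\<alpha> $ k)) (causal h) t\<bar>
        \<le> exp (- (L * t)) * (row_sum A k * N * L powr (- (\<alpha> $ k)) * exp (L * t))"
      by (intro mult_left_mono) auto
    then show ?thesis using False by (simp add: exp_minus field_simps)
  qed
  have G_diff: "\<bar>G y k v - G z k v\<bar> \<le> row_sum A k * dist y z * exp (L * v)" for y z k v
  proof -
    have "G y k v - G z k v = (A *v (exp (L * v) *\<^sub>R (y v - z v))) $ k"
      by (simp add: G_def matrix_vector_mult_diff_distrib scaleR_diff_right)
    moreover have "\<bar>(exp (L * v) *\<^sub>R (y v - z v)) $ j\<bar> \<le> dist y z * exp (L * v)" for j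
    proof -
      have "\<bar>(y v - z v) $ j\<bar> \<le> norm (y v - z v)" by (rule component_le_norm_cart)
      also have "\<dots> \<le> dist y z" using dist_bounded[of y v z] by (simp add: dist_norm)
      finally show ?thesis by (simp add: abs_mult mult.commute mult_right_mono)
    qed
    ultimately show ?thesis using abs_matvec_le[of "exp (L * v) *\<^sub>R (y v - z v)" "dist y z
        * exp (L * v)" A k]
      by (simp add: mult.assoc)
  qed
  have G0: "G 0 k v = 0" for k v by (simp add: G_def)
  have \<Phi>_bcont: "\<Phi> y \<in> bcontfun" for y
  proof (rule bcontfun_normI)
    show "continuous_on UNIV (\<Phi> y)"
      unfolding \<Phi>_def
      by (intro continuous_intros continuous_at_imp_continuous_on ballI conv_kernel_isCont \<alpha> cG)
    fix t
    have "norm (\<Phi> y t) \<le> (\<Sum>k\<in>UNIV. \<bar>\<Phi> y t $ k\<bar>)" by (rule norm_le_l1_cart)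
    also have "\<dots> \<le> (\<Sum>k\<in>UNIV. \<bar>x0 $ k\<bar> + row_sum A k * L powr (- (\<alpha> $ k)) * dist y 0)"
    proof (rule sum_mono)
      fix k
      have "\<bar>\<Phi> y t $ k\<bar> \<le> exp (- (L * max t 0))
          * (\<bar>x0 $ k\<bar> + \<bar>conv (frac_kernel (\<alpha> $ k)) (causal (G y k)) t\<bar>)"
        by (auto simp: \<Phi>_def abs_mult intro!: mult_left_mono)
      also have "\<dots> \<le> 1 * \<bar>x0 $ k\<bar> + row_sum A k * L powr (- (\<alpha> $ k)) * dist y 0"
        unfolding distrib_left using L(1) G_diff[of y k _ 0]
        by (intro add_mono bound cG mult_right_mono) (auto simp: G0)
      finally show "\<bar>\<Phi> y t $ k\<bar> \<le> \<bar>x0 $ k\<bar> + row_sum A k * L powr (- (\<alpha> $ k)) * dist y 0" by simp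
    qed
    finally show "norm (\<Phi> y t) \<le> (\<Sum>k\<in>UNIV. \<bar>x0 $ k\<bar> + row_sum A k * L powr (- (\<alpha> $ k)) * dist y 0)"
        .
  qed
  have "\<forall>y z. dist (Bcontfun (\<Phi> y)) (Bcontfun (\<Phi> z)) \<le> 1 / 2 * dist y z"
  proof (intro allI dist_bound)
    fix y z t
    have "dist (\<Phi> y t) (\<Phi> z t) \<le> (\<Sum>k\<in>UNIV. \<bar>(\<Phi> y t - \<Phi> z t) $ k\<bar>)"
      unfolding dist_norm by (rule norm_le_l1_cart)
    also have "\<dots> \<le> (\<Sum>k\<in>UNIV. row_sum A k * L powr (- (\<alpha> $ k)) * dist y z)"
    proof (rule sum_mono)
      fix k
      have "(\<Phi> y t - \<Phi> z t) $ k = exp (- (L * max t 0))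
          * conv (frac_kernel (\<alpha> $ k)) (causal (\<lambda>v. G y k v - G z k v)) t"
        using conv_kernel_diff[OF \<alpha>[of k] cG[of y k] cG[of z k], of t]
        by (simp add: \<Phi>_def flip: right_diff_distrib)
      then have "\<bar>(\<Phi> y t - \<Phi> z t) $ k\<bar> = exp (- (L * max t 0))
          * \<bar>conv (frac_kernel (\<alpha> $ k)) (causal (\<lambda>v. G y k v - G z k v)) t\<bar>"
        by (simp add: abs_mult)
      also have "\<dots> \<le> row_sum A k * L powr (- (\<alpha> $ k)) * dist y z"
        by (intro bound continuous_intros cG G_diff) auto
      finally show "\<bar>(\<Phi> y t - \<Phi> z t) $ k\<bar> \<le> row_sum A k * L powr (- (\<alpha> $ k)) * dist y z" .
    qed
    also have "\<dots> = (\<Sum>k\<in>UNIV. row_sum A k * L powr (- (\<alpha> $ k))) * dist y z"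
      by (simp add: sum_distrib_right)
    also have "\<dots> \<le> 1 / 2 * dist y z" using L(2) by (intro mult_right_mono) auto
    finally show "dist (apply_bcontfun (Bcontfun (\<Phi> y)) t) (apply_bcontfun (Bcontfun (\<Phi> z)) t)
        \<le> 1 / 2 * dist y z"
      by (simp add: Bcontfun_inverse \<Phi>_bcont)
  qed
  then obtain y where "Bcontfun (\<Phi> y) = y"
    using banach_fix_type[of "1/2" "\<lambda>y. Bcontfun (\<Phi> y)"] by auto
  then have y: "apply_bcontfun y t = \<Phi> y t" for t by (metis Bcontfun_inverse \<Phi>_bcont)
  define x where "x t = exp (L * t) *\<^sub>R y t" for t
  have x: "x t $ k = x0 $ k + conv (frac_kernel (\<alpha> $ k)) (causal (\<lambda>\<tau>. (A *v x \<tau>) $ k)) t"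
      if "t \<ge> 0" for t k
  proof -
    have "G y k = (\<lambda>\<tau>. (A *v x \<tau>) $ k)" by (simp add: G_def x_def fun_eq_iff)
    moreover have "x t $ k = exp (L * t) * \<Phi> y t $ k" by (simp add: x_def y)
    ultimately show ?thesis using that by (simp add: \<Phi>_def exp_minus)
  qed
  have x0: "x 0 = x0" using x[of 0] by (simp add: vec_eq_iff conv_kernel_neg)
  have "continuous_on {0..} x" unfolding x_def[abs_def]
    by (intro continuous_intros continuous_on_apply_bcontfun)
  then have "volterra_solution \<alpha> A x"
    unfolding volterra_solution_def x0 using x by blast
  then show ?thesis using x0 by (rule that)
qed

section \<open>The Laplace transform of a solution\<close>

definition char_matrix :: "real ^ 'n \<Rightarrow> real ^ 'n ^ 'n::finite \<Rightarrow> complex \<Rightarrow> complex ^ 'n ^ 'n" where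
  "char_matrix \<alpha> A s = diag_matrix (\<lambda>k. s powr complex_of_real (\<alpha> $ k))
      - map_matrix complex_of_real A"

lemma char_fun_eq_det: "char_fun \<alpha> A s = det (char_matrix \<alpha> A s)"
  by (simp add: char_fun_def char_matrix_def)

lemma char_matrix_mult:
  fixes \<alpha> :: "real ^ 'n::finite"
  shows "(char_matrix \<alpha> A s *v v) $ k = s powr complex_of_real (\<alpha> $ k) * v $ k
      - (\<Sum>j\<in>UNIV. of_real (A $ k $ j) * v $ j)"
proof -
  have "(char_matrix \<alpha> A s *v v) $ k = (\<Sum>j\<in>UNIV.
      (if k = j then s powr complex_of_real (\<alpha> $ k) else 0) * v $ j - of_real (A $ k $ j) * v $ j)"
    by (simp add: char_matrix_def matrix_vector_mult_def diag_matrix_def map_matrix_def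
        left_diff_distrib)
  also have "\<dots> = (\<Sum>j\<in>UNIV. if k = j then s powr complex_of_real (\<alpha> $ k) * v $ j else 0)
      - (\<Sum>j\<in>UNIV. of_real (A $ k $ j) * v $ j)"
    by (simp add: sum_subtractf if_distrib[of "\<lambda>a. a * _"] cong: if_cong)
  finally show ?thesis by simp
qed

definition laplace_vec :: "(real \<Rightarrow> real ^ 'n::finite) \<Rightarrow> complex \<Rightarrow> complex ^ 'n" where
  "laplace_vec x s = (\<chi> k. laplace (causal (\<lambda>t. x t $ k)) s)"

lemma laplace_volterra_solution:
  fixes \<alpha> :: "real ^ 'n::finite"
  assumes \<alpha>: "\<And>k. 0 < \<alpha> $ k" and x: "volterra_solution \<alpha> A x"
    and bd: "\<And>t k. t \<ge> 0 \<Longrightarrow> \<bar>x t $ k\<bar> \<le> C * exp (L * t)" and s: "0 \<le> L" "L < Re s"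
  shows "char_matrix \<alpha> A s *v laplace_vec x s
      = (\<chi> k. s powr of_real (\<alpha> $ k - 1) * of_real (x 0 $ k))"
proof -
  have cx: "continuous_on {0..} x" and vx: "\<And>k t. t \<ge> 0 \<Longrightarrow> x t $ k
      = x 0 $ k + conv (frac_kernel (\<alpha> $ k)) (causal (\<lambda>\<tau>. (A *v x \<tau>) $ k)) t"
    using x unfolding volterra_solution_def by blast+
  have s0: "Re s > 0" "s \<noteq> 0" using s by auto
  have lx: "laplace_integrable (causal (\<lambda>t. x t $ k)) s" for k
    by (rule laplace_integrable_exp_bound[OF continuous_on_component[OF cx] bd s(2)])
  have "s powr complex_of_real (\<alpha> $ k) * laplace_vec x s $ k
      - (\<Sum>j\<in>UNIV. of_real (A $ k $ j) * laplace_vec x s $ j)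
     = s powr of_real (\<alpha> $ k - 1) * of_real (x 0 $ k)" for k
  proof -
    have cA: "continuous_on {0..} (\<lambda>\<tau>. (A *v x \<tau>) $ k)" by (rule continuous_on_matvec[OF cx])
    have Ax: "causal (\<lambda>\<tau>. (A *v x \<tau>) $ k) = (\<lambda>t. \<Sum>j\<in>UNIV. A $ k $ j * causal (\<lambda>t. x t $ j) t)"
      by (auto simp: fun_eq_iff causal_def matrix_vector_mult_def)
    have lA: "laplace_integrable (causal (\<lambda>\<tau>. (A *v x \<tau>) $ k)) s"
    proof (rule laplace_integrable_exp_bound[OF cA _ s(2)])
      fix t :: real assume "0 \<le> t"
      then show "\<bar>(A *v x t) $ k\<bar> \<le> (row_sum A k * C) * exp (L * t)"
        using abs_matvec_le[of "x t" "C * exp (L * t)" A k] bd by (simp add: mult.assoc)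
    qed
    have lk: "laplace_integrable (frac_kernel (\<alpha> $ k)) s"
      by (rule laplace_integrable_kernel[OF \<alpha> s0(1)])
    have lc: "laplace_integrable (causal (\<lambda>_. x 0 $ k)) s"
    proof (rule laplace_integrable_exp_bound[of _ "\<bar>x 0 $ k\<bar>" 0])
    qed (use s0 in auto)
    have "causal (\<lambda>t. x t $ k) = (\<lambda>t. causal (\<lambda>_. x 0 $ k) t
        + conv (frac_kernel (\<alpha> $ k)) (causal (\<lambda>\<tau>. (A *v x \<tau>) $ k)) t)"
    proof
      fix t show "causal (\<lambda>t. x t $ k) t
          = causal (\<lambda>_. x 0 $ k) t + conv (frac_kernel (\<alpha> $ k)) (causal (\<lambda>\<tau>. (A *v x \<tau>) $ k)) t"
        using vx[of t k] by (cases "t \<ge> 0") (auto simp: conv_kernel_neg)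
    qed
    then have "laplace_vec x s $ k = laplace (causal (\<lambda>_. x 0 $ k)) s
        + laplace (conv (frac_kernel (\<alpha> $ k)) (causal (\<lambda>\<tau>. (A *v x \<tau>) $ k))) s"
      by (simp add: laplace_vec_def laplace_add[OF lc laplace_integrable_conv[OF lk lA]])
    also have "\<dots> = of_real (x 0 $ k) / s + s powr (- of_real (\<alpha> $ k))
        * (\<Sum>j\<in>UNIV. of_real (A $ k $ j) * laplace_vec x s $ j)"
      using laplace_sum_scaled[of UNIV "\<lambda>j. causal (\<lambda>t. x t $ j)" s "\<lambda>j. A $ k $ j", OF lx]
      by (simp add: laplace_causal_const[OF s0(1)] laplace_conv[OF lk lA]
          laplace_kernel[OF \<alpha> s0(1)]) (simp add: Ax laplace_vec_def)
    finally have "s powr of_real (\<alpha> $ k) * laplace_vec x s $ k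
        = s powr of_real (\<alpha> $ k) * (of_real (x 0 $ k) / s)
        + (s powr of_real (\<alpha> $ k) * s powr (- of_real (\<alpha> $ k)))
        * (\<Sum>j\<in>UNIV. of_real (A $ k $ j) * laplace_vec x s $ j)"
      by (simp add: distrib_left mult.assoc)
    also have "s powr of_real (\<alpha> $ k) * s powr (- of_real (\<alpha> $ k)) = 1"
      using s0 by (simp flip: powr_add)
    finally show ?thesis using s0 by (simp add: powr_diff)
  qed
  then show ?thesis by (simp add: vec_eq_iff char_matrix_mult)
qed

section \<open>A zero in the closed right half-plane prevents stability\<close>

lemma det_eq_0_iff_kernel:
  fixes M :: "'a::field ^ 'n ^ 'n"
  shows "det M = 0 \<longleftrightarrow> (\<exists>v. v \<noteq> 0 \<and> M *v v = 0)"
  using invertible_det_nz[of M] invertible_left_inverse[of M] matrix_left_invertible_ker[of M]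
  by auto

lemma bounded_of_tendsto_zero:
  fixes h :: "real \<Rightarrow> real"
  assumes h: "continuous_on {0..} h" and lim: "(h \<longlongrightarrow> 0) at_top"
  obtains M where "M \<ge> 0" "\<And>t. t \<ge> 0 \<Longrightarrow> \<bar>h t\<bar> \<le> M"
proof -
  obtain T where T: "\<And>t. t \<ge> T \<Longrightarrow> \<bar>h t\<bar> < 1"
    using tendstoD[OF lim, of 1] by (auto simp: eventually_at_top_linorder)
  obtain M where M: "M \<ge> 0" "\<And>u. u \<le> T \<Longrightarrow> norm (causal h u) \<le> M"
    using causal_bounded[OF h] by blast
  show ?thesis
  proof (rule that[of "max M 1"])
    fix t :: real assume "t \<ge> 0"
    then show "\<bar>h t\<bar> \<le> max M 1"
      using M(2)[of t] T[of t] by (cases "t \<le> T") auto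
  qed auto
qed

text \<open>
The substitution \<open>t = v / \<epsilon>\<close> turns \<open>\<epsilon>\<close> times the transform into an average of \<open>h(v / \<epsilon>)\<close> with the
weight \<open>exp (- v)\<close>.
\<close>

lemma abelian_laplace:
  fixes h :: "real \<Rightarrow> real"
  assumes h: "continuous_on {0..} h" and lim: "(h \<longlongrightarrow> 0) at_top" and z: "Re z \<ge> 0"
  shows "(\<lambda>n. laplace (causal h) (z + of_real (inverse (real (Suc n))))
      * of_real (inverse (real (Suc n)))) \<longlonglongrightarrow> 0"
proof -
  obtain M where M: "M \<ge> 0" "\<And>t. t \<ge> 0 \<Longrightarrow> \<bar>h t\<bar> \<le> M"
    using bounded_of_tendsto_zero[OF h lim] by blast
  note [measurable] = measurable_causal[OF h]
  have expint: "integrable lborel (\<lambda>v. M * (exp (- (1 * v)) * indicator {0..} v))"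
  proof (intro integrable_mult_right)
    have "integrable lborel (\<lambda>v. exp (- (1 * v)) * frac_kernel 1 v)"
      using laplace_frac_kernel_real[of 1 1] by (simp add: has_bochner_integral_iff)
    moreover have "AE v in lborel. exp (- (1 * v)) * frac_kernel 1 v
        = exp (- (1 * v)) * indicator {0..} v"
      using AE_lborel_singleton[of 0] by eventually_elim (auto simp: frac_kernel_def indicator_def)
    ultimately show "integrable lborel (\<lambda>v. exp (- (1 * v)) * indicat_real {0..} v)"
      by (subst (asm) integrable_cong_AE) auto
  qed
  have lim0: "(\<lambda>n. LINT v|lborel. exp (- v) * \<bar>causal h (real (Suc n) * v)\<bar>)
      \<longlonglongrightarrow> (LINT v|(lborel :: real measure). (0::real))"
  proof (rule integral_dominated_convergence[where w="\<lambda>v. M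
      * (exp (- (1 * v)) * indicator {0..} v)"])
    show "integrable lborel (\<lambda>v. M * (exp (- (1 * v)) * indicator {0..} v))" by (rule expint)
    show "AE v in lborel. (\<lambda>n. exp (- v) * \<bar>causal h (real (Suc n) * v)\<bar>) \<longlonglongrightarrow> 0"
      using AE_lborel_singleton[of 0]
    proof eventually_elim
      fix v :: real assume "v \<noteq> 0"
      show "(\<lambda>n. exp (- v) * \<bar>causal h (real (Suc n) * v)\<bar>) \<longlonglongrightarrow> 0"
      proof (cases "v > 0")
        case True
        have "filterlim (\<lambda>n. real (Suc n) * v) at_top sequentially"
          using True by (intro filterlim_at_top_mult_tendsto_pos[OF tendsto_const]
              filterlim_compose[OF filterlim_real_sequentially filterlim_Suc]) auto
        then have "(\<lambda>n. h (real (Suc n) * v)) \<longlonglongrightarrow> 0" by (rule filterlim_compose[OF lim])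
        then have "(\<lambda>n. exp (- v) * \<bar>h (real (Suc n) * v)\<bar>) \<longlonglongrightarrow> exp (- v) * \<bar>0\<bar>"
          by (intro tendsto_intros)
        then show ?thesis using True by simp
      next
        case False
        then have "real (Suc n) * v < 0" for n using \<open>v \<noteq> 0\<close> by (simp add: mult_less_0_iff)
        then show ?thesis by simp
      qed
    qed
    show "AE v in lborel. norm (exp (- v) * \<bar>causal h (real (Suc n) * v)\<bar>)
        \<le> M * (exp (- (1 * v)) * indicator {0..} v)" for n
    proof (rule AE_I2)
      fix v :: real
      show "norm (exp (- v) * \<bar>causal h (real (Suc n) * v)\<bar>)
          \<le> M * (exp (- (1 * v)) * indicator {0..} v)"
      proof (cases "v \<ge> 0")
        case True
        then show ?thesis using M(2)[of "real (Suc n) * v"]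
          by (simp add: abs_mult mult.commute[of M])
      next
        case False
        then have "real (Suc n) * v < 0" by (simp add: mult_less_0_iff)
        then show ?thesis using False by simp
      qed
    qed
  qed measurable
  have bound: "norm (laplace (causal h) (z + of_real (inverse (real (Suc n))))
      * of_real (inverse (real (Suc n))))
      \<le> (LINT v|lborel. exp (- v) * \<bar>causal h (real (Suc n) * v)\<bar>)" for n
  proof -
    define \<epsilon> where "\<epsilon> = inverse (real (Suc n))"
    have \<epsilon>: "\<epsilon> > 0" by (simp add: \<epsilon>_def)
    have "norm (laplace (causal h) (z + of_real \<epsilon>))
        \<le> (LINT t|lborel. norm (exp (- ((z + of_real \<epsilon>) * of_real t))
        * complex_of_real (causal h t)))"
      unfolding laplace_def by (rule integral_norm_bound)
    also have "\<dots> \<le> (LINT t|lborel. exp (- (\<epsilon> * t)) * \<bar>causal h t\<bar>)"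
    proof (rule integral_mono)
      show "integrable lborel (\<lambda>t. norm (exp (- ((z + of_real \<epsilon>) * of_real t))
          * complex_of_real (causal h t)))"
        using laplace_integrable_exp_bound[OF h, of M 0 "z + of_real \<epsilon>"] M \<epsilon> z
        unfolding laplace_integrable_def by (intro integrable_norm) auto
      have "integrable lborel (\<lambda>t. norm (exp (- (of_real \<epsilon> * of_real t))
          * complex_of_real (causal h t)))"
        using laplace_integrable_exp_bound[OF h, of M 0 "of_real \<epsilon>"] M \<epsilon>
        unfolding laplace_integrable_def by (intro integrable_norm) auto
      then show "integrable lborel (\<lambda>t. exp (- (\<epsilon> * t)) * \<bar>causal h t\<bar>)" by (simp add: norm_mult)
      show "norm (exp (- ((z + of_real \<epsilon>) * of_real t)) * complex_of_real (causal h t))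
          \<le> exp (- (\<epsilon> * t)) * \<bar>causal h t\<bar>" for t
      proof (cases "t \<ge> 0")
        case True
        then have "- ((Re z + \<epsilon>) * t) \<le> - (\<epsilon> * t)" using z by (simp add: distrib_right)
        then show ?thesis by (simp add: norm_mult mult_right_mono)
      qed simp
    qed
    also have "\<dots> = real (Suc n) * (LINT v|lborel. exp (- v) * \<bar>causal h (real (Suc n) * v)\<bar>)"
      by (subst lborel_integral_real_affine[where c="real (Suc n)" and t=0])
          (simp_all add: \<epsilon>_def mult.assoc[symmetric] del: of_nat_Suc)
    finally have "norm (laplace (causal h) (z + of_real \<epsilon>)) * \<epsilon>
        \<le> (LINT v|lborel. exp (- v) * \<bar>causal h (real (Suc n) * v)\<bar>)"
      by (simp add: \<epsilon>_def field_simps)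
    then show ?thesis unfolding \<epsilon>_def[symmetric] norm_mult using \<epsilon> by simp
  qed
  show ?thesis
    by (rule Lim_null_comparison[OF always_eventually]) (use bound lim0 in auto)
qed

lemma volterra_solution_stable:
  assumes st: "asymptotically_stable \<alpha> A" and \<alpha>: "\<And>k. 0 < \<alpha> $ k \<and> \<alpha> $ k
      \<le> 1" and x: "volterra_solution \<alpha> A x"
  shows "((\<lambda>t. x t $ k) \<longlongrightarrow> 0) at_top"
proof -
  have "(x \<longlongrightarrow> 0) at_top" using st x \<alpha> by (simp add: asymptotically_stable_def
      frac_solution_iff_volterra)
  then have "((\<lambda>t. x t $ k) \<longlongrightarrow> 0 $ k) at_top" by (rule tendsto_vec_nth)
  then show ?thesis by simp
qed

text \<open>
If all solutions decay, their transforms grow more slowly than \<open>1 / \<epsilon>\<close> at the points \<open>z + \<epsilon>\<close>, by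
\<open>abelian_laplace\<close>. At a zero \<open>z \<noteq> 0\<close> of \<open>\<chi>\<close> this forces every left kernel vector to vanish; a zero
    at
the origin is a constant solution.
\<close>

theorem not_stable_if_char_zero:
  fixes \<alpha> :: "real ^ 'n::finite"
  assumes \<alpha>: "\<And>k. 0 < \<alpha> $ k \<and> \<alpha> $ k \<le> 1" and z: "char_fun \<alpha> A z = 0" "Re z \<ge> 0"
  shows "\<not> asymptotically_stable \<alpha> A"
proof
  assume st: "asymptotically_stable \<alpha> A"
  have \<alpha>0: "0 < \<alpha> $ k" for k using \<alpha> by blast
  show False
  proof (cases "z = 0")
    case True
    obtain v where v: "v \<noteq> 0" "char_matrix \<alpha> A 0 *v v = 0"
      using z(1) True unfolding char_fun_eq_det det_eq_0_iff_kernel by blast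
    have Av: "(\<Sum>j\<in>UNIV. of_real (A $ k $ j) * v $ j) = 0" for k
      using v(2) \<alpha>0[of k] by (simp add: vec_eq_iff char_matrix_mult)
    \<comment> \<open>The real and imaginary parts of the kernel vector give real constant solutions.\<close>
    have const: "w = 0" if w: "A *v w = 0" for w
    proof -
      have "volterra_solution \<alpha> A (\<lambda>_. w)"
      proof -
        have "conv (frac_kernel b) (causal (\<lambda>_. 0)) t = 0" for b t :: real
          by (simp add: conv_def causal_def)
        then show ?thesis by (simp add: volterra_solution_def w)
      qed
      from volterra_solution_stable[OF st \<alpha> this] have "w $ k = 0" for k
        by (simp add: tendsto_const_iff)
      then show ?thesis by (simp add: vec_eq_iff)
    qed
    have "A *v (\<chi> j. Re (v $ j)) = 0"
      using arg_cong[OF Av, of Re] by (simp add: vec_eq_iff matrix_vector_mult_def)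
    moreover have "A *v (\<chi> j. Im (v $ j)) = 0"
      using arg_cong[OF Av, of Im] by (simp add: vec_eq_iff matrix_vector_mult_def)
    ultimately have "(\<chi> j. Re (v $ j)) = 0" "(\<chi> j. Im (v $ j)) = 0" using const by blast+
    then have "v = 0" by (simp add: vec_eq_iff complex_eq_iff)
    with v(1) show False by simp
  next
    case False
    then have zR: "z \<notin> \<real>\<^sub>\<le>\<^sub>0" using z(2) by (auto simp: complex_nonpos_Reals_iff complex_eq_iff)
    obtain w where w: "w \<noteq> 0" "transpose (char_matrix \<alpha> A z) *v w = 0"
    proof -
      have "det (transpose (char_matrix \<alpha> A z)) = 0" using z(1) by (simp add: char_fun_eq_det)
      then show ?thesis using that unfolding det_eq_0_iff_kernel by blast
    qed
    have left: "(\<Sum>k\<in>UNIV. w $ k * (char_matrix \<alpha> A z *v v) $ k) = 0" for v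
    proof -
      have "(\<Sum>k\<in>UNIV. w $ k * (char_matrix \<alpha> A z *v v) $ k)
          = (\<Sum>k\<in>UNIV. \<Sum>j\<in>UNIV. w $ k * (char_matrix \<alpha> A z $ k $ j * v $ j))"
        by (simp add: matrix_vector_mult_def sum_distrib_left)
      also have "\<dots> = (\<Sum>j\<in>UNIV. \<Sum>k\<in>UNIV. w $ k * (char_matrix \<alpha> A z $ k $ j * v $ j))"
        by (rule sum.swap)
      also have "\<dots> = (\<Sum>j\<in>UNIV. (transpose (char_matrix \<alpha> A z) *v w) $ j * v $ j)"
        by (simp add: matrix_vector_mult_def transpose_def sum_distrib_left mult_ac)
      finally show ?thesis unfolding w(2) by simp
    qed
    have "w $ i = 0" for i
    proof -
      \<comment> \<open>The initial value e_i isolates the i-th component of w.\<close>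
      obtain x where x: "volterra_solution \<alpha> A x" "x 0 = axis i 1"
        using volterra_solution_exists[OF \<alpha>0] by blast
      have cx: "continuous_on {0..} (\<lambda>t. x t $ k)" for k
        using x(1) by (intro continuous_on_component) (simp add: volterra_solution_def)
      have lx: "((\<lambda>t. x t $ k) \<longlongrightarrow> 0) at_top" for k by (rule volterra_solution_stable[OF st \<alpha> x(1)])
      have "\<exists>M. \<forall>k. \<forall>t\<ge>0. \<bar>x t $ k\<bar> \<le> M"
      proof -
        have "\<exists>M\<ge>0. \<forall>t\<ge>0. \<bar>x t $ k\<bar> \<le> M" for k using bounded_of_tendsto_zero[OF cx lx] by metis
        then obtain M where M: "\<And>k. M k \<ge> 0" "\<And>k t. t \<ge> 0 \<Longrightarrow> \<bar>x t $ k\<bar> \<le> M k" by metis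
        have "M k \<le> (\<Sum>k\<in>UNIV. M k)" for k by (rule member_le_sum) (use M in auto)
        then show ?thesis using M(2) order_trans by blast
      qed
      then obtain M where M: "\<And>k t. t \<ge> 0 \<Longrightarrow> \<bar>x t $ k\<bar> \<le> M" by blast
      \<comment> \<open>The points s n approach z from the right, inside the region where the transform exists.\<close>
      define \<epsilon> where "\<epsilon> n = inverse (real (Suc n))" for n
      define s where "s n = z + of_real (\<epsilon> n)" for n
      have \<epsilon>: "\<epsilon> n > 0" for n by (simp add: \<epsilon>_def)
      have \<epsilon>0: "\<epsilon> \<longlonglongrightarrow> 0" unfolding \<epsilon>_def[abs_def] by (rule LIMSEQ_inverse_real_of_nat)
      have s0: "s \<longlonglongrightarrow> z"
      proof -
        have "s \<longlonglongrightarrow> z + of_real 0" unfolding s_def[abs_def] by (intro tendsto_intros \<epsilon>0)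
        then show ?thesis by simp
      qed
      have eq: "(\<Sum>k\<in>UNIV. w $ k * (((s n powr of_real (\<alpha> $ k) - z powr of_real (\<alpha> $ k))
          / of_real (\<epsilon> n)) * (laplace (causal (\<lambda>t. x t $ k)) (s n) * of_real (\<epsilon> n))))
          = w $ i * s n powr of_real (\<alpha> $ i - 1)" for n
      proof -
        have "char_matrix \<alpha> A (s n) *v laplace_vec x (s n)
            = (\<chi> k. s n powr of_real (\<alpha> $ k - 1) * of_real (x 0 $ k))"
          by (rule laplace_volterra_solution[OF \<alpha>0 x(1), of M 0])
              (use M \<epsilon>[of n] z(2) in \<open>auto simp: s_def\<close>)
        then have "(\<Sum>k\<in>UNIV. w $ k * (char_matrix \<alpha> A (s n) *v laplace_vec x (s n)) $ k)
            = (\<Sum>k\<in>UNIV. w $ k * (s n powr of_real (\<alpha> $ k - 1) * of_real (x 0 $ k)))"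
          by simp
        also have "\<dots> = (\<Sum>k\<in>UNIV. if k = i then w $ k * s n powr of_real (\<alpha> $ k - 1) else 0)"
          by (intro sum.cong) (auto simp: x(2) axis_def)
        also have "\<dots> = w $ i * s n powr of_real (\<alpha> $ i - 1)" by simp
        finally have e1: "(\<Sum>k\<in>UNIV. w $ k * (char_matrix \<alpha> A (s n) *v laplace_vec x (s n)) $ k)
            = w $ i * s n powr of_real (\<alpha> $ i - 1)" .
        have "(\<Sum>k\<in>UNIV. w $ k * (char_matrix \<alpha> A (s n) *v laplace_vec x (s n)) $ k) =
            (\<Sum>k\<in>UNIV. w $ k * (char_matrix \<alpha> A (s n) *v laplace_vec x (s n)) $ k)
                - (\<Sum>k\<in>UNIV. w $ k * (char_matrix \<alpha> A z *v laplace_vec x (s n)) $ k)"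
          by (simp add: left)
        also have "\<dots> = (\<Sum>k\<in>UNIV. w $ k *
            ((s n powr of_real (\<alpha> $ k) - z powr of_real (\<alpha> $ k))
            * laplace (causal (\<lambda>t. x t $ k)) (s n)))"
          unfolding sum_subtractf[symmetric]
          by (intro sum.cong refl) (simp add: char_matrix_mult laplace_vec_def algebra_simps)
        finally show ?thesis using e1 \<epsilon>[of n] by simp
      qed
      have "(\<lambda>n. \<Sum>k\<in>UNIV. w $ k * (((s n powr of_real (\<alpha> $ k) - z powr of_real (\<alpha> $ k))
          / of_real (\<epsilon> n)) * (laplace (causal (\<lambda>t. x t $ k)) (s n) * of_real (\<epsilon> n))))
         \<longlonglongrightarrow> (\<Sum>k\<in>UNIV. w $ k * ((of_real (\<alpha> $ k) * z powr (of_real (\<alpha> $ k) - 1)) * 0))"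
      proof (intro tendsto_sum tendsto_mult tendsto_const)
        fix k
        show "(\<lambda>n. laplace (causal (\<lambda>t. x t $ k)) (s n) * of_real (\<epsilon> n)) \<longlonglongrightarrow> 0"
          unfolding s_def \<epsilon>_def by (rule abelian_laplace[OF cx lx z(2)])
        have "((\<lambda>h. ((z + h) powr of_real (\<alpha> $ k) - z powr of_real (\<alpha> $ k)) / h) \<longlongrightarrow> of_real (\<alpha> $ k)
            * z powr (of_real (\<alpha> $ k) - 1)) (at 0)"
          using has_field_derivative_powr[OF zR, of "of_real (\<alpha> $ k)"] by (simp add: DERIV_def)
        moreover have "filterlim (\<lambda>n. complex_of_real (\<epsilon> n)) (at 0) sequentially"
          using tendsto_of_real[OF \<epsilon>0, where 'a=complex] less_imp_neq[OF \<epsilon>]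
          by (auto simp: filterlim_at)
        ultimately show "(\<lambda>n. (s n powr of_real (\<alpha> $ k) - z powr of_real (\<alpha> $ k)) / of_real (\<epsilon> n))
            \<longlonglongrightarrow> of_real (\<alpha> $ k) * z powr (of_real (\<alpha> $ k) - 1)"
          unfolding s_def by (rule filterlim_compose)
      qed
      then have "(\<lambda>n. w $ i * s n powr of_real (\<alpha> $ i - 1)) \<longlonglongrightarrow> 0" unfolding eq by simp
      moreover have "(\<lambda>n. w $ i * s n powr of_real (\<alpha> $ i - 1))
          \<longlonglongrightarrow> w $ i * z powr of_real (\<alpha> $ i - 1)"
        by (intro tendsto_mult tendsto_const tendsto_powr_complex zR s0)
      ultimately have "w $ i * z powr of_real (\<alpha> $ i - 1) = 0" using LIMSEQ_unique by blast
      then show ?thesis using False by simp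
    qed
    then show False using w(1) by (simp add: vec_eq_iff)
  qed
qed

section \<open>Fourier inversion and the Riemann-Lebesgue lemma\<close>

lemma gaussian_fourier:
  assumes n: "n > 0"
  shows "(LINT \<omega>|lborel. exp (\<i> * of_real (\<omega> * v)) * of_real (std_normal_density (\<omega> / n)))
      = of_real (n * exp (- (n * v)\<^sup>2 / 2))"
proof -
  have "char std_normal_distribution (n * v)
      = (LINT w|lborel. std_normal_density w *\<^sub>R iexp (n * v * w))"
    unfolding char_def by (subst integral_density) auto
  then have *: "(LINT w|lborel. iexp (n * v * w) * of_real (std_normal_density w))
      = of_real (exp (- (n * v)\<^sup>2 / 2))"
    by (simp add: char_std_normal_distribution scaleR_conv_of_real mult.commute)
  have "(LINT \<omega>|lborel. iexp (\<omega> * v) * of_real (std_normal_density (\<omega> / n)))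
      = n *\<^sub>R (LINT w|lborel. iexp (n * v * w) * of_real (std_normal_density w))"
    using n by (subst lborel_integral_real_affine[where c=n and t=0]) (auto simp: mult_ac)
  then show ?thesis unfolding * by (simp add: scaleR_conv_of_real)
qed

lemma gaussian_integral: "has_bochner_integral lborel (\<lambda>v. exp (- v\<^sup>2 / 2)) (sqrt (2 * pi))"
proof -
  have "has_bochner_integral lborel (\<lambda>v. sqrt (2 * pi) * std_normal_density v) (sqrt (2 * pi) * 1)"
    using integrable_normal_density[of 1 0] integral_normal_density[of 1 0]
    by (intro has_bochner_integral_mult_right) (simp add: has_bochner_integral_iff)
  then show ?thesis by (simp add: std_normal_density_def)
qed

text \<open>
A Gaussian factor of width \<open>n\<close> in the frequency makes Fubini's theorem applicable and turns the
inversion integral into the mean of \<open>h(t - v / n)\<close> over a Gaussian variable \<open>v\<close>. Both sides converge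
by dominated convergence.
\<close>

theorem fourier_inversion:
  fixes h :: "real \<Rightarrow> complex"
  defines "H \<equiv> \<lambda>\<omega>. LINT t|lborel. exp (- (\<i> * of_real (\<omega> * t))) * h t"
  assumes h: "integrable lborel h" and cont: "continuous_on UNIV h" and M: "\<And>t. norm (h t) \<le> M"
    and H: "integrable lborel H"
  shows "h t = (LINT \<omega>|lborel. exp (\<i> * of_real (\<omega> * t)) * H \<omega>) / of_real (2 * pi)"
proof -
  have [measurable]: "h \<in> borel_measurable borel" "H \<in> borel_measurable borel" using h H by auto
  have sd: "std_normal_density x = exp (- x\<^sup>2 / 2) / sqrt (2 * pi)" for x
    by (simp add: std_normal_density_def)
  have sd_le: "norm (std_normal_density x) \<le> std_normal_density 0" for x
    by (auto simp: sd divide_right_mono)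
  have eq: "(LINT \<omega>|lborel. exp (\<i> * of_real (\<omega> * t)) * H \<omega> * of_real (std_normal_density (\<omega> / n)))
     = (LINT v|lborel. h (t - v / n) * of_real (exp (- v\<^sup>2 / 2)))" (is "?L = ?R")
    if n: "n > 0" for n :: real
  proof -
    let ?f = "\<lambda>\<omega> u. exp (\<i> * of_real (\<omega> * (t - u))) * of_real (std_normal_density (\<omega> / n)) * h u"
    have sdi: "integrable lborel (\<lambda>\<omega>. std_normal_density (\<omega> / n))"
      using lborel_integrable_real_affine[OF integrable_normal_density[of 1 0], of "1/n" 0] n
      by simp
    have int: "integrable (lborel \<Otimes>\<^sub>M lborel) (\<lambda>(\<omega>, u). ?f \<omega> u)"
    proof (rule lborel_pair.Fubini_integrable)
      have "(LINT u|lborel. norm (?f \<omega> u))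
          = std_normal_density (\<omega> / n) * (LINT u|lborel. norm (h u))" for \<omega>
        by (simp add: norm_mult)
      then show "integrable lborel (\<lambda>\<omega>. LINT u|lborel. norm (case (\<omega>, u) of (\<omega>, u) \<Rightarrow> ?f \<omega> u))"
        using sdi by simp
      have "integrable lborel (?f \<omega>)" for \<omega>
        by (rule Bochner_Integration.integrable_bound[OF
            integrable_mult_right[OF integrable_norm[OF h], of "std_normal_density (\<omega> / n)"]])
          (auto simp: norm_mult)
      then show "AE \<omega> in lborel. integrable lborel (\<lambda>u. case (\<omega>, u) of (\<omega>, u) \<Rightarrow> ?f \<omega> u)" by simp
    qed measurable
    have "?L = (LINT \<omega>|lborel. LINT u|lborel. ?f \<omega> u)"
    proof (rule Bochner_Integration.integral_cong[OF refl])
      fix \<omega>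
      have "(LINT u|lborel. ?f \<omega> u) = (LINT u|lborel.
          (exp (\<i> * of_real (\<omega> * t)) * of_real (std_normal_density (\<omega> / n)))
          * (exp (- (\<i> * of_real (\<omega> * u))) * h u))"
        by (rule Bochner_Integration.integral_cong) (auto simp: algebra_simps simp flip: exp_add)
      also have "\<dots> = (exp (\<i> * of_real (\<omega> * t)) * of_real (std_normal_density (\<omega> / n))) * H \<omega>"
        unfolding H_def by (rule integral_mult_right_zero)
      finally show "exp (\<i> * of_real (\<omega> * t)) * H \<omega> * of_real (std_normal_density (\<omega> / n))
          = (LINT u|lborel. ?f \<omega> u)"
        by simp
    qed
    also have "\<dots> = (LINT u|lborel. LINT \<omega>|lborel. ?f \<omega> u)"
      using lborel_pair.Fubini_integral[OF int] by simp
    also have "\<dots> = (LINT u|lborel. of_real (n * exp (- (n * (t - u))\<^sup>2 / 2)) * h u)"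
    proof (rule Bochner_Integration.integral_cong[OF refl])
      fix u
      show "(LINT \<omega>|lborel. ?f \<omega> u) = of_real (n * exp (- (n * (t - u))\<^sup>2 / 2)) * h u"
        by (subst integral_mult_left_zero) (simp only: gaussian_fourier[OF n])
    qed
    also have "\<dots> = ?R"
      using n by (subst lborel_integral_real_affine[where c="-1/n" and t=t])
        (auto simp: scaleR_conv_of_real mult.commute intro!: Bochner_Integration.integral_cong simp
            flip: integral_mult_right_zero)
    finally show ?thesis .
  qed
  have A: "(\<lambda>n. LINT v|lborel. h (t - v / real (Suc n)) * of_real (exp (- v\<^sup>2 / 2)))
      \<longlonglongrightarrow> (LINT v|lborel. h t * of_real (exp (- v\<^sup>2 / 2)))"
  proof (rule integral_dominated_convergence[where w="\<lambda>v. M * exp (- v\<^sup>2 / 2)"])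
    show "integrable lborel (\<lambda>v. M * exp (- v\<^sup>2 / 2))"
      using gaussian_integral by (intro integrable_mult_right) (simp add: has_bochner_integral_iff)
    show "AE v in lborel. (\<lambda>n. h (t - v / real (Suc n)) * of_real (exp (- v\<^sup>2 / 2)))
        \<longlonglongrightarrow> h t * of_real (exp (- v\<^sup>2 / 2))"
    proof (rule AE_I2, intro tendsto_mult tendsto_const)
      fix v
      have "(\<lambda>n. t - v / real (Suc n)) \<longlonglongrightarrow> t - 0"
        by (intro tendsto_intros real_tendsto_divide_at_top[OF tendsto_const]
            filterlim_compose[OF filterlim_real_sequentially filterlim_Suc])
      moreover have "isCont h t" using cont by (simp add: continuous_on_eq_continuous_at)
      ultimately show "(\<lambda>n. h (t - v / real (Suc n))) \<longlonglongrightarrow> h t"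
        using isCont_tendsto_compose[of t h] by simp
    qed
    show "AE v in lborel. norm (h (t - v / real (Suc n)) * of_real (exp (- v\<^sup>2 / 2)))
        \<le> M * exp (- v\<^sup>2 / 2)" for n
      using M by (intro AE_I2) (simp add: norm_mult mult_right_mono)
  qed measurable
  have B: "(\<lambda>n. LINT \<omega>|lborel. exp (\<i> * of_real (\<omega> * t)) * H \<omega>
      * of_real (std_normal_density (\<omega> / real (Suc n)))) \<longlonglongrightarrow>
      (LINT \<omega>|lborel. exp (\<i> * of_real (\<omega> * t)) * H \<omega> * of_real (std_normal_density 0))"
  proof (rule integral_dominated_convergence[where w="\<lambda>\<omega>. norm (H \<omega>) * std_normal_density 0"])
    show "AE \<omega> in lborel. (\<lambda>n. exp (\<i> * of_real (\<omega> * t)) * H \<omega>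
        * of_real (std_normal_density (\<omega> / real (Suc n))))
        \<longlonglongrightarrow> exp (\<i> * of_real (\<omega> * t)) * H \<omega> * of_real (std_normal_density 0)"
    proof (rule AE_I2, intro tendsto_mult tendsto_const tendsto_of_real)
      fix \<omega> :: real
      have "(\<lambda>n. \<omega> / real (Suc n)) \<longlonglongrightarrow> 0"
        by (intro real_tendsto_divide_at_top[OF tendsto_const]
            filterlim_compose[OF filterlim_real_sequentially filterlim_Suc])
      moreover have "isCont std_normal_density 0" unfolding sd[abs_def]
        by (intro continuous_intros) auto
      ultimately show "(\<lambda>n. std_normal_density (\<omega> / real (Suc n))) \<longlonglongrightarrow> std_normal_density 0"
        by (metis isCont_tendsto_compose)
    qed
    show "AE \<omega> in lborel. norm (exp (\<i> * of_real (\<omega> * t)) * H \<omega>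
        * of_real (std_normal_density (\<omega> / real (Suc n))))
        \<le> norm (H \<omega>) * std_normal_density 0" for n
      using sd_le by (intro AE_I2) (simp add: norm_mult mult_left_mono)
    show "integrable lborel (\<lambda>\<omega>. norm (H \<omega>) * std_normal_density 0)" using H by simp
  qed measurable
  have "(LINT v|lborel. h t * of_real (exp (- v\<^sup>2 / 2)))
      = (LINT \<omega>|lborel. exp (\<i> * of_real (\<omega> * t)) * H \<omega> * of_real (std_normal_density 0))"
    using A B eq[of "real (Suc n)" for n] by (auto intro: LIMSEQ_unique)
  moreover have "(LINT v|lborel. h t * of_real (exp (- v\<^sup>2 / 2))) = h t * of_real (sqrt (2 * pi))"
  proof -
    have "(LINT v|lborel. complex_of_real (exp (- v\<^sup>2 / 2))) = of_real (sqrt (2 * pi))"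
      using gaussian_integral unfolding integral_complex_of_real
      by (simp add: has_bochner_integral_iff)
    then show ?thesis by (subst integral_mult_right_zero) simp
  qed
  moreover have "(LINT \<omega>|lborel. exp (\<i> * of_real (\<omega> * t)) * H \<omega> * of_real (std_normal_density 0))
      = (LINT \<omega>|lborel. exp (\<i> * of_real (\<omega> * t)) * H \<omega>) / of_real (sqrt (2 * pi))"
    by (simp add: sd)
  ultimately have "h t * of_real (sqrt (2 * pi))
      = (LINT \<omega>|lborel. exp (\<i> * of_real (\<omega> * t)) * H \<omega>) / of_real (sqrt (2 * pi))"
    by simp
  then have "h t * (of_real (sqrt (2 * pi)) * of_real (sqrt (2 * pi)))
      = (LINT \<omega>|lborel. exp (\<i> * of_real (\<omega> * t)) * H \<omega>)"
    by (simp add: field_simps)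
  also have "complex_of_real (sqrt (2 * pi)) * of_real (sqrt (2 * pi)) = of_real (2 * pi)"
    by (simp flip: of_real_mult)
  finally show ?thesis by (simp add: field_simps)
qed

text \<open>
Translating the frequency by \<open>\<delta> = \<pi> / t\<close> reverses the sign of the oscillating factor, so twice the
integral is at most the \<open>L\<^sup>1\<close> distance of \<open>F\<close> and its translate. As the translates have the same
    norm
and converge pointwise almost everywhere, Scheffe's lemma shows that this distance tends to 0.
\<close>

theorem riemann_lebesgue:
  fixes F :: "real \<Rightarrow> complex"
  assumes F: "integrable lborel F" and cont: "AE \<omega> in lborel. isCont F \<omega>"
  shows "((\<lambda>t. LINT \<omega>|lborel. exp (\<i> * of_real (\<omega> * t)) * F \<omega>) \<longlongrightarrow> 0) at_top"
proof (rule tendsto_at_topI_sequentially)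
  fix X :: "nat \<Rightarrow> real" assume X: "filterlim X at_top sequentially"
  have [measurable]: "F \<in> borel_measurable borel" using F by auto
  let ?I = "\<lambda>t. LINT \<omega>|lborel. exp (\<i> * of_real (\<omega> * t)) * F \<omega>"
  have iF: "integrable lborel (\<lambda>\<omega>. exp (\<i> * of_real (\<omega> * t)) * G \<omega>)"
    if "integrable lborel G" for G :: "real \<Rightarrow> complex" and t
  proof -
    have [measurable]: "G \<in> borel_measurable borel" using that by auto
    show ?thesis by (rule Bochner_Integration.integrable_bound[OF that]) (auto simp: norm_mult)
  qed
  define \<delta> where "\<delta> n = pi / X n" for n
  have shift: "integrable lborel (\<lambda>\<omega>. F (\<delta> n + \<omega>))" for n
    using lborel_integrable_real_affine[OF F, of 1 "\<delta> n"] by simp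
  have d0: "\<delta> \<longlonglongrightarrow> 0" unfolding \<delta>_def
    by (intro real_tendsto_divide_at_top[OF tendsto_const] X)
  have lim: "(\<lambda>n. \<integral>\<^sup>+ \<omega>. norm (F (\<delta> n + \<omega>) - F \<omega>) \<partial>lborel) \<longlonglongrightarrow> 0"
  proof (rule Scheffe_lemma2[OF _ F])
    show "AE \<omega> in lborel. (\<lambda>n. F (\<delta> n + \<omega>)) \<longlonglongrightarrow> F \<omega>"
      using cont
    proof eventually_elim
      case (elim \<omega>)
      have "(\<lambda>n. \<delta> n + \<omega>) \<longlonglongrightarrow> 0 + \<omega>" by (intro tendsto_intros d0)
      then show ?case using elim isCont_tendsto_compose[of \<omega> F] by simp
    qed
    show "(\<integral>\<^sup>+ \<omega>. norm (F (\<delta> n + \<omega>)) \<partial>lborel) \<le> (\<integral>\<^sup>+ \<omega>. norm (F \<omega>) \<partial>lborel)" for n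
      using nn_integral_real_affine[of "\<lambda>\<omega>. ennreal (norm (F \<omega>))" 1 "\<delta> n"] by simp
  qed measurable
  have bound: "ennreal (norm (2 * ?I (X n))) \<le> (\<integral>\<^sup>+ \<omega>. norm (F (\<delta> n + \<omega>) - F \<omega>) \<partial>lborel)"
      if "X n > 0" for n
  proof -
    have "?I (X n) = (LINT \<omega>|lborel. exp (\<i> * of_real ((\<delta> n + \<omega>) * X n)) * F (\<delta> n + \<omega>))"
      by (subst lborel_integral_real_affine[where c=1 and t="\<delta> n"]) auto
    also have "\<dots> = (LINT \<omega>|lborel. - (exp (\<i> * of_real (\<omega> * X n)) * F (\<delta> n + \<omega>)))"
    proof (rule Bochner_Integration.integral_cong[OF refl])
      fix \<omega>
      have "(\<delta> n + \<omega>) * X n = pi + \<omega> * X n" using that by (simp add: \<delta>_def field_simps)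
      then have "exp (\<i> * of_real ((\<delta> n + \<omega>) * X n))
          = exp (\<i> * of_real pi) * exp (\<i> * of_real (\<omega> * X n))"
        by (simp add: distrib_left exp_add)
      then show "exp (\<i> * of_real ((\<delta> n + \<omega>) * X n)) * F (\<delta> n + \<omega>)
          = - (exp (\<i> * of_real (\<omega> * X n)) * F (\<delta> n + \<omega>))"
        by (simp add: mult.commute[of \<i>])
    qed
    also have "\<dots> = - (LINT \<omega>|lborel. exp (\<i> * of_real (\<omega> * X n)) * F (\<delta> n + \<omega>))" by simp
    finally have "2 * ?I (X n) = ?I (X n)
        - (LINT \<omega>|lborel. exp (\<i> * of_real (\<omega> * X n)) * F (\<delta> n + \<omega>))" by simp
    also have "\<dots> = (LINT \<omega>|lborel. exp (\<i> * of_real (\<omega> * X n)) * F \<omega> - exp (\<i> * of_real (\<omega> * X n))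
        * F (\<delta> n + \<omega>))"
      by (rule Bochner_Integration.integral_diff[symmetric]) (intro iF F shift)+
    also have "\<dots> = (LINT \<omega>|lborel. exp (\<i> * of_real (\<omega> * X n)) * (F \<omega> - F (\<delta> n + \<omega>)))"
      by (simp add: right_diff_distrib)
    finally have eq: "2 * ?I (X n) = (LINT \<omega>|lborel. exp (\<i> * of_real (\<omega> * X n))
        * (F \<omega> - F (\<delta> n + \<omega>)))" .
    have "ennreal (norm (2 * ?I (X n))) \<le>
        (\<integral>\<^sup>+ \<omega>. norm (exp (\<i> * of_real (\<omega> * X n)) * (F \<omega> - F (\<delta> n + \<omega>))) \<partial>lborel)"
      unfolding eq by (intro integral_norm_bound_ennreal iF Bochner_Integration.integrable_diff F
          shift)
    then show ?thesis by (simp add: norm_mult norm_minus_commute)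
  qed
  have "(\<lambda>n. ennreal (norm (2 * ?I (X n)))) \<longlonglongrightarrow> 0"
  proof (rule tendsto_sandwich[OF _ _ tendsto_const lim])
    show "\<forall>\<^sub>F n in sequentially. ennreal (norm (2 * ?I (X n)))
        \<le> (\<integral>\<^sup>+ \<omega>. norm (F (\<delta> n + \<omega>) - F \<omega>) \<partial>lborel)"
      using filterlim_at_top_dense[THEN iffD1, OF X, rule_format, of 0]
      by eventually_elim (rule bound)
  qed simp
  then have "(\<lambda>n. norm (2 * ?I (X n))) \<longlonglongrightarrow> 0"
    by (simp add: ennreal_tendsto_0_iff)
  then have "(\<lambda>n. 2 * ?I (X n)) \<longlonglongrightarrow> 0" by (rule tendsto_norm_zero_cancel)
  then have "(\<lambda>n. (1/2) * (2 * ?I (X n))) \<longlonglongrightarrow> (1/2) * 0" by (rule tendsto_mult_left)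
  then show "(\<lambda>n. ?I (X n)) \<longlonglongrightarrow> 0" by simp
qed

section \<open>Inverse Laplace transforms along the imaginary axis\<close>

lemma integrable_even_extension:
  fixes G :: "real \<Rightarrow> real"
  assumes "set_integrable lborel {0<..} G"
  shows "integrable lborel (\<lambda>\<omega>. G \<bar>\<omega>\<bar>)"
proof -
  let ?P = "\<lambda>\<omega>. indicat_real {0<..} \<omega> *\<^sub>R G \<omega>"
  have P: "integrable lborel ?P" using assms by (simp add: set_integrable_def)
  have N: "integrable lborel (\<lambda>\<omega>. ?P (0 + (-1) * \<omega>))"
    using lborel_integrable_real_affine[OF P, of "-1" 0] by simp
  have "integrable lborel (\<lambda>\<omega>. ?P \<omega> + ?P (0 + (-1) * \<omega>) + G 0 * indicator {0} \<omega>)"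
    by (intro Bochner_Integration.integrable_add P N integrable_mult_right) auto
  also have "(\<lambda>\<omega>. ?P \<omega> + ?P (0 + (-1) * \<omega>) + G 0 * indicator {0} \<omega>) = (\<lambda>\<omega>. G \<bar>\<omega>\<bar>)"
    by (auto simp: fun_eq_iff indicator_def)
  finally show ?thesis .
qed

text \<open>
For \<open>0 < a \<le> 1\<close> this weight is comparable to \<open>r\<^sup>a\<^sup>-\<^sup>1\<close> near 0 and to \<open>r\<^sup>-\<^sup>1\<^sup>-\<^sup>a\<close> at infinity, it is
decreasing, and it is the derivative of \<open>arctan (r\<^sup>a) / a\<close>, which makes its integrability immediate.
\<close>

definition decay :: "real \<Rightarrow> real \<Rightarrow> real" where
  "decay a r = 1 / (r powr (1 - a) + r powr (1 + a))"

lemma integrable_decay: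
  assumes a: "a > 0"
  shows "integrable lborel (\<lambda>\<omega>. decay a \<bar>\<omega>\<bar>)"
proof (rule integrable_even_extension)
  have D: "((\<lambda>r. arctan (r powr a) / a) has_real_derivative decay a r) (at r)" if "r > 0" for r
  proof -
    have "((\<lambda>r. arctan (r powr a) / a) has_real_derivative
        (inverse (1 + (r powr a)\<^sup>2) * (a * r powr (a - 1))) / a) (at r)"
      using that by (auto intro!: derivative_eq_intros)
    also have "(inverse (1 + (r powr a)\<^sup>2) * (a * r powr (a - 1))) / a = decay a r"
    proof -
      have "r powr (1 - a) + r powr (1 + a) = (1 + (r powr a)\<^sup>2) / r powr (a - 1)"
        using that by (simp add: add_divide_distrib powr_power powr_minus[symmetric] divide_inverse
            distrib_right add.commute flip: powr_add powr_minus)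
      then show ?thesis using a by (simp add: decay_def divide_inverse)
    qed
    finally show ?thesis .
  qed
  have "set_integrable lborel (einterval 0 \<infinity>) (decay a)"
  proof (rule interval_integral_FTC_nonneg(1)[where F="\<lambda>r. arctan (r powr a)
      / a" and A=0 and B="(pi / 2) / a"])
    show "((\<lambda>r. arctan (r powr a) / a) has_real_derivative decay a r) (at r)" if "0 < ereal r" for r
      using D that by simp
    show "isCont (decay a) r" if "0 < ereal r" for r
    proof -
      have "r powr (1 - a) + r powr (1 + a) > 0" using that by (intro add_pos_pos) auto
      then show ?thesis unfolding decay_def using that by (intro continuous_intros) auto
    qed
    show "(((\<lambda>r. arctan (r powr a) / a) \<circ> real_of_ereal) \<longlongrightarrow> 0) (at_right 0)"
    proof -
      have "((\<lambda>r. arctan (r powr a) / a) \<longlongrightarrow> arctan (0 powr a) / a) (at_right 0)"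
        using a by (intro tendsto_intros tendsto_powr') (auto simp: eventually_at_filter)
      then show ?thesis using a by (simp add: ereal_tendsto_simps zero_ereal_def)
    qed
    show "(((\<lambda>r. arctan (r powr a) / a) \<circ> real_of_ereal) \<longlongrightarrow> (pi / 2) / a) (at_left \<infinity>)"
    proof -
      have "((\<lambda>r. arctan (r powr a) / a) \<longlongrightarrow> (pi / 2) / a) at_top"
        using a by (intro tendsto_divide tendsto_const filterlim_compose[OF tendsto_arctan_at_top]
            real_powr_at_top) auto
      then show ?thesis by (simp add: ereal_tendsto_simps)
    qed
  qed (auto simp: decay_def)
  then show "set_integrable lborel {0<..} (decay a)" by (simp add: zero_ereal_def)
qed

lemma tendsto_decay: "a > 0 \<Longrightarrow> (decay a \<longlongrightarrow> 0) at_top"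
proof -
  assume a: "a > 0"
  have "filterlim (\<lambda>r. r powr (1 + a)) at_top at_top" using a by (intro real_powr_at_top) auto
  then have "filterlim (\<lambda>r. r powr (1 - a) + r powr (1 + a)) at_top at_top"
    by (rule filterlim_at_top_mono) auto
  then have "((\<lambda>r. inverse (r powr (1 - a) + r powr (1 + a))) \<longlongrightarrow> 0) at_top"
    by (rule filterlim_compose[OF tendsto_inverse_0_at_top[OF filterlim_ident]])
  then show ?thesis by (simp add: decay_def[abs_def] divide_inverse)
qed

lemma decay_nonneg: "0 \<le> decay a r"
  by (simp add: decay_def)

lemma decay_antimono:
  assumes "0 < r" "r \<le> r'" "0 < a" "a \<le> 1"
  shows "decay a r' \<le> decay a r"
  unfolding decay_def using assms by (intro divide_left_mono add_mono powr_mono2 mult_pos_pos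
      add_pos_pos) auto

lemma powr_le_decay_near:
  assumes "0 < r" "r \<le> R" "0 < a"
  shows "r powr (a - 1) \<le> (1 + R powr (2 * a)) * decay a r"
proof -
  have eq: "r powr (1 - a) + r powr (1 + a) = r powr (1 - a) * (1 + r powr (2 * a))"
    using assms(1) by (simp add: distrib_left add.commute flip: powr_add)
  have "r powr (a - 1) = 1 / r powr (1 - a)" using assms(1)
    by (simp add: powr_minus_divide[symmetric])
  also have "\<dots> \<le> (1 + R powr (2 * a)) / (r powr (1 - a) * (1 + r powr (2 * a)))"
  proof -
    have "r powr (2 * a) \<le> R powr (2 * a)" using assms by (intro powr_mono2) auto
    moreover have "1 + r powr (2 * a) > 0" by (simp add: add_pos_nonneg)
    ultimately show ?thesis using assms(1) by (simp add: divide_simps)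
  qed
  finally show ?thesis unfolding decay_def eq by simp
qed

lemma powr_le_decay_far:
  assumes "1 \<le> r" "0 < a"
  shows "r powr (- 1 - a) \<le> 2 * decay a r"
proof -
  have "r powr (1 - a) \<le> r powr (1 + a)" using assms by (intro powr_mono) auto
  then have "r powr (1 - a) + r powr (1 + a) \<le> 2 * r powr (1 + a)" by simp
  moreover have "r powr (1 - a) + r powr (1 + a) > 0" using assms by (intro add_pos_pos) auto
  ultimately have "1 / (2 * r powr (1 + a)) \<le> 1 / (r powr (1 - a) + r powr (1 + a))"
    using assms by (intro divide_left_mono mult_pos_pos) auto
  moreover have "r powr (- 1 - a) = 1 / r powr (1 + a)" using powr_minus_divide[of r "1 + a"]
    by simp
  ultimately show ?thesis by (simp add: decay_def)
qed

text \<open>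
Cauchy's theorem for a rectangle whose height tends to infinity. Working with a primitive of \<open>\<Phi>\<close>
replaces the contour integrals: the vertical sides are differences of values of the primitive,
and the horizontal sides are estimated by the mean value inequality.
\<close>

lemma vertical_integral_shift:
  fixes \<Phi> :: "complex \<Rightarrow> complex" and G :: "real \<Rightarrow> real"
  assumes hol: "\<Phi> holomorphic_on {s. Re s > 0}" and "0 < \<eta>" "\<eta> \<le> c"
    and bd: "\<And>s. \<eta> \<le> Re s \<Longrightarrow> Re s \<le> c \<Longrightarrow> Im s \<noteq> 0 \<Longrightarrow> norm (\<Phi> s) \<le> G \<bar>Im s\<bar>"
    and G: "integrable lborel (\<lambda>\<omega>. G \<bar>\<omega>\<bar>)" "(G \<longlongrightarrow> 0) at_top"
  shows "(LINT \<omega>|lborel. \<Phi> (Complex c \<omega>)) = (LINT \<omega>|lborel. \<Phi> (Complex \<eta> \<omega>))"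
proof -
  have opn: "open {s. Re s > 0}" by (rule open_halfspace_Re_gt)
  have cvx: "convex {s. Re s > 0}" by (rule convex_halfspace_Re_gt)
  obtain P where P: "\<And>s. Re s > 0 \<Longrightarrow> (P has_field_derivative \<Phi> s) (at s)"
    using holomorphic_convex_primitive'[OF cvx opn hol] at_within_open[OF _ opn]
    by (metis mem_Collect_eq)
  have cont: "continuous_on UNIV (\<lambda>\<omega>. \<Phi> (Complex b \<omega>))" if "b > 0" for b
    using that by (intro continuous_on_compose2[OF holomorphic_on_imp_continuous_on[OF hol]])
      (auto simp: Complex_eq intro!: continuous_intros)
  have int: "integrable lborel (\<lambda>\<omega>. \<Phi> (Complex b \<omega>))" if b: "\<eta> \<le> b" "b \<le> c" for b
  proof (rule Bochner_Integration.integrable_bound[OF G(1)])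
    show "(\<lambda>\<omega>. \<Phi> (Complex b \<omega>)) \<in> borel_measurable lborel"
      using borel_measurable_continuous_onI[OF cont] b assms(2) by auto
    show "AE \<omega> in lborel. norm (\<Phi> (Complex b \<omega>)) \<le> norm (G \<bar>\<omega>\<bar>)"
      using AE_lborel_singleton[of 0]
      by eventually_elim (use bd[of "Complex b _"] b in \<open>force intro: order_trans\<close>)
  qed
  have seg: "(LINT \<omega>|lborel. indicator {- R..R} \<omega> *\<^sub>R \<Phi> (Complex b \<omega>))
      = (P (Complex b R) - P (Complex b (- R))) / \<i>"
    if b: "b > 0" and R: "R \<ge> 0" for b R
  proof -
    have "(LINT \<omega>|lborel. indicator {- R..R} \<omega> *\<^sub>R \<Phi> (Complex b \<omega>))
        = P (Complex b R) / \<i> - P (Complex b (- R)) / \<i>"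
    proof (rule integral_FTC_Icc)
      show "- R \<le> R" using R by simp
      show "continuous_on {- R..R} (\<lambda>\<omega>. \<Phi> (Complex b \<omega>))"
        by (rule continuous_on_subset[OF cont[OF b]]) auto
      fix \<omega>
      have "((\<lambda>\<omega>. Complex b \<omega>) has_vector_derivative \<i>) (at \<omega> within {- R..R})"
        unfolding Complex_eq by (auto intro!: derivative_eq_intros)
      then have "((P \<circ> (\<lambda>\<omega>. Complex b \<omega>)) has_vector_derivative \<i> * \<Phi> (Complex b \<omega>))
          (at \<omega> within {- R..R})"
        by (rule field_vector_diff_chain_within)
            (use P[of "Complex b \<omega>"] b in \<open>auto intro: has_field_derivative_at_within\<close>)
      then have "((\<lambda>\<omega>. P (Complex b \<omega>) * (1 / \<i>)) has_vector_derivative (\<i> * \<Phi> (Complex b \<omega>))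
          * (1 / \<i>)) (at \<omega> within {- R..R})"
        unfolding o_def by (rule has_vector_derivative_mult_left)
      then show "((\<lambda>\<omega>. P (Complex b \<omega>) / \<i>) has_vector_derivative \<Phi> (Complex b \<omega>))
          (at \<omega> within {- R..R})"
        by (simp add: mult_ac)
    qed
    then show ?thesis by (simp only: diff_divide_distrib)
  qed
  have lim: "(\<lambda>n. LINT \<omega>|lborel. indicator {- real n..real n} \<omega> *\<^sub>R \<Phi> (Complex b \<omega>))
      \<longlonglongrightarrow> (LINT \<omega>|lborel. \<Phi> (Complex b \<omega>))"
    if b: "\<eta> \<le> b" "b \<le> c" for b
  proof (rule integral_dominated_convergence[where w="\<lambda>\<omega>. norm (\<Phi> (Complex b \<omega>))"])
    have [measurable]: "(\<lambda>\<omega>. \<Phi> (Complex b \<omega>)) \<in> borel_measurable lborel" using int[OF b] by auto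
    show "(\<lambda>\<omega>. \<Phi> (Complex b \<omega>)) \<in> borel_measurable lborel" by fact
    show "(\<lambda>\<omega>. indicator {- real n..real n} \<omega> *\<^sub>R \<Phi> (Complex b \<omega>)) \<in> borel_measurable lborel" for n
      by measurable
    show "integrable lborel (\<lambda>\<omega>. norm (\<Phi> (Complex b \<omega>)))" using int[OF b] by simp
    show "AE \<omega> in lborel. (\<lambda>n. indicator {- real n..real n} \<omega> *\<^sub>R \<Phi> (Complex b \<omega>))
        \<longlonglongrightarrow> \<Phi> (Complex b \<omega>)"
    proof (rule AE_I2)
      fix \<omega> :: real
      have "eventually (\<lambda>n. indicator {- real n..real n} \<omega> *\<^sub>R \<Phi> (Complex b \<omega>) = \<Phi> (Complex b \<omega>))
          sequentially"
        using eventually_ge_at_top[of "nat \<lceil>\<bar>\<omega>\<bar>\<rceil>"]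
      proof eventually_elim
        case (elim n)
        then have "\<bar>\<omega>\<bar> \<le> real n" by linarith
        then show ?case by (auto simp: indicator_def)
      qed
      then show "(\<lambda>n. indicator {- real n..real n} \<omega> *\<^sub>R \<Phi> (Complex b \<omega>)) \<longlonglongrightarrow> \<Phi> (Complex b \<omega>)"
        by (rule tendsto_eventually)
    qed
  qed (auto simp: indicator_def)
  have hor: "norm (P (Complex c y) - P (Complex \<eta> y)) \<le> G \<bar>y\<bar> * (c - \<eta>)" if "y \<noteq> 0" for y
  proof -
    have "norm (P (Complex c y) - P (Complex \<eta> y)) \<le> G \<bar>y\<bar> * norm (Complex c y - Complex \<eta> y)"
    proof (rule field_differentiable_bound[where S="{s. \<eta> \<le> Re s \<and> Re s \<le> c \<and> Im s = y}" and f'=\<Phi>])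
      have "{s. \<eta> \<le> Re s \<and> Re s \<le> c \<and> Im s = y}
          = {s. Re s \<ge> \<eta>} \<inter> {s. Re s \<le> c} \<inter> {s. Im s \<ge> y} \<inter> {s. Im s \<le> y}" by auto
      then show "convex {s. \<eta> \<le> Re s \<and> Re s \<le> c \<and> Im s = y}"
        by (simp add: convex_Int convex_halfspace_Re_ge convex_halfspace_Re_le
            convex_halfspace_Im_ge convex_halfspace_Im_le)
      fix s assume s: "s \<in> {s. \<eta> \<le> Re s \<and> Re s \<le> c \<and> Im s = y}"
      then show "(P has_field_derivative \<Phi> s) (at s within {s. \<eta> \<le> Re s \<and> Re s \<le> c \<and> Im s = y})"
        using P[of s] assms(2) by (auto intro: has_field_derivative_at_within)
      show "norm (\<Phi> s) \<le> G \<bar>y\<bar>" using s bd[of s] that by auto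
    qed (use assms in auto)
    also have "norm (Complex c y - Complex \<eta> y) = c - \<eta>" using assms(3)
      by (simp add: complex_diff cmod_def)
    finally show ?thesis .
  qed
  have "(\<lambda>n. (LINT \<omega>|lborel. indicator {- real n..real n} \<omega> *\<^sub>R \<Phi> (Complex c \<omega>))
      - (LINT \<omega>|lborel. indicator {- real n..real n} \<omega> *\<^sub>R \<Phi> (Complex \<eta> \<omega>)))
     \<longlonglongrightarrow> (LINT \<omega>|lborel. \<Phi> (Complex c \<omega>)) - (LINT \<omega>|lborel. \<Phi> (Complex \<eta> \<omega>))"
    using assms by (intro tendsto_diff lim) auto
  moreover have "(\<lambda>n. (LINT \<omega>|lborel. indicator {- real n..real n} \<omega> *\<^sub>R \<Phi> (Complex c \<omega>))
      - (LINT \<omega>|lborel. indicator {- real n..real n} \<omega> *\<^sub>R \<Phi> (Complex \<eta> \<omega>)))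
     \<longlonglongrightarrow> 0"
  proof (rule Lim_null_comparison)
    show "\<forall>\<^sub>F n in sequentially. norm ((LINT \<omega>|lborel. indicator {- real n..real n} \<omega> *\<^sub>R \<Phi>
        (Complex c \<omega>)) - (LINT \<omega>|lborel. indicator {- real n..real n} \<omega> *\<^sub>R \<Phi> (Complex \<eta> \<omega>)))
        \<le> 2 * (G (real n) * (c - \<eta>))"
      using eventually_gt_at_top[of 0]
    proof eventually_elim
      case (elim n)
      have "(LINT \<omega>|lborel. indicator {- real n..real n} \<omega> *\<^sub>R \<Phi> (Complex c \<omega>))
          - (LINT \<omega>|lborel. indicator {- real n..real n} \<omega> *\<^sub>R \<Phi> (Complex \<eta> \<omega>))
         = ((P (Complex c (real n)) - P (Complex \<eta> (real n)))
             - (P (Complex c (- real n)) - P (Complex \<eta> (- real n)))) / \<i>"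
        using assms(2,3) by (simp only: seg of_nat_0_le_iff order.strict_trans2 diff_divide_distrib)
            (simp add: algebra_simps)
      also have "norm \<dots> \<le> norm (P (Complex c (real n)) - P (Complex \<eta> (real n)))
          + norm (P (Complex c (- real n)) - P (Complex \<eta> (- real n)))"
        unfolding norm_divide by (simp add: norm_triangle_ineq4)
      also have "\<dots> \<le> G \<bar>real n\<bar> * (c - \<eta>) + G \<bar>- real n\<bar> * (c - \<eta>)"
        using elim by (intro add_mono hor) auto
      finally show ?case by simp
    qed
    have "(\<lambda>n. 2 * (G (real n) * (c - \<eta>))) \<longlonglongrightarrow> 2 * (0 * (c - \<eta>))"
      by (intro tendsto_intros filterlim_compose[OF G(2)] filterlim_real_sequentially)
    then show "(\<lambda>n. 2 * (G (real n) * (c - \<eta>))) \<longlonglongrightarrow> 0" by simp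
  qed
  ultimately show ?thesis using LIMSEQ_unique by fastforce
qed

text \<open>
The line of integration is moved from \<open>Re s = c\<close> to the imaginary axis. There the factor
\<open>exp (s t)\<close> is purely oscillating and the Riemann-Lebesgue lemma applies. The origin may be a
singularity of \<open>F\<close>, so the axis itself is only reached as a limit of lines \<open>Re s = \<eta>\<close>.
\<close>

theorem inverse_laplace_tendsto_zero:
  fixes F :: "complex \<Rightarrow> complex" and f :: "real \<Rightarrow> complex"
  assumes hol: "F holomorphic_on {s. Re s > 0}" and cont: "continuous_on ({s. Re s \<ge> 0} - {0}) F"
    and bd: "\<And>s. 0 \<le> Re s \<Longrightarrow> Im s \<noteq> 0 \<Longrightarrow> norm (F s) \<le> G \<bar>Im s\<bar>"
    and G: "integrable lborel (\<lambda>\<omega>. G \<bar>\<omega>\<bar>)" "(G \<longlongrightarrow> 0) at_top"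
    and c: "c > 0" and f: "\<And>t. t \<ge> 0 \<Longrightarrow> f t
        = (LINT \<omega>|lborel. exp (Complex c \<omega> * of_real t) * F (Complex c \<omega>)) / K"
  shows "(f \<longlongrightarrow> 0) at_top"
proof -
  have contF: "isCont (\<lambda>\<omega>. F (Complex 0 \<omega>)) \<omega>" if "\<omega> \<noteq> 0" for \<omega>
  proof -
    have "continuous_on (- {0}) (\<lambda>\<omega>. F (Complex 0 \<omega>))"
      by (rule continuous_on_compose2[OF cont])
          (auto simp: Complex_eq complex_eq_iff intro!: continuous_intros)
    moreover have "open (- {0::real})" by auto
    ultimately show ?thesis using that by (simp add: continuous_on_eq_continuous_at)
  qed
  have meas: "(\<lambda>\<omega>. F (Complex b \<omega>)) \<in> borel_measurable lborel" if "b \<ge> 0" for b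
  proof -
    have "continuous_on (- {0}) (\<lambda>\<omega>. F (Complex b \<omega>))"
      using that by (intro continuous_on_compose2[OF cont])
          (auto simp: Complex_eq complex_eq_iff intro!: continuous_intros)
    then have "(\<lambda>\<omega>. if \<omega> \<in> - {0} then F (Complex b \<omega>) else (\<lambda>_. F (Complex b 0)) \<omega>) \<in>
        borel_measurable borel"
      by (intro borel_measurable_continuous_on_if) auto
    also have "(\<lambda>\<omega>. if \<omega> \<in> - {0} then F (Complex b \<omega>) else (\<lambda>_. F (Complex b 0)) \<omega>)
        = (\<lambda>\<omega>. F (Complex b \<omega>))"
      by auto
    finally show ?thesis by simp
  qed
  have intF: "integrable lborel (\<lambda>\<omega>. F (Complex 0 \<omega>))"
  proof (rule Bochner_Integration.integrable_bound[OF G(1) meas])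
    show "AE \<omega> in lborel. norm (F (Complex 0 \<omega>)) \<le> norm (G \<bar>\<omega>\<bar>)"
      using AE_lborel_singleton[of 0]
      by eventually_elim (use bd[of "Complex 0 _"] in \<open>force intro: order_trans\<close>)
  qed auto
  have eq: "(LINT \<omega>|lborel. exp (Complex c \<omega> * of_real t) * F (Complex c \<omega>))
      = (LINT \<omega>|lborel. exp (\<i> * of_real (\<omega> * t)) * F (Complex 0 \<omega>))"
    if t: "t \<ge> 0" for t
  proof -
    define \<Phi> where "\<Phi> s = exp (s * of_real t) * F s" for s
    have \<Phi>bd: "norm (\<Phi> s) \<le> exp (C * t) * G \<bar>Im s\<bar>" if "0 \<le> Re s" "Re s \<le> C" "Im s \<noteq> 0" for s C
    proof -
      have "norm (\<Phi> s) = exp (Re s * t) * norm (F s)" by (simp add: \<Phi>_def norm_mult)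
      also have "\<dots> \<le> exp (C * t) * G \<bar>Im s\<bar>" using that bd[of s] t
        by (intro mult_mono) (auto intro: mult_right_mono)
      finally show ?thesis .
    qed
    have shift: "(LINT \<omega>|lborel. \<Phi> (Complex c \<omega>)) = (LINT \<omega>|lborel. \<Phi> (Complex \<eta> \<omega>))"
        if "0 < \<eta>" "\<eta> \<le> c" for \<eta>
    proof (rule vertical_integral_shift[where G="\<lambda>y. exp (c * t) * G y"])
      show "\<Phi> holomorphic_on {s. Re s > 0}" unfolding \<Phi>_def by (intro holomorphic_intros hol)
      show "integrable lborel (\<lambda>\<omega>. exp (c * t) * G \<bar>\<omega>\<bar>)" using G(1) by simp
      show "((\<lambda>y. exp (c * t) * G y) \<longlongrightarrow> 0) at_top" using tendsto_mult_left[OF G(2)] by simp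
    qed (use that \<Phi>bd in auto)
    define \<eta> where "\<eta> n = c / real (Suc n)" for n
    have \<eta>: "0 < \<eta> n" "\<eta> n \<le> c" for n using c by (auto simp: \<eta>_def field_simps)
    have \<eta>0: "\<eta> \<longlonglongrightarrow> 0" unfolding \<eta>_def[abs_def]
      by (intro real_tendsto_divide_at_top[OF tendsto_const]
          filterlim_compose[OF filterlim_real_sequentially filterlim_Suc])
    have "(\<lambda>n. LINT \<omega>|lborel. \<Phi> (Complex (\<eta> n) \<omega>)) \<longlonglongrightarrow> (LINT \<omega>|lborel. \<Phi> (Complex 0 \<omega>))"
    proof (rule integral_dominated_convergence[where w="\<lambda>\<omega>. exp (c * t) * G \<bar>\<omega>\<bar>"])
      have m: "(\<lambda>\<omega>. \<Phi> (Complex b \<omega>)) \<in> borel_measurable lborel" if "b \<ge> 0" for b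
      proof -
        have "(\<lambda>\<omega>. exp (Complex b \<omega> * of_real t)) \<in> borel_measurable lborel"
          unfolding Complex_eq by measurable
        then show ?thesis unfolding \<Phi>_def by (intro borel_measurable_times meas that)
      qed
      show "(\<lambda>\<omega>. \<Phi> (Complex 0 \<omega>)) \<in> borel_measurable lborel" by (rule m) simp
      show "(\<lambda>\<omega>. \<Phi> (Complex (\<eta> n) \<omega>)) \<in> borel_measurable lborel" for n
        by (rule m) (use \<eta>[of n] in simp)
      show "integrable lborel (\<lambda>\<omega>. exp (c * t) * G \<bar>\<omega>\<bar>)" using G(1) by simp
      show "AE \<omega> in lborel. norm (\<Phi> (Complex (\<eta> n) \<omega>)) \<le> exp (c * t) * G \<bar>\<omega>\<bar>" for n
        using AE_lborel_singleton[of 0]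
        by eventually_elim (use \<Phi>bd[of "Complex (\<eta> n) _" c] \<eta>[of n] in \<open>force\<close>)
      show "AE \<omega> in lborel. (\<lambda>n. \<Phi> (Complex (\<eta> n) \<omega>)) \<longlonglongrightarrow> \<Phi> (Complex 0 \<omega>)"
        using AE_lborel_singleton[of 0]
      proof eventually_elim
        fix \<omega> :: real assume \<omega>: "\<omega> \<noteq> 0"
        have lim: "(\<lambda>n. Complex (\<eta> n) \<omega>) \<longlonglongrightarrow> Complex 0 \<omega>"
          by (intro tendsto_Complex \<eta>0 tendsto_const)
        have "continuous_on ({s. Re s \<ge> 0} - {0}) \<Phi>"
          unfolding \<Phi>_def by (intro continuous_intros cont)
        then show "(\<lambda>n. \<Phi> (Complex (\<eta> n) \<omega>)) \<longlonglongrightarrow> \<Phi> (Complex 0 \<omega>)"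
          using \<omega> less_imp_le[OF \<eta>(1)]
          by (intro continuous_on_tendsto_compose[OF _ lim]) (auto simp: complex_eq_iff)
      qed
    qed
    moreover have "(\<lambda>n. LINT \<omega>|lborel. \<Phi> (Complex (\<eta> n) \<omega>)) = (\<lambda>n. LINT \<omega>|lborel. \<Phi> (Complex c \<omega>))"
      using shift[OF \<eta>] by simp
    ultimately have "(LINT \<omega>|lborel. \<Phi> (Complex c \<omega>)) = (LINT \<omega>|lborel. \<Phi> (Complex 0 \<omega>))"
      by (simp add: LIMSEQ_const_iff)
    moreover have "Complex 0 \<omega> * of_real t = \<i> * of_real (\<omega> * t)" for \<omega> by (simp add: Complex_eq)
    ultimately show ?thesis by (simp add: \<Phi>_def)
  qed
  have "AE \<omega> in lborel. isCont (\<lambda>\<omega>. F (Complex 0 \<omega>)) \<omega>"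
    using AE_lborel_singleton[of 0] by eventually_elim (rule contF)
  then have "((\<lambda>t. (LINT \<omega>|lborel. exp (\<i> * of_real (\<omega> * t)) * F (Complex 0 \<omega>)) / K) \<longlongrightarrow> 0) at_top"
    unfolding divide_inverse by (intro tendsto_mult_left_zero riemann_lebesgue intF)
  moreover have "eventually (\<lambda>t. (LINT \<omega>|lborel. exp (\<i> * of_real (\<omega> * t)) * F (Complex 0 \<omega>)) / K
      = f t) at_top"
    using eventually_ge_at_top[of 0] by eventually_elim (simp add: f eq)
  ultimately show ?thesis using tendsto_cong by force
qed

section \<open>The resolvent of the characteristic matrix\<close>

lemma holomorphic_on_det:
  fixes M :: "complex \<Rightarrow> complex ^ 'n ^ 'n"
  assumes "\<And>i j. (\<lambda>s. M s $ i $ j) holomorphic_on S"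
  shows "(\<lambda>s. det (M s)) holomorphic_on S"
  unfolding det_def by (intro holomorphic_intros assms)

lemma continuous_on_det:
  fixes M :: "complex \<Rightarrow> complex ^ 'n ^ 'n"
  assumes "\<And>i j. continuous_on S (\<lambda>s. M s $ i $ j)"
  shows "continuous_on S (\<lambda>s. det (M s))"
  unfolding det_def by (intro continuous_intros assms)

text \<open>
Cramer's formula for the inverse, used because it shows that the entries inherit continuity and
holomorphy from those of \<open>M\<close>.
\<close>

definition cramer_inverse :: "'a::field ^ 'n ^ 'n \<Rightarrow> 'a ^ 'n ^ 'n" where
  "cramer_inverse M = (\<chi> k j. det (\<chi> i l. if l = k then axis j 1 $ i else M $ i $ l) / det M)"

lemma cramer_inverse_right:
  fixes M :: "'a::field ^ 'n ^ 'n"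
  assumes "det M \<noteq> 0"
  shows "M ** cramer_inverse M = mat 1"
proof -
  have "(M ** cramer_inverse M) $ i $ j = mat 1 $ i $ j" for i j
  proof -
    have "M *v (\<chi> k. cramer_inverse M $ k $ j) = axis j 1"
      unfolding cramer[OF assms] by (simp add: cramer_inverse_def)
    moreover have "(M ** cramer_inverse M) $ i $ j = (M *v (\<chi> k. cramer_inverse M $ k $ j)) $ i"
      by (simp add: matrix_matrix_mult_def matrix_vector_mult_def)
    ultimately show ?thesis by (simp add: mat_def axis_def)
  qed
  then show ?thesis by (simp add: vec_eq_iff)
qed

lemma cramer_inverse_left:
  fixes M :: "'a::field ^ 'n ^ 'n"
  assumes "det M \<noteq> 0"
  shows "cramer_inverse M ** M = mat 1"
  using cramer_inverse_right[OF assms] by (simp add: matrix_left_right_inverse)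

lemma holomorphic_on_cramer_inverse:
  fixes M :: "complex \<Rightarrow> complex ^ 'n ^ 'n"
  assumes nz: "\<And>s. s \<in> S \<Longrightarrow> det (M s) \<noteq> 0"
    and h: "\<And>i j. (\<lambda>s. M s $ i $ j) holomorphic_on S"
  shows "(\<lambda>s. cramer_inverse (M s) $ k $ j) holomorphic_on S"
proof -
  have num: "(\<lambda>s. det (\<chi> i l. if l = k then axis j 1 $ i else M s $ i $ l)) holomorphic_on S"
  proof (rule holomorphic_on_det)
    fix i l show "(\<lambda>s. (\<chi> i l. if l = k then axis j 1 $ i else M s $ i $ l) $ i $ l) holomorphic_on
        S"
      using h by (cases "l = k") simp_all
  qed
  show ?thesis
    unfolding cramer_inverse_def vec_lambda_beta
    by (rule holomorphic_on_divide[OF num holomorphic_on_det[OF h] nz])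
qed

lemma continuous_on_cramer_inverse:
  fixes M :: "complex \<Rightarrow> complex ^ 'n ^ 'n"
  assumes nz: "\<And>s. s \<in> S \<Longrightarrow> det (M s) \<noteq> 0"
    and h: "\<And>i j. continuous_on S (\<lambda>s. M s $ i $ j)"
  shows "continuous_on S (\<lambda>s. cramer_inverse (M s) $ k $ j)"
proof -
  have num: "continuous_on S (\<lambda>s. det (\<chi> i l. if l = k then axis j 1 $ i else M s $ i $ l))"
  proof (rule continuous_on_det)
    fix i l show "continuous_on S (\<lambda>s. (\<chi> i l. if l = k then axis j 1 $ i else M s $ i $ l) $ i $
        l)"
      using h by (cases "l = k") simp_all
  qed
  show ?thesis
    unfolding cramer_inverse_def vec_lambda_beta
    by (rule continuous_on_divide[OF num continuous_on_det[OF h]]) (simp add: nz)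
qed

text \<open>
The only candidate for the Laplace transform of the solution with initial value \<open>x0\<close>; unlike the
transform it makes sense wherever the characteristic matrix is invertible.
\<close>

definition resolvent_solution :: "real ^ 'n \<Rightarrow> real ^ 'n ^ 'n \<Rightarrow> real ^ 'n::finite \<Rightarrow> complex \<Rightarrow> complex
    ^ 'n" where
  "resolvent_solution \<alpha> A x0 s =
     cramer_inverse (char_matrix \<alpha> A s) *v (\<chi> k. s powr of_real (\<alpha> $ k - 1) * of_real (x0 $ k))"

lemma char_matrix_nth: "char_matrix \<alpha> A s $ i $ j
    = (if i = j then s powr of_real (\<alpha> $ i) else 0) - of_real (A $ i $ j)"
  by (simp add: char_matrix_def diag_matrix_def map_matrix_def)

lemma nonpos_Reals_Re_pos: "Re s > 0 \<Longrightarrow> s \<notin> \<real>\<^sub>\<le>\<^sub>0"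
  by (auto simp: complex_nonpos_Reals_iff)

lemma char_matrix_holomorphic: "(\<lambda>s. char_matrix \<alpha> A s $ i $ j) holomorphic_on {s. Re s > 0}"
  unfolding char_matrix_nth
  by (cases "i = j") (auto intro!: holomorphic_intros simp: nonpos_Reals_Re_pos)

lemma char_matrix_continuous:
  assumes "\<And>k. 0 < \<alpha> $ k"
  shows "continuous_on {s. Re s \<ge> 0} (\<lambda>s. char_matrix \<alpha> A s $ i $ j)"
  unfolding char_matrix_nth
  by (cases "i = j") (auto intro!: continuous_intros assms)

lemma resolvent_solution_nth:
  "resolvent_solution \<alpha> A x0 s $ k = (\<Sum>j\<in>UNIV. cramer_inverse (char_matrix \<alpha> A s) $ k $ j
      * (s powr of_real (\<alpha> $ j - 1) * of_real (x0 $ j)))"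
  by (simp add: resolvent_solution_def matrix_vector_mult_def)

lemma resolvent_solution_holomorphic:
  fixes \<alpha> :: "real ^ 'n::finite"
  assumes nz: "\<And>s. Re s \<ge> 0 \<Longrightarrow> det (char_matrix \<alpha> A s) \<noteq> 0"
  shows "(\<lambda>s. resolvent_solution \<alpha> A x0 s $ k) holomorphic_on {s. Re s > 0}"
  unfolding resolvent_solution_nth
  by (intro holomorphic_intros holomorphic_on_cramer_inverse char_matrix_holomorphic nz)
      (auto simp: nonpos_Reals_Re_pos)

lemma resolvent_solution_continuous:
  fixes \<alpha> :: "real ^ 'n::finite"
  assumes nz: "\<And>s. Re s \<ge> 0 \<Longrightarrow> det (char_matrix \<alpha> A s) \<noteq> 0" and \<alpha>: "\<And>k. 0 < \<alpha> $ k"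
  shows "continuous_on ({s. Re s \<ge> 0} - {0}) (\<lambda>s. resolvent_solution \<alpha> A x0 s $ k)"
  unfolding resolvent_solution_nth
  by (intro continuous_intros continuous_on_cramer_inverse nz
      continuous_on_subset[OF char_matrix_continuous[OF \<alpha>]]) auto

lemma resolvent_solution_unique:
  assumes "det (char_matrix \<alpha> A s) \<noteq> 0"
    and "char_matrix \<alpha> A s *v v = (\<chi> k. s powr of_real (\<alpha> $ k - 1) * of_real (x0 $ k))"
  shows "v = resolvent_solution \<alpha> A x0 s"
  unfolding resolvent_solution_def assms(2)[symmetric]
  by (simp add: matrix_vector_mul_assoc cramer_inverse_left[OF assms(1)])

text \<open>
The transformed Volterra equation. For large \<open>s\<close> its second summand is a small perturbation.
\<close>

lemma resolvent_solution_eq: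
  fixes \<alpha> :: "real ^ 'n::finite"
  assumes "det (char_matrix \<alpha> A s) \<noteq> 0" and s: "s \<noteq> 0"
  shows "resolvent_solution \<alpha> A x0 s $ k = of_real (x0 $ k) / s +
     s powr (- of_real (\<alpha> $ k)) * (\<Sum>j\<in>UNIV. of_real (A $ k $ j) * resolvent_solution \<alpha> A x0 s $ j)"
proof -
  have "char_matrix \<alpha> A s *v resolvent_solution \<alpha> A x0 s
      = (\<chi> k. s powr of_real (\<alpha> $ k - 1) * of_real (x0 $ k))"
    unfolding resolvent_solution_def by (simp add: matrix_vector_mul_assoc
        cramer_inverse_right[OF assms(1)])
  then have "s powr of_real (\<alpha> $ k) * resolvent_solution \<alpha> A x0 s $ k
      - (\<Sum>j\<in>UNIV. of_real (A $ k $ j) * resolvent_solution \<alpha> A x0 s $ j)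
      = s powr of_real (\<alpha> $ k - 1) * of_real (x0 $ k)"
    unfolding char_matrix_mult[symmetric] by simp
  then show ?thesis using s by (simp add: powr_minus powr_diff field_simps)
qed

lemma norm_add_one_ge:
  assumes "Re s \<ge> 0"
  shows "1 \<le> norm (s + 1)" "norm s \<le> norm (s + 1)"
proof -
  show "1 \<le> norm (s + 1)" using complex_Re_le_cmod[of "s + 1"] assms by simp
  have "(norm s)\<^sup>2 \<le> (norm (s + 1))\<^sup>2"
    unfolding cmod_power2 using assms by (simp add: power2_eq_square algebra_simps)
  then show "norm s \<le> norm (s + 1)" by (rule power2_le_imp_le) simp
qed

text \<open>
For \<open>\<bar>s\<bar> \<le> R\<close> the inverse matrix is bounded by compactness, and the right-hand side
\<open>s\<^sup>\<alpha>\<^sup>k\<^sup>-\<^sup>1 x\<^sub>k(0)\<close> contributes \<open>\<bar>s\<bar>\<^sup>a\<^sup>-\<^sup>1\<close>. For \<open>\<bar>s\<bar> \<ge> R\<close> the fixed point form of the equation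
    yields
\<open>X = x(0) / s + O(\<bar>s\<bar>\<^sup>-\<^sup>1\<^sup>-\<^sup>a)\<close>, and replacing \<open>1 / s\<close>
  by \<open>1 / (s + 1)\<close>, which is harmless at 0, costs
only \<open>O(\<bar>s\<bar>\<^sup>-\<^sup>2)\<close>.
\<close>

lemma resolvent_solution_bound:
  fixes \<alpha> x0 :: "real ^ 'n::finite"
  assumes nz: "\<And>s. Re s \<ge> 0 \<Longrightarrow> det (char_matrix \<alpha> A s) \<noteq> 0"
    and \<alpha>: "\<And>k. a \<le> \<alpha> $ k \<and> \<alpha> $ k \<le> 1" and a: "0 < a"
  obtains C where "C \<ge> 0"
    "\<And>s k. Re s \<ge> 0 \<Longrightarrow> s \<noteq> 0 \<Longrightarrow> norm (resolvent_solution \<alpha> A x0 s $ k - of_real (x0 $ k) / (s + 1))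
        \<le> C * decay a (norm s)"
proof -
  let ?X = "resolvent_solution \<alpha> A x0"
  have \<alpha>0: "0 < \<alpha> $ k" for k using \<alpha>[of k] a by simp
  have a1: "a \<le> 1" using \<alpha> by (meson order_trans)
  obtain L where L: "L > 0" "(\<Sum>k\<in>UNIV. row_sum A k * L powr (- (\<alpha> $ k))) \<le> 1 / 2"
    using contraction_weight_exists[OF \<alpha>0] by blast
  define R where "R = max 1 L"
  have R: "R \<ge> 1" "R \<ge> L" by (auto simp: R_def)
  define S where "S = (\<Sum>k\<in>UNIV. \<bar>x0 $ k\<bar>)"
  have x0S: "\<bar>x0 $ k\<bar> \<le> S" for k unfolding S_def by (rule member_le_sum) auto
  have S0: "S \<ge> 0" unfolding S_def by (simp add: sum_nonneg)
  define Q where "Q = (\<Sum>k\<in>UNIV. row_sum A k)"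
  have Q: "row_sum A k \<le> Q" "Q \<ge> 0" for k unfolding Q_def
    by (auto intro!: member_le_sum sum_nonneg row_sum_nonneg)

  define K where "K = {s. Re s \<ge> 0} \<inter> cball 0 R"
  have "compact K" unfolding K_def by (intro closed_Int_compact closed_halfspace_Re_ge
      compact_cball)
  have "\<exists>B\<ge>0. \<forall>s\<in>K. norm (cramer_inverse (char_matrix \<alpha> A s) $ k $ j) \<le> B" for k j
  proof -
    have "continuous_on K (\<lambda>s. cramer_inverse (char_matrix \<alpha> A s) $ k $ j)"
      by (intro continuous_on_cramer_inverse nz
          continuous_on_subset[OF char_matrix_continuous[OF \<alpha>0]]) (auto simp: K_def)
    then have "bounded ((\<lambda>s. cramer_inverse (char_matrix \<alpha> A s) $ k $ j) ` K)"
      using \<open>compact K\<close> by (intro compact_imp_bounded compact_continuous_image)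
    then show ?thesis by (auto simp: bounded_pos intro: less_imp_le)
  qed
  then obtain B where B: "\<And>k j. B k j \<ge> 0" "\<And>k j s. s \<in> K
      \<Longrightarrow> norm (cramer_inverse (char_matrix \<alpha> A s) $ k $ j) \<le> B k j"
    by metis
  define B' where "B' = (\<Sum>k\<in>UNIV. \<Sum>j\<in>UNIV. B k j)"
  have BB': "B k j \<le> B'" for k j
  proof -
    have "B k j \<le> (\<Sum>j\<in>UNIV. B k j)" by (rule member_le_sum) (use B in auto)
    also have "\<dots> \<le> B'" unfolding B'_def by (rule member_le_sum[of k UNIV "\<lambda>k. \<Sum>j\<in>UNIV. B k j"])
        (use B in \<open>auto intro: sum_nonneg\<close>)
    finally show ?thesis .
  qed
  have B'0: "B' \<ge> 0" using B(1) BB' order_trans by blast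

  define C1 where "C1 = (B' * S * R + S * R) * (1 + R powr (2 * a))"
  define C2 where "C2 = (2 * S * Q + S) * 2"
  have near: "norm (?X s $ k - of_real (x0 $ k) / (s + 1)) \<le> C1 * decay a (norm s)"
    if s: "Re s \<ge> 0" "s \<noteq> 0" "norm s \<le> R" for s k
  proof -
    have sK: "s \<in> K" using s by (simp add: K_def)
    \<comment> \<open>Since R is at least 1, the power R^(b - a) with exponent below 1 is at most R.\<close>
    have pw: "norm s powr (b - 1) \<le> norm s powr (a - 1) * R" if b: "a \<le> b" "b \<le> 1" for b
    proof -
      have "norm s powr (b - 1) = norm s powr (a - 1) * norm s powr (b - a)"
        using s by (simp flip: powr_add)
      also have "norm s powr (b - a) \<le> R powr (b - a)" using s b by (intro powr_mono2) auto
      also have "\<dots> \<le> R powr 1" using R a b by (intro powr_mono) auto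
      finally show ?thesis using R by (simp add: mult_left_mono)
    qed
    have "norm (?X s $ k) \<le> (\<Sum>j\<in>UNIV. norm
        (cramer_inverse (char_matrix \<alpha> A s) $ k $ j
        * (s powr of_real (\<alpha> $ j - 1) * of_real (x0 $ j))))"
      unfolding resolvent_solution_nth by (rule norm_sum)
    also have "\<dots> \<le> (\<Sum>j\<in>UNIV. B' * ((norm s powr (a - 1) * R) * \<bar>x0 $ j\<bar>))"
    proof (rule sum_mono)
      fix j
      have "norm (s powr of_real (\<alpha> $ j - 1)) \<le> norm s powr (a - 1) * R"
        using pw[of "\<alpha> $ j"] \<alpha>[of j] by (simp add: norm_powr_real_powr' del: of_real_diff)
      then show "norm (cramer_inverse (char_matrix \<alpha> A s) $ k $ j
          * (s powr of_real (\<alpha> $ j - 1) * of_real (x0 $ j)))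
          \<le> B' * ((norm s powr (a - 1) * R) * \<bar>x0 $ j\<bar>)"
        unfolding norm_mult norm_of_real using order_trans[OF B(2)[OF sK] BB'] B'0 R(1)
        by (intro mult_mono mult_nonneg_nonneg) auto
    qed
    also have "\<dots> = (B' * S * R) * norm s powr (a - 1)"
      by (simp add: S_def sum_distrib_left sum_distrib_right mult_ac)
    finally have 1: "norm (?X s $ k) \<le> (B' * S * R) * norm s powr (a - 1)" .
    have "norm (of_real (x0 $ k) / (s + 1)) \<le> \<bar>x0 $ k\<bar> / 1"
      unfolding norm_divide norm_of_real using norm_add_one_ge(1)[OF s(1)]
      by (intro divide_left_mono mult_pos_pos) auto
    also have "\<dots> \<le> S * 1" using x0S[of k] by simp
    also have "\<dots> \<le> S * (norm s powr (a - 1) * R)"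
      using pw[of 1] a1 S0 s by (intro mult_left_mono) auto
    finally have 2: "norm (of_real (x0 $ k) / (s + 1)) \<le> (S * R) * norm s powr (a - 1)"
      by (simp add: mult_ac)
    have "norm (?X s $ k - of_real (x0 $ k) / (s + 1)) \<le> (B' * S * R + S * R) * norm s powr (a - 1)"
      using norm_triangle_ineq4[of "?X s $ k" "of_real (x0 $ k) / (s + 1)"] 1 2
      by (simp add: distrib_right)
    also have "\<dots> \<le> (B' * S * R + S * R) * ((1 + R powr (2 * a)) * decay a (norm s))"
      using B'0 S0 R s a by (intro mult_left_mono powr_le_decay_near) auto
    finally show ?thesis by (simp add: C1_def mult.assoc)
  qed

  have far: "norm (?X s $ k - of_real (x0 $ k) / (s + 1)) \<le> C2 * decay a (norm s)"
    if s: "Re s \<ge> 0" "R \<le> norm s" for s k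
  proof -
    have s0: "s \<noteq> 0" "norm s \<ge> 1" using s(2) R(1) by auto
    define m where "m = (\<Sum>k\<in>UNIV. norm (?X s $ k))"
    have m0: "m \<ge> 0" by (simp add: m_def sum_nonneg)
    have AX: "norm (\<Sum>j\<in>UNIV. of_real (A $ k $ j) * ?X s $ j) \<le> row_sum A k * m" for k
    proof -
      have "norm (\<Sum>j\<in>UNIV. of_real (A $ k $ j) * ?X s $ j) \<le> (\<Sum>j\<in>UNIV. \<bar>A $ k $ j\<bar> * m)"
      proof (rule order_trans[OF norm_sum sum_mono])
        fix j
        have "norm (?X s $ j) \<le> m" unfolding m_def by (rule member_le_sum) auto
        then show "norm (of_real (A $ k $ j) * ?X s $ j) \<le> \<bar>A $ k $ j\<bar> * m"
          by (simp add: norm_mult mult_left_mono)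
      qed
      then show ?thesis by (simp add: row_sum_def sum_distrib_right)
    qed
    have diff: "norm (?X s $ k - of_real (x0 $ k) / s)
        \<le> norm s powr (- (\<alpha> $ k)) * (row_sum A k * m)" for k
    proof -
      have "?X s $ k - of_real (x0 $ k) / s
          = s powr (- of_real (\<alpha> $ k)) * (\<Sum>j\<in>UNIV. of_real (A $ k $ j) * ?X s $ j)"
        using resolvent_solution_eq[OF nz[OF s(1)] s0(1), of x0 k] by simp
      moreover have "norm (s powr (- of_real (\<alpha> $ k))) = norm s powr (- (\<alpha> $ k))"
        using norm_powr_real_powr'[of "- of_real (\<alpha> $ k)" s] by simp
      ultimately show ?thesis using AX[of k] by (simp add: norm_mult mult_left_mono)
    qed
    have "m \<le> (\<Sum>k\<in>UNIV. \<bar>x0 $ k\<bar> / norm s + norm s powr (- (\<alpha> $ k)) * (row_sum A k * m))"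
      unfolding m_def
    proof (rule sum_mono, fold m_def)
      fix k
      have "norm (?X s $ k) \<le> norm (of_real (x0 $ k) / s) + norm (?X s $ k - of_real (x0 $ k) / s)"
        by (metis add.commute diff_add_cancel norm_triangle_ineq)
      then show "norm (?X s $ k) \<le> \<bar>x0 $ k\<bar> / norm s + norm s powr (- (\<alpha> $ k)) * (row_sum A k * m)"
        using diff[of k] by (simp add: norm_divide)
    qed
    also have "\<dots> \<le> (\<Sum>k\<in>UNIV. \<bar>x0 $ k\<bar> / norm s + L powr (- (\<alpha> $ k)) * (row_sum A k * m))"
    proof (intro sum_mono add_left_mono mult_right_mono)
      fix k
      show "norm s powr (- (\<alpha> $ k)) \<le> L powr (- (\<alpha> $ k))"
        using L(1) R(2) s(2) \<alpha>0[of k] by (intro powr_mono2') auto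
    qed (simp add: row_sum_nonneg m0)
    also have "\<dots> = S / norm s + (\<Sum>k\<in>UNIV. row_sum A k * L powr (- (\<alpha> $ k))) * m"
      by (simp add: sum.distrib S_def sum_divide_distrib sum_distrib_left mult_ac)
    \<comment> \<open>By the choice of L, the perturbation is absorbed into half of m.\<close>
    also have "\<dots> \<le> S / norm s + 1 / 2 * m" using L(2) m0 by (intro add_left_mono mult_right_mono)
    finally have m: "m \<le> 2 * S / norm s" by simp
    have "norm (?X s $ k - of_real (x0 $ k) / s) \<le> norm s powr (- a) * (Q * (2 * S / norm s))"
    proof (rule order_trans[OF diff[of k]], intro mult_mono m Q)
      show "norm s powr (- (\<alpha> $ k)) \<le> norm s powr (- a)" using s0 \<alpha>[of k] by (intro powr_mono) auto
    qed (use Q(2) m0 row_sum_nonneg[of A k] in auto)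
    also have "\<dots> = (2 * S * Q) * norm s powr (- 1 - a)"
    proof -
      have "norm s powr (- a) / norm s = norm s powr (- 1 - a)"
        using s0 powr_diff[of "norm s" "- a" 1] by (simp add: minus_diff_commute)
      then show ?thesis by (metis (no_types, opaque_lifting) mult.commute mult.left_commute
          times_divide_eq_right)
    qed
    finally have 1: "norm (?X s $ k - of_real (x0 $ k) / s) \<le> (2 * S * Q) * norm s powr (- 1 - a)" .
    have s1: "s + 1 \<noteq> 0" using norm_add_one_ge(1)[OF s(1)] by auto
    have "of_real (x0 $ k) / s - of_real (x0 $ k) / (s + 1) = of_real (x0 $ k) / (s * (s + 1))"
      using s0 s1 by (simp add: field_simps)
    also have "norm \<dots> \<le> S / (norm s * norm s)"
      unfolding norm_divide norm_mult norm_of_real using x0S[of k] norm_add_one_ge(2)[OF s(1)] s0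
      by (intro frac_le mult_left_mono mult_pos_pos S0) auto
    also have "\<dots> = S * norm s powr (- 2)" using s0 by (simp add: powr_minus_divide power2_eq_square)
    also have "\<dots> \<le> S * norm s powr (- 1 - a)" using s0 a1 S0
      by (intro mult_left_mono powr_mono) auto
    finally have 2: "norm (of_real (x0 $ k) / s - of_real (x0 $ k) / (s + 1))
        \<le> S * norm s powr (- 1 - a)" .
    have "norm (?X s $ k - of_real (x0 $ k) / (s + 1)) \<le> (2 * S * Q + S) * norm s powr (- 1 - a)"
      using norm_triangle_ineq[of "?X s $ k - of_real (x0 $ k) / s" "of_real (x0 $ k) / s
          - of_real (x0 $ k) / (s + 1)"] 1 2
      by (simp add: distrib_right)
    also have "\<dots> \<le> (2 * S * Q + S) * (2 * decay a (norm s))"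
      using S0 Q(2) s0 a by (intro mult_left_mono powr_le_decay_far) auto
    finally show ?thesis by (simp only: C2_def mult.assoc)
  qed
  show ?thesis
  proof (rule that[of "max C1 C2"])
    have "C2 \<ge> 0" using S0 Q(2) by (simp add: C2_def)
    then show "max C1 C2 \<ge> 0" by simp
    fix s :: complex and k assume s: "Re s \<ge> 0" "s \<noteq> 0"
    have "C1 * decay a (norm s) \<le> max C1 C2 * decay a (norm s)" "C2 * decay a (norm s)
        \<le> max C1 C2 * decay a (norm s)"
      by (intro mult_right_mono decay_nonneg; simp)+
    then show "norm (?X s $ k - of_real (x0 $ k) / (s + 1)) \<le> max C1 C2 * decay a (norm s)"
      using near[OF s] far[OF s(1)] by (meson linear order_trans)
  qed
qed

section \<open>Decay of all solutions in the absence of zeros\<close>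

text \<open>
Subtracting \<open>x(0) exp (- t)\<close> removes the jump at time 0 of the causal extension, and correspondingly
the non-integrable term \<open>x(0) / s\<close> at infinity of the transform, without affecting the limit.
\<close>

theorem volterra_solution_tendsto_zero:
  fixes \<alpha> :: "real ^ 'n::finite"
  assumes nz: "\<And>s. Re s \<ge> 0 \<Longrightarrow> char_fun \<alpha> A s \<noteq> 0"
    and \<alpha>: "\<And>k. 0 < \<alpha> $ k \<and> \<alpha> $ k \<le> 1" and x: "volterra_solution \<alpha> A x"
  shows "((\<lambda>t. x t $ k) \<longlongrightarrow> 0) at_top"
proof -
  have nz': "det (char_matrix \<alpha> A s) \<noteq> 0" if "Re s \<ge> 0" for s
    using nz[OF that] by (simp add: char_fun_eq_det)
  have \<alpha>0: "0 < \<alpha> $ k" for k using \<alpha> by blast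
  have cx: "continuous_on {0..} (\<lambda>t. x t $ k)"
    using x by (intro continuous_on_component) (simp add: volterra_solution_def)
  define a where "a = Min (range (($) \<alpha>))"
  have a: "0 < a" unfolding a_def using \<alpha>0 by (subst Min_gr_iff) auto
  have a_le: "a \<le> \<alpha> $ k \<and> \<alpha> $ k \<le> 1" for k unfolding a_def using \<alpha> by auto
  have a1: "a \<le> 1" using a_le by (meson order_trans)
  obtain C where C: "C \<ge> 0" "\<And>s k. Re s \<ge> 0 \<Longrightarrow> s \<noteq> 0 \<Longrightarrow>
      norm (resolvent_solution \<alpha> A (x 0) s $ k - of_real (x 0 $ k) / (s + 1))
          \<le> C * decay a (norm s)"
    using resolvent_solution_bound[OF nz' a_le a] by blast
  obtain D L where L: "L > 0" "\<And>t k. t \<ge> 0 \<Longrightarrow> \<bar>x t $ k\<bar> \<le> D * exp (L * t)"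
    by (rule volterra_solution_exp_bound[OF \<alpha>0 x]) (rule that)
  define F where "F s = resolvent_solution \<alpha> A (x 0) s $ k - of_real (x 0 $ k) / (s + 1)" for s
  define f where "f t = x t $ k - x 0 $ k * exp (- t)" for t
  have cf: "continuous_on {0..} f" unfolding f_def by (intro continuous_intros cx)
  have fb: "\<bar>f t\<bar> \<le> (D + \<bar>x 0 $ k\<bar>) * exp (L * t)" if "t \<ge> 0" for t
  proof -
    have "exp (- t) \<le> exp (L * t)" using that L(1) by (auto intro: order_trans[of _ 0])
    then have "\<bar>x 0 $ k\<bar> * exp (- t) \<le> \<bar>x 0 $ k\<bar> * exp (L * t)" by (rule mult_left_mono) simp
    moreover have "\<bar>f t\<bar> \<le> \<bar>x t $ k\<bar> + \<bar>x 0 $ k\<bar> * exp (- t)"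
      unfolding f_def using abs_triangle_ineq4[of "x t $ k" "x 0 $ k * exp (- t)"]
      by (simp add: abs_mult)
    ultimately show ?thesis using L(2)[OF that, of k] by (simp add: distrib_right)
  qed
  define c where "c = L + 1"
  have c: "c > 0" "c > L" using L(1) by (auto simp: c_def)
  have lf: "laplace (causal f) s = F s" if s: "Re s > L" for s
  proof -
    have s0: "Re s > 0" using s L(1) by simp
    have ix: "laplace_integrable (causal (\<lambda>t. x t $ k)) s"
      by (rule laplace_integrable_exp_bound[OF cx L(2) s])
    have ie: "laplace_integrable (causal (\<lambda>t. exp (- t))) s"
      by (rule laplace_integrable_exp_bound[of _ 1 0]) (use s0 in \<open>auto intro!: continuous_intros\<close>)
    have "laplace_vec x s = resolvent_solution \<alpha> A (x 0) s"
      using s0 s L(1) by (intro resolvent_solution_unique nz'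
          laplace_volterra_solution[OF \<alpha>0 x L(2)]) auto
    moreover have "laplace_vec x s $ k = laplace (causal (\<lambda>t. x t $ k)) s"
      by (simp add: laplace_vec_def)
    moreover have "causal f = (\<lambda>t. causal (\<lambda>t. x t $ k) t - x 0 $ k * causal (\<lambda>t. exp (- t)) t)"
      by (auto simp: causal_def f_def fun_eq_iff)
    ultimately show ?thesis
      using laplace_diff_scaled[OF ix ie, of "x 0 $ k"] laplace_causal_exp[OF s0]
      by (simp add: F_def)
  qed
  have F_hol: "F holomorphic_on {s. Re s > 0}"
    unfolding F_def
  proof (intro holomorphic_intros resolvent_solution_holomorphic nz')
    fix s :: complex assume "s \<in> {s. Re s > 0}"
    then show "s + 1 \<noteq> 0" using norm_add_one_ge(1)[of s] by auto
  qed auto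
  have F_cont: "continuous_on ({s. Re s \<ge> 0} - {0}) F"
    unfolding F_def
  proof (intro continuous_on_diff resolvent_solution_continuous[OF nz' \<alpha>0] continuous_on_divide
      continuous_intros)
    show "\<forall>s\<in>{s. Re s \<ge> 0} - {0}. s + 1 \<noteq> 0" using norm_add_one_ge(1) by fastforce
  qed
  have F_bound: "norm (F s) \<le> C * decay a \<bar>Im s\<bar>" if s: "0 \<le> Re s" "Im s \<noteq> 0" for s
  proof -
    have "norm (F s) \<le> C * decay a (norm s)" unfolding F_def using s by (intro C(2)) auto
    also have "\<dots> \<le> C * decay a \<bar>Im s\<bar>"
      using s a a1 C(1) abs_Im_le_cmod[of s] by (intro mult_left_mono decay_antimono) auto
    finally show ?thesis .
  qed
  have G_int: "integrable lborel (\<lambda>\<omega>. C * decay a \<bar>\<omega>\<bar>)"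
    by (intro integrable_mult_right integrable_decay a)
  have G_lim: "((\<lambda>r. C * decay a r) \<longlongrightarrow> 0) at_top"
    using tendsto_mult_left[OF tendsto_decay[OF a], of C] by simp
  define h where "h t = exp (- (complex_of_real c * of_real t)) * of_real (causal f t)" for t
  have h_int: "integrable lborel h"
    using laplace_integrable_exp_bound[OF cf fb, of "of_real c"] c
    unfolding laplace_integrable_def h_def by simp
  have "isCont (causal f) t" for t
  proof (cases "t = 0")
    case True
    have "continuous_on UNIV (\<lambda>t. f (max t 0))"
      by (intro continuous_on_compose2[OF cf] continuous_intros) auto
    moreover have "(\<lambda>t. f (max t 0)) = causal f" by (auto simp: fun_eq_iff causal_def f_def)
    ultimately show ?thesis by (simp add: continuous_on_eq_continuous_at)
  qed (rule isCont_causal[OF cf])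
  then have h_cont: "continuous_on UNIV h"
    unfolding h_def by (intro continuous_intros continuous_at_imp_continuous_on ballI) auto
  have h_bound: "norm (h t) \<le> D + \<bar>x 0 $ k\<bar>" for t
  proof (cases "t \<ge> 0")
    case True
    have D: "0 \<le> D + \<bar>x 0 $ k\<bar>" using fb[of 0] by simp
    have "norm (h t) = exp (- (c * t)) * \<bar>f t\<bar>" using True by (simp add: h_def norm_mult)
    also have "\<dots> \<le> exp (- (c * t)) * ((D + \<bar>x 0 $ k\<bar>) * exp (L * t))"
      by (intro mult_left_mono fb True) simp
    also have "\<dots> = (D + \<bar>x 0 $ k\<bar>) * exp (- t)" by (simp add: c_def algebra_simps flip: exp_add)
    also have "\<dots> \<le> (D + \<bar>x 0 $ k\<bar>) * 1" using True D by (intro mult_left_mono) auto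
    finally show ?thesis by simp
  next
    case False
    then show ?thesis using fb[of 0] by (simp add: h_def)
  qed
  have H_eq: "(LINT t|lborel. exp (- (\<i> * of_real (\<omega> * t))) * h t) = F (Complex c \<omega>)" for \<omega>
  proof -
    have "exp (- (\<i> * of_real (\<omega> * t))) * h t
        = exp (- (Complex c \<omega> * of_real t)) * of_real (causal f t)" for t
      by (simp add: h_def Complex_eq algebra_simps flip: exp_add)
    then have "(LINT t|lborel. exp (- (\<i> * of_real (\<omega> * t))) * h t)
        = laplace (causal f) (Complex c \<omega>)"
      by (simp add: laplace_def)
    then show ?thesis using lf[of "Complex c \<omega>"] c by simp
  qed
  have H_int: "integrable lborel (\<lambda>\<omega>. F (Complex c \<omega>))"
  proof (rule Bochner_Integration.integrable_bound[OF G_int])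
    have "continuous_on UNIV (\<lambda>\<omega>. F (Complex c \<omega>))"
      using c by (intro continuous_on_compose2[OF F_cont])
          (auto simp: Complex_eq complex_eq_iff intro!: continuous_intros)
    then show "(\<lambda>\<omega>. F (Complex c \<omega>)) \<in> borel_measurable lborel"
      using borel_measurable_continuous_onI by auto
    show "AE \<omega> in lborel. norm (F (Complex c \<omega>)) \<le> norm (C * decay a \<bar>\<omega>\<bar>)"
      using AE_lborel_singleton[of 0]
      by eventually_elim (use F_bound[of "Complex c _"] c in \<open>force intro: order_trans\<close>)
  qed
  have inv: "complex_of_real (f t) = (LINT \<omega>|lborel. exp (Complex c \<omega> * of_real t)
      * F (Complex c \<omega>)) / of_real (2 * pi)" if t: "t \<ge> 0" for t
  proof -
    have "h t = (LINT \<omega>|lborel. exp (\<i> * of_real (\<omega> * t)) * F (Complex c \<omega>)) / of_real (2 * pi)"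
      using fourier_inversion[OF h_int h_cont h_bound, of t] H_int by (simp only: H_eq)
    then have "exp (of_real (c * t)) * h t
        = (exp (of_real (c * t)) * (LINT \<omega>|lborel. exp (\<i> * of_real (\<omega> * t)) * F (Complex c \<omega>)))
        / of_real (2 * pi)"
      by simp
    also have "exp (of_real (c * t)) * (LINT \<omega>|lborel. exp (\<i> * of_real (\<omega> * t)) * F (Complex c \<omega>))
        =
        (LINT \<omega>|lborel. exp (of_real (c * t)) * (exp (\<i> * of_real (\<omega> * t)) * F (Complex c \<omega>)))"
      by (rule integral_mult_right_zero[symmetric])
    also have "\<dots> = (LINT \<omega>|lborel. exp (Complex c \<omega> * of_real t) * F (Complex c \<omega>))"
      by (rule Bochner_Integration.integral_cong)
          (auto simp: Complex_eq algebra_simps simp flip: exp_add)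
    finally have "exp (of_real (c * t)) * h t
        = (LINT \<omega>|lborel. exp (Complex c \<omega> * of_real t) * F (Complex c \<omega>)) / of_real (2 * pi)" .
    moreover have "exp (complex_of_real (c * t)) * h t = of_real (f t)"
      using t by (simp add: h_def exp_minus)
    ultimately show ?thesis by simp
  qed
  have "((\<lambda>t. complex_of_real (f t)) \<longlongrightarrow> 0) at_top"
    by (rule inverse_laplace_tendsto_zero[OF F_hol F_cont F_bound G_int G_lim c(1) inv])
  then have "(f \<longlongrightarrow> 0) at_top" using tendsto_of_real_iff[of f 0 at_top, where 'a=complex] by simp
  moreover have "((\<lambda>t. x 0 $ k * exp (- t)) \<longlongrightarrow> x 0 $ k * 0) at_top"
    by (intro tendsto_mult tendsto_const filterlim_compose[OF exp_at_bot]
        filterlim_uminus_at_bot_at_top)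
  ultimately have "((\<lambda>t. f t + x 0 $ k * exp (- t)) \<longlongrightarrow> 0 + x 0 $ k * 0) at_top" by (rule tendsto_add)
  then show ?thesis by (simp add: f_def)
qed

theorem stable_iff_no_char_zero:
  fixes \<alpha> :: "real ^ 'n::finite"
  assumes \<alpha>: "\<And>k. 0 < \<alpha> $ k \<and> \<alpha> $ k \<le> 1"
  shows "asymptotically_stable \<alpha> A \<longleftrightarrow> (\<forall>z. Re z \<ge> 0 \<longrightarrow> char_fun \<alpha> A z \<noteq> 0)"
proof
  assume "asymptotically_stable \<alpha> A"
  then show "\<forall>z. Re z \<ge> 0 \<longrightarrow> char_fun \<alpha> A z \<noteq> 0" using not_stable_if_char_zero[OF \<alpha>] by blast
next
  assume nz: "\<forall>z. Re z \<ge> 0 \<longrightarrow> char_fun \<alpha> A z \<noteq> 0"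
  show "asymptotically_stable \<alpha> A"
    unfolding asymptotically_stable_def
  proof (intro allI impI)
    fix x assume "frac_solution \<alpha> A x"
    then have "volterra_solution \<alpha> A x" using frac_solution_iff_volterra[OF \<alpha>] by blast
    then have "((\<lambda>t. x t $ k) \<longlongrightarrow> 0 $ k) at_top" for k
      unfolding zero_index using nz by (intro volterra_solution_tendsto_zero[OF _ \<alpha>]) blast+
    then show "(x \<longlongrightarrow> 0) at_top" by (rule vec_tendstoI)
  qed
qed

section \<open>From the characteristic function to the matrix polynomial\<close>

lemma unit_matrix_nth: "unit_matrix j $ a $ b = (if a = j \<and> b = j then 1 else 0)"
  by (simp add: unit_matrix_def matrix_matrix_mult_def columnvector_def rowvector_def axis_def)

lemma matrix_poly_nth:
  "matrix_poly A q \<mu> $ a $ b = (if a = b then \<mu> ^ q a else 0) - of_real (A $ a $ b)"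
proof -
  have "(\<Sum>j\<in>UNIV. map_matrix (\<lambda>c. complex_of_real c * \<mu> ^ q j) (unit_matrix j)) $ a $ b
      = (\<Sum>j\<in>UNIV. if j = a then (if a = b then \<mu> ^ q a else 0) else 0)"
    unfolding sum_component by (intro sum.cong) (auto simp: map_matrix_def unit_matrix_nth)
  then show ?thesis by (simp add: matrix_poly_def map_matrix_def)
qed

lemma Arg_powr_of_real:
  assumes "z \<noteq> 0" "\<bar>b * Arg z\<bar> < pi"
  shows "Arg (z powr of_real b) = b * Arg z"
proof -
  have "z powr of_real b = exp (of_real b * Ln z)" using assms(1) by (simp add: powr_def)
  moreover have im: "Im (of_real b * Ln z) = b * Arg z" using assms(1) by (simp add: Arg_eq_Im_Ln)
  moreover have "- pi < b * Arg z" "b * Arg z \<le> pi" using assms(2) by auto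
  ultimately show ?thesis using Arg_exp[of "of_real b * Ln z"] by metis
qed

text \<open>
The bound on the argument keeps \<open>b\<close> times the principal logarithm of \<open>z\<close> within the strip on which
the logarithm inverts the exponential.
\<close>

lemma powr_powr_of_real:
  assumes "z \<noteq> 0" "\<bar>b * Arg z\<bar> < pi"
  shows "(z powr of_real b) powr of_real c = z powr of_real (b * c)"
proof -
  have "Ln (exp (of_real b * Ln z)) = of_real b * Ln z"
    using assms by (intro Ln_exp) (auto simp: Arg_eq_Im_Ln abs_less_iff)
  then show ?thesis using assms(1) by (simp add: powr_def mult_ac)
qed

lemma char_matrix_eq_matrix_poly:
  fixes \<alpha> :: "real ^ 'n::finite"
  assumes "\<And>k. \<mu> ^ q k = z powr of_real (\<alpha> $ k)"
  shows "char_matrix \<alpha> A z = matrix_poly A q \<mu>"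
  by (simp add: vec_eq_iff char_matrix_nth matrix_poly_nth assms)

text \<open>
The maps \<open>z \<mapsto> z\<^sup>\<delta>\<close> and \<open>\<mu> \<mapsto> \<mu>\<^sup>1\<^sup>/\<^sup>\<delta>\<close> are inverse bijections between the closed right half-plane and
    the
sector of half-angle \<open>\<delta> \<pi> / 2\<close>, since on these sets the arguments stay inside the principal range.
\<close>

lemma char_zero_iff_matrix_poly_kernel:
  fixes \<alpha> :: "real ^ 'n::finite"
  assumes \<delta>: "0 < \<delta>" "\<delta> \<le> 1" and \<alpha>: "\<And>k. \<alpha> $ k = \<delta> * real (q k)" and q: "\<And>k. q k > 0"
  shows "(\<exists>z. char_fun \<alpha> A z = 0 \<and> \<bar>Arg z\<bar> \<le> pi / 2) \<longleftrightarrow>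
         (\<exists>\<mu>. \<bar>Arg \<mu>\<bar> \<le> \<delta> * (pi / 2) \<and> (\<exists>v. v \<noteq> 0 \<and> matrix_poly A q \<mu> *v v = 0))"
proof
  assume "\<exists>z. char_fun \<alpha> A z = 0 \<and> \<bar>Arg z\<bar> \<le> pi / 2"
  then obtain z where z: "char_fun \<alpha> A z = 0" "\<bar>Arg z\<bar> \<le> pi / 2" by blast
  define \<mu> where "\<mu> = z powr of_real \<delta>"
  have small: "\<bar>\<delta> * Arg z\<bar> \<le> \<delta> * (pi / 2)"
    using \<delta> z(2) mult_left_mono[of "\<bar>Arg z\<bar>" "pi / 2" \<delta>] by (simp add: abs_mult)
  have "\<delta> * (pi / 2) \<le> 1 * (pi / 2)" using \<delta> by (intro mult_right_mono) auto
  then have lt: "\<bar>\<delta> * Arg z\<bar> < pi" using small pi_gt_zero by linarith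
  have "\<mu> ^ q k = z powr of_real (\<alpha> $ k)" for k
  proof (cases "z = 0")
    case True
    then show ?thesis using q[of k] \<delta> by (simp add: \<mu>_def)
  next
    case False
    have "\<mu> ^ q k = \<mu> powr of_real (real (q k))" using False by (simp add: \<mu>_def)
    also have "\<dots> = z powr of_real (\<alpha> $ k)"
      unfolding \<mu>_def \<alpha> by (rule powr_powr_of_real[OF False lt])
    finally show ?thesis .
  qed
  then have "char_matrix \<alpha> A z = matrix_poly A q \<mu>" by (rule char_matrix_eq_matrix_poly)
  then have "\<exists>v. v \<noteq> 0 \<and> matrix_poly A q \<mu> *v v = 0"
    using z(1) by (simp add: char_fun_eq_det det_eq_0_iff_kernel)
  moreover have "\<bar>Arg \<mu>\<bar> \<le> \<delta> * (pi / 2)"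
  proof (cases "z = 0")
    case True
    then show ?thesis using \<delta> by (simp add: \<mu>_def Arg_zero)
  next
    case False
    show ?thesis using small unfolding \<mu>_def Arg_powr_of_real[OF False lt] .
  qed
  ultimately show "\<exists>\<mu>. \<bar>Arg \<mu>\<bar> \<le> \<delta> * (pi / 2) \<and> (\<exists>v. v \<noteq> 0 \<and> matrix_poly A q \<mu> *v v = 0)" by blast
next
  assume "\<exists>\<mu>. \<bar>Arg \<mu>\<bar> \<le> \<delta> * (pi / 2) \<and> (\<exists>v. v \<noteq> 0 \<and> matrix_poly A q \<mu> *v v = 0)"
  then obtain \<mu> where \<mu>: "\<bar>Arg \<mu>\<bar> \<le> \<delta> * (pi / 2)" "\<exists>v. v \<noteq> 0 \<and> matrix_poly A q \<mu> *v v = 0" by blast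
  define z where "z = \<mu> powr of_real (1 / \<delta>)"
  have small: "\<bar>1 / \<delta> * Arg \<mu>\<bar> \<le> pi / 2"
    using \<mu>(1) \<delta> by (simp add: abs_mult abs_divide field_simps)
  then have lt: "\<bar>1 / \<delta> * Arg \<mu>\<bar> < pi" using pi_gt_zero by linarith
  have "\<mu> ^ q k = z powr of_real (\<alpha> $ k)" for k
  proof (cases "\<mu> = 0")
    case True
    then show ?thesis using q[of k] \<delta> by (simp add: z_def \<alpha>)
  next
    case False
    have "z powr of_real (\<alpha> $ k) = \<mu> powr of_real (1 / \<delta> * \<alpha> $ k)"
      unfolding z_def by (rule powr_powr_of_real[OF False lt])
    also have "1 / \<delta> * \<alpha> $ k = real (q k)" using \<delta> by (simp add: \<alpha>)
    finally show ?thesis using False by simp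
  qed
  then have "char_matrix \<alpha> A z = matrix_poly A q \<mu>" by (rule char_matrix_eq_matrix_poly)
  then have "char_fun \<alpha> A z = 0" using \<mu>(2) by (simp add: char_fun_eq_det det_eq_0_iff_kernel)
  moreover have "\<bar>Arg z\<bar> \<le> pi / 2"
  proof (cases "\<mu> = 0")
    case True
    then show ?thesis using \<delta> by (simp add: z_def Arg_zero)
  next
    case False
    show ?thesis using small unfolding z_def Arg_powr_of_real[OF False lt] .
  qed
  ultimately show "\<exists>z. char_fun \<alpha> A z = 0 \<and> \<bar>Arg z\<bar> \<le> pi / 2" by blast
qed

theorem theorem3:
  fixes A :: "real ^ 'n ^ 'n" and \<alpha> :: "real ^ 'n" and \<alpha>max :: real
    and r s q :: "'n \<Rightarrow> nat" and \<sigma> :: nat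
  assumes "CARD('n) \<ge> 2"
    and "\<And>k. 0 < \<alpha> $ k \<and> \<alpha> $ k \<le> 1"
    and "\<not> (\<forall>j k. \<alpha> $ j = \<alpha> $ k)"
    and "\<alpha>max = Max (range (\<lambda>k. \<alpha> $ k))"
    and "\<And>k. \<alpha> $ k / \<alpha>max \<in> \<rat>"
    and "\<And>k. 0 < r k \<and> r k \<le> s k \<and> coprime (r k) (s k)"
    and "\<And>k. \<alpha> $ k = \<alpha>max * real (r k) / real (s k)"
    and "\<sigma> = (LCM k. s k)"
    and "\<And>k. q k = r k * \<sigma> div s k"
  shows "(\<not> asymptotically_stable \<alpha> A \<longleftrightarrow> (\<exists>z. char_fun \<alpha> A z = 0 \<and> \<bar>Arg z\<bar> \<le> pi / 2)) \<and>
         ((\<exists>z. char_fun \<alpha> A z = 0 \<and> \<bar>Arg z\<bar> \<le> pi / 2) \<longleftrightarrow>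
          (\<exists>\<mu>. \<bar>Arg \<mu>\<bar> \<le> pi * \<alpha>max / (2 * real \<sigma>) \<and> (\<exists>v. v \<noteq> 0 \<and> matrix_poly A q \<mu> *v v = 0)))"
proof
  show "\<not> asymptotically_stable \<alpha> A \<longleftrightarrow> (\<exists>z. char_fun \<alpha> A z = 0 \<and> \<bar>Arg z\<bar> \<le> pi / 2)"
    unfolding stable_iff_no_char_zero[OF assms(2)] Arg_Re_nonneg by blast
  have s_pos: "s k > 0" for k using assms(6)[of k] by linarith
  have dvd: "s k dvd \<sigma>" for k unfolding assms(8) by (rule dvd_Lcm) simp
  have "\<sigma> \<noteq> 0" unfolding assms(8) using s_pos by (subst Lcm_0_iff) (auto simp: less_imp_neq)
  then have \<sigma>: "\<sigma> \<ge> 1" by simp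
  have q_real: "real (q k) = real (r k) * real \<sigma> / real (s k)" for k
    unfolding assms(9) using dvd[of k] s_pos[of k] by (simp add: real_of_nat_div)
  have max_ge: "\<alpha> $ k \<le> \<alpha>max" for k unfolding assms(4) by (rule Max_ge) auto
  have max_pos: "\<alpha>max > 0" using max_ge assms(2) by (meson less_le_trans)
  have max_le: "\<alpha>max \<le> 1" unfolding assms(4) using assms(2) by (subst Max_le_iff) auto
  have q_pos: "q k > 0" for k
  proof -
    have "real (q k) > 0" unfolding q_real using assms(6)[of k] s_pos[of k] \<sigma> by simp
    then show ?thesis by simp
  qed
  have \<alpha>_eq: "\<alpha> $ k = \<alpha>max / real \<sigma> * real (q k)" for k
    unfolding q_real assms(7)[of k] using \<sigma> by (simp add: field_simps)
  have "\<alpha>max / real \<sigma> \<le> 1" using max_le max_pos \<sigma> by (simp add: divide_le_eq)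
  then have "(\<exists>z. char_fun \<alpha> A z = 0 \<and> \<bar>Arg z\<bar> \<le> pi / 2) \<longleftrightarrow>
      (\<exists>\<mu>. \<bar>Arg \<mu>\<bar> \<le> \<alpha>max / real \<sigma> * (pi / 2) \<and> (\<exists>v. v \<noteq> 0 \<and> matrix_poly A q \<mu> *v v = 0))"
    using max_pos \<sigma> \<alpha>_eq q_pos by (intro char_zero_iff_matrix_poly_kernel) auto
  also have "\<alpha>max / real \<sigma> * (pi / 2) = pi * \<alpha>max / (2 * real \<sigma>)" by (simp add: mult.commute)
  finally show "(\<exists>z. char_fun \<alpha> A z = 0 \<and> \<bar>Arg z\<bar> \<le> pi / 2) \<longleftrightarrow>
      (\<exists>\<mu>. \<bar>Arg \<mu>\<bar> \<le> pi * \<alpha>max / (2 * real \<sigma>) \<and> (\<exists>v. v \<noteq> 0 \<and> matrix_poly A q \<mu> *v v = 0))" .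
qed

end
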